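(* Let $(X,\Sigma,\mu)$ be a measure space, where $\mu$ is a semi-finite measure. Take a regular vector sublattice $E$ of $\mathrm{L}_0(X,\Sigma,\mu)$. Then $E$ admits a (necessarily unique) Hausdorff uo-Lebesgue topology $\widehat\tau_E$. This topology $\widehat\tau_E$ is the restriction to $E$ of the (unique) Hausdorff uo-Lebesgue topology on $\mathrm{L}_0(X,\Sigma,\mu)$. For every $p$ with $1\le p<\infty$, a net $(f_\alpha)_{\alpha\in\mathcal A}$ in $E$ converges to zero in $\widehat\tau_E$ if and only if it satisfies one of the following three equivalent criteria: (i) $\int_X|f_\alpha|^p\wedge 1_A\,d\mu\to 0$ for every measurable subset $A$ of $X$ with finite measure; (ii) $\int_X|f_\alpha|^p\wedge|f|^p\,d\mu\to 0$ for every $f\in\mathrm{L}_p(X,\Sigma,\mu)$; (iii) $f_\alpha\to 0$ in measure on subsets of finite measure. In particular, a net in $E$ is $\widehat\tau_E$-convergent to zero if and only if it converges to zero in measure on subsets of finite measure.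
   Context: $\mathrm{L}_0(X,\Sigma,\mu)$ is the vector lattice of all real-valued $\Sigma$-measurable functions on $X$, with identification of functions that agree $\mu$-almost everywhere. A measure $\mu$ (with values in $[0,\infty]$) is semi-finite if every $A\in\Sigma$ with $\mu(A)=\infty$ has a measurable subset $A'$ with $0<\mu(A')<\infty$. A net $(f_\alpha)$ in $\mathrm{L}_0(X,\Sigma,\mu)$ converges to $f$ in measure on subsets of finite measure if for all $A\in\Sigma$ with $\mu(A)<\infty$ and all $\varepsilon>0$, $\mu(\{x\in A:|f_\alpha(x)-f(x)|\ge\varepsilon\})\to 0$. A vector sublattice $F$ of a vector lattice $E$ is regular if for every net in $F$, $x_\alpha\downarrow 0$ in $F$ implies $x_\alpha\downarrow 0$ in $E$. A net $(x_\alpha)_{\alpha\in\mathcal A}$ in a vector lattice $E$ is order convergent to $x$ if there is a net $(y_\beta)_{\beta\in\mathcal B}$ in $E$ (possibly with a different index set) with $y_\beta\downarrow 0$ such that for every $\beta_0\in\mathcal B$ there is $\alpha_0\in\mathcal A$ with $|x-x_\alpha|\le y_{\beta_0}$ for all $\alpha\ge\alpha_0$; it is unbounded order convergent (uo-convergent) to $x$ if $|x_\alpha-x|\wedge y$ is order convergent to $0$ in $E$ for all $y\in E^+$. A uo-Lebesgue topology on $E$ is a locally solid linear topology (a vector space topology, not necessarily Hausdorff, with a base of solid neighbourhoods of $0$) such that uo-convergence of a net to $x$ implies its topological convergence to $x$. *)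

theory Defs
  imports "HOL-Analysis.Analysis" "HOL-Algebra.Lattice" "HOL-Algebra.Group"
begin

section \<open>Nets\<close>

definition directed :: "'i set \<Rightarrow> ('i \<Rightarrow> 'i \<Rightarrow> bool) \<Rightarrow> bool" where
  "directed I r \<longleftrightarrow> I \<noteq> {} \<and> (\<forall>i\<in>I. r i i) \<and>
     (\<forall>i\<in>I. \<forall>j\<in>I. \<forall>k\<in>I. r i j \<longrightarrow> r j k \<longrightarrow> r i k) \<and>
     (\<forall>i\<in>I. \<forall>j\<in>I. \<exists>k\<in>I. r i k \<and> r j k)"

lemma directed_nonempty: "directed I r \<Longrightarrow> I \<noteq> {}"
  by (simp add: directed_def)

lemma directed_refl: "directed I r \<Longrightarrow> i \<in> I \<Longrightarrow> r i i"
  by (simp add: directed_def)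

lemma directed_trans:
  "directed I r \<Longrightarrow> i \<in> I \<Longrightarrow> j \<in> I \<Longrightarrow> k \<in> I \<Longrightarrow> r i j \<Longrightarrow> r j k \<Longrightarrow> r i k"
  unfolding directed_def by metis

lemma directed_ub:
  assumes "directed I r" "i \<in> I" "j \<in> I"
  obtains k where "k \<in> I" "r i k" "r j k"
  using assms unfolding directed_def by metis

text \<open>The filter of tails. A net indexed by the directed set \<open>I\<close> is a function restricted to
  \<open>I\<close>, and its convergence is convergence along this filter.\<close>

definition net_filter :: "'i set \<Rightarrow> ('i \<Rightarrow> 'i \<Rightarrow> bool) \<Rightarrow> 'i filter" where
  "net_filter I r = (INF i\<in>I. principal {j\<in>I. r i j})"

lemma eventually_net_filter:
  assumes "directed I r"
  shows "eventually P (net_filter I r) \<longleftrightarrow> (\<exists>i\<in>I. \<forall>j\<in>I. r i j \<longrightarrow> P j)"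
proof -
  have "eventually P (net_filter I r) \<longleftrightarrow> (\<exists>i\<in>I. eventually P (principal {j\<in>I. r i j}))"
    unfolding net_filter_def
  proof (rule eventually_INF_base)
    show "I \<noteq> {}" using assms by (rule directed_nonempty)
  next
    fix a b assume "a \<in> I" "b \<in> I"
    then obtain k where k: "k \<in> I" "r a k" "r b k" using directed_ub[OF assms] by metis
    have "{j\<in>I. r k j} \<subseteq> {j\<in>I. r a j} \<inter> {j\<in>I. r b j}"
      using directed_trans[OF assms \<open>a \<in> I\<close> k(1) _ k(2)] directed_trans[OF assms \<open>b \<in> I\<close> k(1) _ k(3)]
      by auto
    then show "\<exists>x\<in>I. principal {j\<in>I. r x j} \<le>
        Lattices.inf (principal {j\<in>I. r a j}) (principal {j\<in>I. r b j})"
      using k by (intro bexI[of _ k]) auto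
  qed
  then show ?thesis by (auto simp: eventually_principal)
qed

section \<open>Vector lattices\<close>

record 'a vlattice = "'a gorder" +
  vadd :: "'a \<Rightarrow> 'a \<Rightarrow> 'a"
  vzero :: 'a
  vscale :: "real \<Rightarrow> 'a \<Rightarrow> 'a"

locale vector_lattice = Lattice.lattice V for V :: "('a, 'm) vlattice_scheme" (structure) +
  assumes add_group: "comm_group \<lparr>carrier = carrier V, monoid.mult = vadd V, one = vzero V\<rparr>"
    and scale_closed: "x \<in> carrier V \<Longrightarrow> vscale V c x \<in> carrier V"
    and scale_one: "x \<in> carrier V \<Longrightarrow> vscale V 1 x = x"
    and scale_scale: "x \<in> carrier V \<Longrightarrow> vscale V c (vscale V d x) = vscale V (c * d) x"
    and scale_add_left: "x \<in> carrier V \<Longrightarrow> vscale V (c + d) x = vadd V (vscale V c x) (vscale V d x)"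
    and scale_add_right: "x \<in> carrier V \<Longrightarrow> y \<in> carrier V \<Longrightarrow>
          vscale V c (vadd V x y) = vadd V (vscale V c x) (vscale V c y)"
    and add_mono: "x \<in> carrier V \<Longrightarrow> y \<in> carrier V \<Longrightarrow> z \<in> carrier V \<Longrightarrow>
          x \<sqsubseteq>\<^bsub>V\<^esub> y \<Longrightarrow> vadd V x z \<sqsubseteq>\<^bsub>V\<^esub> vadd V y z"
    and scale_mono: "x \<in> carrier V \<Longrightarrow> y \<in> carrier V \<Longrightarrow> 0 \<le> c \<Longrightarrow>
          x \<sqsubseteq>\<^bsub>V\<^esub> y \<Longrightarrow> vscale V c x \<sqsubseteq>\<^bsub>V\<^esub> vscale V c y"

definition vdiff :: "('a, 'm) vlattice_scheme \<Rightarrow> 'a \<Rightarrow> 'a \<Rightarrow> 'a" where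
  "vdiff V x y = vadd V x (vscale V (-1) y)"

definition vabs :: "('a, 'm) vlattice_scheme \<Rightarrow> 'a \<Rightarrow> 'a" where
  "vabs V x = x \<squnion>\<^bsub>V\<^esub> vscale V (-1) x"

text \<open>A sublattice \<open>F\<close> of \<open>V\<close> is treated as a vector lattice in its own right through
  \<open>restrict_vl V F\<close>, so that joins, meets, infima and nets are those of \<open>F\<close>.\<close>

abbreviation restrict_vl :: "('a, 'm) vlattice_scheme \<Rightarrow> 'a set \<Rightarrow> ('a, 'm) vlattice_scheme" where
  "restrict_vl V F \<equiv> V\<lparr>carrier := F\<rparr>"

definition vector_sublattice :: "('a, 'm) vlattice_scheme \<Rightarrow> 'a set \<Rightarrow> bool" where
  "vector_sublattice V F \<longleftrightarrow> F \<subseteq> carrier V \<and> vzero V \<in> F \<and>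
     (\<forall>x\<in>F. \<forall>y\<in>F. vadd V x y \<in> F) \<and> (\<forall>c. \<forall>x\<in>F. vscale V c x \<in> F) \<and>
     (\<forall>x\<in>F. \<forall>y\<in>F. x \<squnion>\<^bsub>V\<^esub> y \<in> F \<and> x \<sqinter>\<^bsub>V\<^esub> y \<in> F)"

definition decreases_to ::
  "('a, 'm) vlattice_scheme \<Rightarrow> 'i set \<Rightarrow> ('i \<Rightarrow> 'i \<Rightarrow> bool) \<Rightarrow> ('i \<Rightarrow> 'a) \<Rightarrow> 'a \<Rightarrow> bool" where
  "decreases_to V I r y x \<longleftrightarrow> directed I r \<and> y \<in> I \<rightarrow> carrier V \<and>
     (\<forall>i\<in>I. \<forall>j\<in>I. r i j \<longrightarrow> y j \<sqsubseteq>\<^bsub>V\<^esub> y i) \<and> is_glb V x (y ` I)"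

text \<open>HOL cannot quantify over index types inside a formula, so the decreasing nets in the next two
  definitions are indexed by directed sets on the type \<open>'a\<close> of the elements of the lattice. This is no
  restriction, because a decreasing net may be replaced by its range with the reversed order; see
  \<open>regular_sublatticeD\<close> and \<open>order_convergentI\<close>.\<close>

definition regular_sublattice :: "('a, 'm) vlattice_scheme \<Rightarrow> 'a set \<Rightarrow> bool" where
  "regular_sublattice V F \<longleftrightarrow> vector_sublattice V F \<and>
     (\<forall>(I :: 'a set) r y. decreases_to (restrict_vl V F) I r y (vzero V)
        \<longrightarrow> decreases_to V I r y (vzero V))"

definition order_convergent ::
  "('a, 'm) vlattice_scheme \<Rightarrow> 'i set \<Rightarrow> ('i \<Rightarrow> 'i \<Rightarrow> bool) \<Rightarrow> ('i \<Rightarrow> 'a) \<Rightarrow> 'a \<Rightarrow> bool" where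
  "order_convergent V I r f x \<longleftrightarrow>
     (\<exists>(J :: 'a set) s y. decreases_to V J s y (vzero V) \<and>
        (\<forall>j\<in>J. \<exists>i0\<in>I. \<forall>i\<in>I. r i0 i \<longrightarrow> vabs V (vdiff V x (f i)) \<sqsubseteq>\<^bsub>V\<^esub> y j))"

definition uo_convergent ::
  "('a, 'm) vlattice_scheme \<Rightarrow> 'i set \<Rightarrow> ('i \<Rightarrow> 'i \<Rightarrow> bool) \<Rightarrow> ('i \<Rightarrow> 'a) \<Rightarrow> 'a \<Rightarrow> bool" where
  "uo_convergent V I r f x \<longleftrightarrow>
     (\<forall>y\<in>carrier V. vzero V \<sqsubseteq>\<^bsub>V\<^esub> y \<longrightarrow>
        order_convergent V I r (\<lambda>i. vabs V (vdiff V (f i) x) \<sqinter>\<^bsub>V\<^esub> y) (vzero V))"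

lemma directed_range:
  assumes "decreases_to V I r y x"
    and trans: "\<And>a b c. a \<in> carrier V \<Longrightarrow> b \<in> carrier V \<Longrightarrow> c \<in> carrier V \<Longrightarrow>
          a \<sqsubseteq>\<^bsub>V\<^esub> b \<Longrightarrow> b \<sqsubseteq>\<^bsub>V\<^esub> c \<Longrightarrow> a \<sqsubseteq>\<^bsub>V\<^esub> c"
  shows "decreases_to V (y ` I) (\<lambda>a b. b \<sqsubseteq>\<^bsub>V\<^esub> a \<or> a = b) (\<lambda>a. a) x"
proof -
  have dir: "directed I r" and y: "\<And>i. i \<in> I \<Longrightarrow> y i \<in> carrier V"
    and mono: "\<And>i j. i \<in> I \<Longrightarrow> j \<in> I \<Longrightarrow> r i j \<Longrightarrow> y j \<sqsubseteq>\<^bsub>V\<^esub> y i"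
    and glb: "is_glb V x (y ` I)"
    using assms(1) unfolding decreases_to_def by auto
  have refl: "y j \<sqsubseteq>\<^bsub>V\<^esub> y j" if "j \<in> I" for j
    using mono[OF that that] directed_refl[OF dir that] by simp
  have tr: "\<And>a b c. a \<in> y ` I \<Longrightarrow> b \<in> y ` I \<Longrightarrow> c \<in> y ` I \<Longrightarrow>
          b \<sqsubseteq>\<^bsub>V\<^esub> a \<or> a = b \<Longrightarrow> c \<sqsubseteq>\<^bsub>V\<^esub> b \<or> b = c \<Longrightarrow> c \<sqsubseteq>\<^bsub>V\<^esub> a \<or> a = c"
  proof -
    fix a b c assume "a \<in> y ` I" "b \<in> y ` I" "c \<in> y ` I"
      and ab: "b \<sqsubseteq>\<^bsub>V\<^esub> a \<or> a = b" and bc: "c \<sqsubseteq>\<^bsub>V\<^esub> b \<or> b = c"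
    then have "a \<in> carrier V" "b \<in> carrier V" "c \<in> carrier V" using y by auto
    then show "c \<sqsubseteq>\<^bsub>V\<^esub> a \<or> a = c" using ab bc trans[of c b a] by metis
  qed
  have up: "\<exists>k\<in>y ` I. (k \<sqsubseteq>\<^bsub>V\<^esub> a \<or> a = k) \<and> (k \<sqsubseteq>\<^bsub>V\<^esub> b \<or> b = k)" if ab: "a \<in> y ` I" "b \<in> y ` I" for a b
  proof -
    obtain i j where ij: "i \<in> I" "j \<in> I" "a = y i" "b = y j" using ab by blast
    then obtain k where k: "k \<in> I" "r i k" "r j k" using directed_ub[OF dir] by metis
    then show ?thesis using ij mono[OF ij(1) k(1,2)] mono[OF ij(2) k(1,3)] by auto
  qed
  have "directed (y ` I) (\<lambda>a b. b \<sqsubseteq>\<^bsub>V\<^esub> a \<or> a = b)"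
    unfolding directed_def
  proof (intro conjI ballI impI)
    show "y ` I \<noteq> {}" using directed_nonempty[OF dir] by simp
  next
    fix a show "a \<sqsubseteq>\<^bsub>V\<^esub> a \<or> a = a" by simp
  next
    fix a b c assume "a \<in> y ` I" "b \<in> y ` I" "c \<in> y ` I"
      "b \<sqsubseteq>\<^bsub>V\<^esub> a \<or> a = b" "c \<sqsubseteq>\<^bsub>V\<^esub> b \<or> b = c"
    then show "c \<sqsubseteq>\<^bsub>V\<^esub> a \<or> a = c" by (rule tr)
  next
    fix a b assume "a \<in> y ` I" "b \<in> y ` I"
    then show "\<exists>k\<in>y ` I. (k \<sqsubseteq>\<^bsub>V\<^esub> a \<or> a = k) \<and> (k \<sqsubseteq>\<^bsub>V\<^esub> b \<or> b = k)" by (rule up)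
  qed
  moreover have "\<forall>a\<in>y ` I. a \<in> carrier V" using y by blast
  moreover have "\<forall>a\<in>y ` I. \<forall>b\<in>y ` I. b \<sqsubseteq>\<^bsub>V\<^esub> a \<or> a = b \<longrightarrow> b \<sqsubseteq>\<^bsub>V\<^esub> a"
    using refl by blast
  ultimately show ?thesis
    using glb unfolding decreases_to_def image_ident Pi_iff by (intro conjI) assumption+
qed

lemma (in vector_lattice) decreases_to_range:
  assumes "decreases_to V I r y x"
  shows "decreases_to V (y ` I) (\<lambda>a b. b \<sqsubseteq>\<^bsub>V\<^esub> a \<or> a = b) (\<lambda>a. a) x"
  by (rule directed_range[OF assms]) (rule le_trans)

lemma (in vector_lattice) order_convergentI:
  fixes J :: "'j set"
  assumes "decreases_to V J s y (vzero V)"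
    and "\<And>j. j \<in> J \<Longrightarrow> \<exists>i0\<in>I. \<forall>i\<in>I. r i0 i \<longrightarrow> vabs V (vdiff V x (f i)) \<sqsubseteq>\<^bsub>V\<^esub> y j"
  shows "order_convergent V I r f x"
  unfolding order_convergent_def
proof (intro exI conjI ballI)
  show "decreases_to V (y ` J) (\<lambda>a b. b \<sqsubseteq>\<^bsub>V\<^esub> a \<or> a = b) (\<lambda>a. a) (vzero V)"
    by (rule decreases_to_range[OF assms(1)])
  fix b assume "b \<in> y ` J"
  then obtain j where "j \<in> J" "b = y j" by blast
  then show "\<exists>i0\<in>I. \<forall>i\<in>I. r i0 i \<longrightarrow> vabs V (vdiff V x (f i)) \<sqsubseteq>\<^bsub>V\<^esub> b"
    using assms(2) by simp
qed

lemma (in vector_lattice) regular_sublatticeD: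
  fixes I :: "'i set"
  assumes reg: "regular_sublattice V F" and dec: "decreases_to (restrict_vl V F) I r y (vzero V)"
  shows "decreases_to V I r y (vzero V)"
proof -
  have F: "F \<subseteq> carrier V" using reg by (simp add: regular_sublattice_def vector_sublattice_def)
  have "decreases_to (restrict_vl V F) (y ` I) (\<lambda>a b. b \<sqsubseteq>\<^bsub>V\<^esub> a \<or> a = b) (\<lambda>a. a) (vzero V)"
    using directed_range[OF dec] F le_trans unfolding subset_eq by simp
  then have "decreases_to V (y ` I) (\<lambda>a b. b \<sqsubseteq>\<^bsub>V\<^esub> a \<or> a = b) (\<lambda>a. a) (vzero V)"
    using reg by (simp add: regular_sublattice_def)
  then have "is_glb V (vzero V) (y ` I)" by (simp add: decreases_to_def)
  then show ?thesis using dec F unfolding decreases_to_def by auto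
qed

section \<open>uo-Lebesgue topologies\<close>

definition linear_topology :: "('a, 'm) vlattice_scheme \<Rightarrow> 'a topology \<Rightarrow> bool" where
  "linear_topology V T \<longleftrightarrow> topspace T = carrier V \<and>
     continuous_map (prod_topology T T) T (\<lambda>(x, y). vadd V x y) \<and>
     continuous_map (prod_topology euclideanreal T) T (\<lambda>(c, x). vscale V c x)"

definition solid :: "('a, 'm) vlattice_scheme \<Rightarrow> 'a set \<Rightarrow> bool" where
  "solid V S \<longleftrightarrow> S \<subseteq> carrier V \<and>
     (\<forall>x\<in>S. \<forall>y\<in>carrier V. vabs V y \<sqsubseteq>\<^bsub>V\<^esub> vabs V x \<longrightarrow> y \<in> S)"

definition locally_solid :: "('a, 'm) vlattice_scheme \<Rightarrow> 'a topology \<Rightarrow> bool" where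
  "locally_solid V T \<longleftrightarrow> linear_topology V T \<and>
     (\<forall>U. openin T U \<and> vzero V \<in> U \<longrightarrow>
        (\<exists>S W. solid V S \<and> S \<subseteq> U \<and> openin T W \<and> vzero V \<in> W \<and> W \<subseteq> S))"

text \<open>Again the index type is fixed. The type \<open>'a \<times> 'a set\<close> is large enough: the values of
  any net have the same tail filter as those of a net indexed by pairs of a point and a tail
  containing it, and convergence depends on that filter only; see \<open>uo_LebesgueD\<close>.\<close>

definition uo_Lebesgue :: "('a, 'm) vlattice_scheme \<Rightarrow> 'a topology \<Rightarrow> bool" where
  "uo_Lebesgue V T \<longleftrightarrow> locally_solid V T \<and>
     (\<forall>(I :: ('a \<times> 'a set) set) r f x.
        directed I r \<and> f \<in> I \<rightarrow> carrier V \<and> x \<in> carrier V \<and> uo_convergent V I r f x \<longrightarrow>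
        limitin T f x (net_filter I r))"

lemma tail_net:
  fixes f :: "'i \<Rightarrow> 'a"
  assumes "directed I r"
  obtains J :: "('a \<times> 'a set) set" and s
  where "directed J s" and "fst ` J \<subseteq> f ` I"
    and "\<And>P. (\<exists>j0\<in>J. \<forall>j\<in>J. s j0 j \<longrightarrow> P (fst j)) \<longleftrightarrow> (\<exists>i0\<in>I. \<forall>i\<in>I. r i0 i \<longrightarrow> P (f i))"
proof -
  define tl where "tl i = f ` {k\<in>I. r i k}" for i
  define J where "J = {(a, S). a \<in> S \<and> S \<in> tl ` I}"
  define s where "s = (\<lambda>(p :: 'a \<times> 'a set) (q :: 'a \<times> 'a set). snd q \<subseteq> snd p)"
  have ne: "f i \<in> tl i" if "i \<in> I" for i using directed_refl[OF assms that] that by (auto simp: tl_def)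
  have mem: "(f i, tl i) \<in> J" if "i \<in> I" for i using ne that by (auto simp: J_def)
  have mono: "tl k \<subseteq> tl i" if "i \<in> I" "k \<in> I" "r i k" for i k
    using directed_trans[OF assms that(1,2) _ that(3)] unfolding tl_def by auto
  have up: "\<exists>p\<in>J. s q p \<and> s q' p" if q: "q \<in> J" "q' \<in> J" for q q'
  proof -
    obtain i i' where i: "i \<in> I" "i' \<in> I" "snd q = tl i" "snd q' = tl i'"
      using q by (auto simp: J_def)
    then obtain k where k: "k \<in> I" "r i k" "r i' k" using directed_ub[OF assms] by metis
    have "tl k \<subseteq> tl i" "tl k \<subseteq> tl i'" using mono i k by simp_all
    then show ?thesis using mem[OF k(1)] i by (intro bexI[of _ "(f k, tl k)"]) (simp_all add: s_def)
  qed
  show thesis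
  proof (rule that[of J s])
    show "directed J s"
      unfolding directed_def
    proof (intro conjI ballI impI)
      show "J \<noteq> {}" using mem directed_nonempty[OF assms] by auto
    qed (use up in \<open>auto simp: s_def\<close>)
    show "fst ` J \<subseteq> f ` I" by (auto simp: J_def tl_def)
    fix P
    show "(\<exists>j0\<in>J. \<forall>j\<in>J. s j0 j \<longrightarrow> P (fst j)) \<longleftrightarrow> (\<exists>i0\<in>I. \<forall>i\<in>I. r i0 i \<longrightarrow> P (f i))"
    proof
      assume "\<exists>j0\<in>J. \<forall>j\<in>J. s j0 j \<longrightarrow> P (fst j)"
      then obtain j0 where j0: "j0 \<in> J" "\<And>j. j \<in> J \<Longrightarrow> s j0 j \<Longrightarrow> P (fst j)" by blast
      then obtain i where i: "i \<in> I" "snd j0 = tl i" by (auto simp: J_def)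
      have "P (f k)" if "k \<in> I" "r i k" for k
        using j0(2)[OF mem[OF \<open>k \<in> I\<close>]] mono[OF i(1) that] i by (simp add: s_def)
      then show "\<exists>i0\<in>I. \<forall>i\<in>I. r i0 i \<longrightarrow> P (f i)" using i by blast
    next
      assume "\<exists>i0\<in>I. \<forall>i\<in>I. r i0 i \<longrightarrow> P (f i)"
      then obtain i where i: "i \<in> I" "\<And>k. k \<in> I \<Longrightarrow> r i k \<Longrightarrow> P (f k)" by blast
      have "P (fst j)" if "j \<in> J" "s (f i, tl i) j" for j
      proof -
        have "fst j \<in> snd j" "snd j \<subseteq> tl i" using that by (auto simp: J_def s_def)
        then show ?thesis using i(2) by (auto simp: tl_def)
      qed
      then show "\<exists>j0\<in>J. \<forall>j\<in>J. s j0 j \<longrightarrow> P (fst j)" using mem[OF i(1)] by blast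
    qed
  qed
qed

lemma uo_LebesgueD:
  fixes I :: "'i set"
  assumes uo: "uo_Lebesgue V T" and I: "directed I r" and f: "f \<in> I \<rightarrow> carrier V"
    and x: "x \<in> carrier V" and conv: "uo_convergent V I r f x"
  shows "limitin T f x (net_filter I r)"
proof -
  obtain J :: "('a \<times> 'a set) set" and s where J: "directed J s" "fst ` J \<subseteq> f ` I"
    and ev: "\<And>P. (\<exists>j0\<in>J. \<forall>j\<in>J. s j0 j \<longrightarrow> P (fst j)) \<longleftrightarrow> (\<exists>i0\<in>I. \<forall>i\<in>I. r i0 i \<longrightarrow> P (f i))"
    by (rule tail_net[OF I, of f]) blast
  have "uo_convergent V J s fst x"
    using conv unfolding uo_convergent_def order_convergent_def
      ev[of "\<lambda>a. vabs V (vdiff V (vzero V) (vabs V (vdiff V a x) \<sqinter>\<^bsub>V\<^esub> y)) \<sqsubseteq>\<^bsub>V\<^esub> b" for y b] .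
  moreover have "fst \<in> J \<rightarrow> carrier V" using J f by fastforce
  ultimately have "limitin T fst x (net_filter J s)"
    using uo J x unfolding uo_Lebesgue_def by blast
  then show ?thesis
    unfolding limitin_def eventually_net_filter[OF I] eventually_net_filter[OF J(1)]
      ev[of "\<lambda>a. a \<in> U" for U] .
qed

definition hausdorff_uo_Lebesgue :: "('a, 'm) vlattice_scheme \<Rightarrow> 'a topology \<Rightarrow> bool" where
  "hausdorff_uo_Lebesgue V T \<longleftrightarrow> uo_Lebesgue V T \<and> Hausdorff_space T"

text \<open>Only meaningful where existence and uniqueness hold.\<close>

definition uo_Lebesgue_topology :: "('a, 'm) vlattice_scheme \<Rightarrow> 'a topology" where
  "uo_Lebesgue_topology V = (THE T. hausdorff_uo_Lebesgue V T)"

section \<open>Spaces of measurable functions\<close>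

text \<open>The locale \<open>semifinite_measure\<close> of HOL-Analysis does not require \<open>0 < emeasure M B\<close>, so it
  is satisfied by every measure (take \<open>B = {}\<close>) and cannot be used here.\<close>

definition semi_finite :: "'x measure \<Rightarrow> bool" where
  "semi_finite M \<longleftrightarrow> (\<forall>A\<in>sets M. emeasure M A = \<infinity> \<longrightarrow>
     (\<exists>B\<in>sets M. B \<subseteq> A \<and> 0 < emeasure M B \<and> emeasure M B < \<infinity>))"

definition ae_rel :: "'x measure \<Rightarrow> (('x \<Rightarrow> real) \<times> ('x \<Rightarrow> real)) set" where
  "ae_rel M = {(f, g). f \<in> borel_measurable M \<and> g \<in> borel_measurable M \<and> (AE x in M. f x = g x)}"

definition ae_class :: "'x measure \<Rightarrow> ('x \<Rightarrow> real) \<Rightarrow> ('x \<Rightarrow> real) set" where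
  "ae_class M f = ae_rel M `` {f}"

definition rep :: "('x \<Rightarrow> real) set \<Rightarrow> 'x \<Rightarrow> real" where
  "rep a = (SOME f. f \<in> a)"

text \<open>The elements of \<open>L0 M\<close> are classes modulo \<open>\<mu>\<close>-almost everywhere equality on \<open>space M\<close>, and
  \<open>rep\<close> picks a member of a class. Everything below is independent of that choice.\<close>

definition L0 :: "'x measure \<Rightarrow> ('x \<Rightarrow> real) set vlattice" where
  "L0 M = \<lparr>carrier = borel_measurable M // ae_rel M,
     eq = (=),
     le = (\<lambda>a b. AE x in M. rep a x \<le> rep b x),
     vadd = (\<lambda>a b. ae_class M (\<lambda>x. rep a x + rep b x)),
     vzero = ae_class M (\<lambda>x. 0),
     vscale = (\<lambda>c a. ae_class M (\<lambda>x. c * rep a x))\<rparr>"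

definition Lp :: "'x measure \<Rightarrow> real \<Rightarrow> ('x \<Rightarrow> real) set set" where
  "Lp M p = {a \<in> carrier (L0 M). (\<integral>\<^sup>+x. \<bar>rep a x\<bar> powr p \<partial>M) < \<infinity>}"

definition converges_in_measure ::
  "'x measure \<Rightarrow> 'i set \<Rightarrow> ('i \<Rightarrow> 'i \<Rightarrow> bool) \<Rightarrow> ('i \<Rightarrow> ('x \<Rightarrow> real) set) \<Rightarrow> ('x \<Rightarrow> real) set \<Rightarrow> bool" where
  "converges_in_measure M I r f a \<longleftrightarrow>
     (\<forall>A\<in>sets M. emeasure M A < \<infinity> \<longrightarrow> (\<forall>\<epsilon>>0.
        ((\<lambda>i. emeasure M {x\<in>A. \<epsilon> \<le> \<bar>rep (f i) x - rep a x\<bar>}) \<longlongrightarrow> 0) (net_filter I r)))"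

lemma equiv_ae_rel: "equiv (borel_measurable M) (ae_rel M)"
  by (rule equivI) (auto simp: ae_rel_def refl_on_def sym_def trans_def elim: AE_mp)

lemma ae_class_in_L0: "f \<in> borel_measurable M \<Longrightarrow> ae_class M f \<in> carrier (L0 M)"
  by (simp add: L0_def ae_class_def quotientI)

lemma ae_class_eq_iff:
  "f \<in> borel_measurable M \<Longrightarrow> g \<in> borel_measurable M \<Longrightarrow>
     ae_class M f = ae_class M g \<longleftrightarrow> (AE x in M. f x = g x)"
  unfolding ae_class_def by (subst eq_equiv_class_iff[OF equiv_ae_rel]) (auto simp: ae_rel_def)

lemma rep_ae_class:
  assumes "f \<in> borel_measurable M"
  shows "rep (ae_class M f) \<in> borel_measurable M" "AE x in M. rep (ae_class M f) x = f x"
proof -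
  have "f \<in> ae_class M f" using assms by (auto simp: ae_class_def ae_rel_def)
  then have "rep (ae_class M f) \<in> ae_class M f" unfolding rep_def by (rule someI[of "\<lambda>h. h \<in> ae_class M f"])
  then show "rep (ae_class M f) \<in> borel_measurable M" "AE x in M. rep (ae_class M f) x = f x"
    by (auto simp: ae_class_def ae_rel_def elim: AE_mp)
qed

lemma L0_cases:
  assumes "a \<in> carrier (L0 M)"
  obtains f where "f \<in> borel_measurable M" "a = ae_class M f"
  using assms by (auto simp: L0_def ae_class_def elim: quotientE)

lemma rep_measurable: "a \<in> carrier (L0 M) \<Longrightarrow> rep a \<in> borel_measurable M"
  by (metis L0_cases rep_ae_class(1))

lemma ae_class_rep: "a \<in> carrier (L0 M) \<Longrightarrow> ae_class M (rep a) = a"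
  by (metis L0_cases ae_class_eq_iff rep_ae_class)

lemma L0_eqI:
  assumes "a \<in> carrier (L0 M)" "b \<in> carrier (L0 M)" "AE x in M. rep a x = rep b x"
  shows "a = b"
  using assms by (metis ae_class_rep ae_class_eq_iff rep_measurable)

lemma L0_simps:
  "vadd (L0 M) a b = ae_class M (\<lambda>x. rep a x + rep b x)"
  "vzero (L0 M) = ae_class M (\<lambda>x. 0)"
  "vscale (L0 M) c a = ae_class M (\<lambda>x. c * rep a x)"
  "a \<sqsubseteq>\<^bsub>L0 M\<^esub> b \<longleftrightarrow> (AE x in M. rep a x \<le> rep b x)"
  by (simp_all add: L0_def)

lemma L0_partial_order: "partial_order (L0 M)"
proof unfold_locales
  show "(.=\<^bsub>L0 M\<^esub>) = (=)" by (simp add: L0_def)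
  show "x .=\<^bsub>L0 M\<^esub> y" if "x \<sqsubseteq>\<^bsub>L0 M\<^esub> y" "y \<sqsubseteq>\<^bsub>L0 M\<^esub> x" "x \<in> carrier (L0 M)" "y \<in> carrier (L0 M)" for x y
  proof -
    have "AE t in M. rep x t = rep y t"
      using that(1,2) unfolding L0_simps by eventually_elim auto
    then have "x = y" using that L0_eqI by blast
    then show ?thesis by (simp add: L0_def)
  qed
  show "x \<sqsubseteq>\<^bsub>L0 M\<^esub> z" if "x \<sqsubseteq>\<^bsub>L0 M\<^esub> y" "y \<sqsubseteq>\<^bsub>L0 M\<^esub> z" for x y z
    using that unfolding L0_simps by eventually_elim auto
qed (auto simp: L0_def)

lemma L0_lub:
  assumes "a \<in> carrier (L0 M)" "b \<in> carrier (L0 M)"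
  shows "is_lub (L0 M) (ae_class M (\<lambda>x. max (rep a x) (rep b x))) {a, b}"
proof -
  note [measurable] = rep_measurable[OF assms(1)] rep_measurable[OF assms(2)]
  let ?f = "\<lambda>x. max (rep a x) (rep b x)"
  have m: "?f \<in> borel_measurable M" by measurable
  note r = rep_ae_class(2)[OF m]
  have "a \<sqsubseteq>\<^bsub>L0 M\<^esub> ae_class M ?f" "b \<sqsubseteq>\<^bsub>L0 M\<^esub> ae_class M ?f"
    unfolding L0_simps using r by (eventually_elim, auto)+
  moreover have "ae_class M ?f \<sqsubseteq>\<^bsub>L0 M\<^esub> u" if "a \<sqsubseteq>\<^bsub>L0 M\<^esub> u" "b \<sqsubseteq>\<^bsub>L0 M\<^esub> u" for u
    using that r unfolding L0_simps by eventually_elim auto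
  ultimately show ?thesis using assms ae_class_in_L0[OF m] by (auto simp: least_def Upper_def)
qed

lemma L0_glb:
  assumes "a \<in> carrier (L0 M)" "b \<in> carrier (L0 M)"
  shows "is_glb (L0 M) (ae_class M (\<lambda>x. min (rep a x) (rep b x))) {a, b}"
proof -
  note [measurable] = rep_measurable[OF assms(1)] rep_measurable[OF assms(2)]
  let ?f = "\<lambda>x. min (rep a x) (rep b x)"
  have m: "?f \<in> borel_measurable M" by measurable
  note r = rep_ae_class(2)[OF m]
  have "ae_class M ?f \<sqsubseteq>\<^bsub>L0 M\<^esub> a" "ae_class M ?f \<sqsubseteq>\<^bsub>L0 M\<^esub> b"
    unfolding L0_simps using r by (eventually_elim, auto)+
  moreover have "u \<sqsubseteq>\<^bsub>L0 M\<^esub> ae_class M ?f" if "u \<sqsubseteq>\<^bsub>L0 M\<^esub> a" "u \<sqsubseteq>\<^bsub>L0 M\<^esub> b" for u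
    using that r unfolding L0_simps by eventually_elim auto
  ultimately show ?thesis using assms ae_class_in_L0[OF m] by (auto simp: greatest_def Lower_def)
qed

lemma L0_add_ae:
  assumes "a \<in> carrier (L0 M)" "b \<in> carrier (L0 M)"
  shows "vadd (L0 M) a b \<in> carrier (L0 M)" "AE x in M. rep (vadd (L0 M) a b) x = rep a x + rep b x"
proof -
  note [measurable] = rep_measurable[OF assms(1)] rep_measurable[OF assms(2)]
  have m: "(\<lambda>x. rep a x + rep b x) \<in> borel_measurable M" by measurable
  show "vadd (L0 M) a b \<in> carrier (L0 M)" "AE x in M. rep (vadd (L0 M) a b) x = rep a x + rep b x"
    using rep_ae_class(2)[OF m] ae_class_in_L0[OF m] unfolding L0_simps by auto
qed

lemma L0_scale_ae:
  assumes "a \<in> carrier (L0 M)"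
  shows "vscale (L0 M) c a \<in> carrier (L0 M)" "AE x in M. rep (vscale (L0 M) c a) x = c * rep a x"
proof -
  note [measurable] = rep_measurable[OF assms(1)]
  have m: "(\<lambda>x. c * rep a x) \<in> borel_measurable M" by measurable
  show "vscale (L0 M) c a \<in> carrier (L0 M)" "AE x in M. rep (vscale (L0 M) c a) x = c * rep a x"
    using rep_ae_class(2)[OF m] ae_class_in_L0[OF m] unfolding L0_simps by auto
qed

lemma L0_zero_ae:
  "vzero (L0 M) \<in> carrier (L0 M)" "AE x in M. rep (vzero (L0 M)) x = 0"
  unfolding L0_simps by (auto intro: ae_class_in_L0 rep_ae_class)

lemma L0_add_group: "comm_group \<lparr>carrier = carrier (L0 M), monoid.mult = vadd (L0 M), one = vzero (L0 M)\<rparr>"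
proof (rule comm_groupI, simp_all add: L0_add_ae(1) L0_zero_ae(1))
  fix x y z
  assume x: "x \<in> carrier (L0 M)" and y: "y \<in> carrier (L0 M)" and z: "z \<in> carrier (L0 M)"
  show "vadd (L0 M) (vadd (L0 M) x y) z = vadd (L0 M) x (vadd (L0 M) y z)"
  proof (rule L0_eqI)
    show "AE t in M. rep (vadd (L0 M) (vadd (L0 M) x y) z) t = rep (vadd (L0 M) x (vadd (L0 M) y z)) t"
      using L0_add_ae(2)[OF L0_add_ae(1)[OF x y] z] L0_add_ae(2)[OF x y] L0_add_ae(2)[OF y z]
        L0_add_ae(2)[OF x L0_add_ae(1)[OF y z]] by eventually_elim simp
  qed (simp_all add: x y z L0_add_ae(1))
next
  fix x y assume "x \<in> carrier (L0 M)" "y \<in> carrier (L0 M)"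
  show "vadd (L0 M) x y = vadd (L0 M) y x" unfolding L0_simps by (simp add: add.commute)
next
  fix x assume x: "x \<in> carrier (L0 M)"
  show "vadd (L0 M) (vzero (L0 M)) x = x"
  proof (rule L0_eqI)
    show "AE t in M. rep (vadd (L0 M) (vzero (L0 M)) x) t = rep x t"
      using L0_add_ae(2)[OF L0_zero_ae(1) x] L0_zero_ae(2)[of M] by eventually_elim simp
  qed (simp_all add: x L0_add_ae(1) L0_zero_ae(1))
next
  fix x assume x: "x \<in> carrier (L0 M)"
  show "\<exists>y\<in>carrier (L0 M). vadd (L0 M) y x = vzero (L0 M)"
  proof (intro bexI[of _ "vscale (L0 M) (-1) x"] L0_eqI)
    show "AE t in M. rep (vadd (L0 M) (vscale (L0 M) (-1) x) x) t = rep (vzero (L0 M)) t"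
      using L0_add_ae(2)[OF L0_scale_ae(1)[OF x] x, of "-1"] L0_scale_ae(2)[OF x, of "-1"] L0_zero_ae(2)[of M]
      by eventually_elim simp
  qed (simp_all add: x L0_add_ae(1) L0_zero_ae(1) L0_scale_ae(1))
qed

lemma L0_lattice: "Lattice.lattice (L0 M)"
proof (intro Lattice.lattice.intro upper_semilattice.intro lower_semilattice.intro
    upper_semilattice_axioms.intro lower_semilattice_axioms.intro L0_partial_order)
  fix x y assume xy: "x \<in> carrier (L0 M)" "y \<in> carrier (L0 M)"
  show "\<exists>s. is_lub (L0 M) s {x, y}" using L0_lub[OF xy] by (rule exI)
  show "\<exists>s. is_glb (L0 M) s {x, y}" using L0_glb[OF xy] by (rule exI)
qed

lemma L0_scale_scale:
  assumes x: "x \<in> carrier (L0 M)"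
  shows "vscale (L0 M) c (vscale (L0 M) d x) = vscale (L0 M) (c * d) x"
proof (rule L0_eqI)
  show "AE t in M. rep (vscale (L0 M) c (vscale (L0 M) d x)) t = rep (vscale (L0 M) (c * d) x) t"
    using L0_scale_ae(2)[OF L0_scale_ae(1)[OF x, of d], of c] L0_scale_ae(2)[OF x, of d]
      L0_scale_ae(2)[OF x, of "c * d"] by eventually_elim simp
qed (simp_all add: x L0_scale_ae(1))

lemma L0_scale_add_left:
  assumes x: "x \<in> carrier (L0 M)"
  shows "vscale (L0 M) (c + d) x = vadd (L0 M) (vscale (L0 M) c x) (vscale (L0 M) d x)"
proof (rule L0_eqI)
  show "AE t in M. rep (vscale (L0 M) (c + d) x) t
      = rep (vadd (L0 M) (vscale (L0 M) c x) (vscale (L0 M) d x)) t"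
    using L0_scale_ae(2)[OF x, of "c + d"] L0_scale_ae(2)[OF x, of c] L0_scale_ae(2)[OF x, of d]
      L0_add_ae(2)[OF L0_scale_ae(1)[OF x, of c] L0_scale_ae(1)[OF x, of d]]
    by eventually_elim (simp add: distrib_right)
qed (simp_all add: x L0_scale_ae(1) L0_add_ae(1))

lemma L0_scale_add_right:
  assumes x: "x \<in> carrier (L0 M)" and y: "y \<in> carrier (L0 M)"
  shows "vscale (L0 M) c (vadd (L0 M) x y) = vadd (L0 M) (vscale (L0 M) c x) (vscale (L0 M) c y)"
proof (rule L0_eqI)
  show "AE t in M. rep (vscale (L0 M) c (vadd (L0 M) x y)) t
      = rep (vadd (L0 M) (vscale (L0 M) c x) (vscale (L0 M) c y)) t"
    using L0_scale_ae(2)[OF L0_add_ae(1)[OF x y], of c] L0_add_ae(2)[OF x y]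
      L0_add_ae(2)[OF L0_scale_ae(1)[OF x, of c] L0_scale_ae(1)[OF y, of c]]
      L0_scale_ae(2)[OF x, of c] L0_scale_ae(2)[OF y, of c]
    by eventually_elim (simp add: distrib_left)
qed (simp_all add: x y L0_add_ae(1) L0_scale_ae(1))

lemma L0_add_mono:
  assumes x: "x \<in> carrier (L0 M)" and y: "y \<in> carrier (L0 M)" and z: "z \<in> carrier (L0 M)"
    and le: "x \<sqsubseteq>\<^bsub>L0 M\<^esub> y"
  shows "vadd (L0 M) x z \<sqsubseteq>\<^bsub>L0 M\<^esub> vadd (L0 M) y z"
  using le L0_add_ae(2)[OF x z] L0_add_ae(2)[OF y z] unfolding L0_simps(4)
  by eventually_elim simp

lemma L0_scale_mono:
  assumes x: "x \<in> carrier (L0 M)" and y: "y \<in> carrier (L0 M)" and c: "0 \<le> c"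
    and le: "x \<sqsubseteq>\<^bsub>L0 M\<^esub> y"
  shows "vscale (L0 M) c x \<sqsubseteq>\<^bsub>L0 M\<^esub> vscale (L0 M) c y"
  using le L0_scale_ae(2)[OF x, of c] L0_scale_ae(2)[OF y, of c] unfolding L0_simps(4)
  by eventually_elim (simp add: mult_left_mono c)

lemma L0_scale_one: "x \<in> carrier (L0 M) \<Longrightarrow> vscale (L0 M) 1 x = x"
  by (simp add: L0_simps ae_class_rep)

lemma vector_lattice_L0: "vector_lattice (L0 M)"
  apply (rule vector_lattice.intro[OF L0_lattice])
  apply (rule vector_lattice_axioms.intro)
         apply (rule L0_add_group)
        apply (erule L0_scale_ae(1))
       apply (erule L0_scale_one)
      apply (erule L0_scale_scale)
     apply (erule L0_scale_add_left)
    apply (erule (1) L0_scale_add_right)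
   apply (erule (3) L0_add_mono)
  apply (erule (3) L0_scale_mono)
  done

end

theory Submission
  imports Defs
begin

text \<open>
  Everything is transferred to measurable functions \<open>f\<close> whose class lies in \<open>E\<close>; call their set \<open>F\<close>. For
  \<open>A\<close> of finite measure and \<open>e > 0\<close> the sets \<open>small M A e\<close> are the basic neighbourhoods of zero for
  convergence in measure on sets of finite measure, which gives the topology to be found.

  It is uo-Lebesgue because a family decreasing to zero in \<open>F\<close> decreases to zero in \<open>L\<^sub>0\<close> by regularity,
  hence in measure, and because up to a set of small measure the common support of \<open>F\<close> inside \<open>A\<close> is
  the support of a single element of \<open>F\<close>.

  For uniqueness let \<open>V\<close> be a solid neighbourhood of zero of a Hausdorff uo-Lebesgue topology, and \<open>J\<close>
  the ideal of all \<open>f \<in> F\<close> vanishing on \<open>A\<close>. For a suitable \<open>A\<close> the ideal \<open>J\<close> lies in \<open>V\<close>: otherwise choose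
  for every \<open>A\<close> an element of \<open>J\<close> outside \<open>V\<close>; these form a uo-null net, as the measure is
  semi-finite. If functions \<open>f\<^sub>k \<in> small M A (2\<^sup>-\<^sup>k)\<close> were outside a sum of copies of \<open>V\<close>, their parts in the
  disjoint complement of \<open>J\<close> would converge to zero almost everywhere on \<open>A\<close>, so they would be uo-null;
  hence some \<open>small M A e\<close> is contained in a given neighbourhood. Conversely, by the Hausdorff property and
  an exhaustion argument there are neighbourhoods \<open>W\<^sub>0 \<supseteq> W\<^sub>1 + W\<^sub>1\<close>, \<open>W\<^sub>1 \<supseteq> W\<^sub>2 + W\<^sub>2\<close>, \<open>\<dots>\<close> whose intersection
  lies in \<open>J\<close>. If no \<open>W\<^sub>k\<close> is contained in \<open>small M A e\<close>, there are \<open>c\<^sub>k \<in> W\<^sub>k\<close> disjoint from \<open>J\<close> that stay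
  away from zero in measure. They are not uo-null, which produces \<open>w \<noteq> 0\<close> with \<open>w = sup (c\<^sub>j \<and> w)\<close> over
  every tail; but then \<open>w\<close> belongs to every \<open>W\<^sub>k\<close>, so to \<open>J\<close>, and is disjoint from all \<open>c\<^sub>j\<close>.
\<close>

section \<open>Convergence in measure\<close>

text \<open>One number bounds both the level and the measure of the level set, so a neighbourhood is
  indexed by a set and a single parameter. The real-valued \<open>measure\<close> is faithful here
  as long as \<open>A\<close> has finite measure.\<close>

definition small :: "'x measure \<Rightarrow> 'x set \<Rightarrow> real \<Rightarrow> ('x \<Rightarrow> real) set" where
  "small M A e = {f \<in> borel_measurable M. measure M {x\<in>A. e \<le> \<bar>f x\<bar>} < e}"

lemma Collect_fmeasurable:
  assumes "A \<in> fmeasurable M" "{x\<in>space M. P x} \<in> sets M"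
  shows "{x\<in>A. P x} \<in> fmeasurable M"
proof -
  have "{x\<in>A. P x} = A \<inter> {x\<in>space M. P x}"
    using sets.sets_into_space[OF fmeasurableD[OF assms(1)]] by auto
  then show ?thesis using fmeasurable_Int_fmeasurable[OF assms] by simp
qed

lemma level_fmeasurable:
  assumes "A \<in> fmeasurable M" and [measurable]: "f \<in> borel_measurable M"
  shows "{x\<in>A. e \<le> \<bar>f x :: real\<bar>} \<in> fmeasurable M"
  by (rule Collect_fmeasurable[OF assms(1)]) measurable

lemma measure_mono_AE:
  assumes "A \<in> fmeasurable M" "B \<in> fmeasurable M" "AE x in M. x \<in> A \<longrightarrow> x \<in> B"
  shows "measure M A \<le> measure M B"
  using emeasure_mono_AE[OF assms(3)] assms(1,2)
  by (auto simp: measure_def fmeasurable_def intro!: enn2real_mono)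

lemma zero_small: "0 < e \<Longrightarrow> (\<lambda>x. 0) \<in> small M A e"
  by (simp add: small_def)

lemma small_mono:
  assumes "B \<in> fmeasurable M" "A \<in> sets M" "A \<subseteq> B" "d \<le> e"
  shows "small M B d \<subseteq> small M A e"
proof
  fix f assume f: "f \<in> small M B d"
  have A: "A \<in> fmeasurable M" using assms fmeasurableI2 by blast
  have "measure M {x\<in>A. e \<le> \<bar>f x\<bar>} \<le> measure M {x\<in>B. d \<le> \<bar>f x\<bar>}"
    using f assms(3,4) level_fmeasurable[OF A] level_fmeasurable[OF assms(1)]
    by (intro measure_mono_AE) (auto simp: small_def)
  then show "f \<in> small M A e" using f assms(4) by (auto simp: small_def)
qed

lemma small_solid:
  assumes "A \<in> fmeasurable M" "f \<in> small M A e" "g \<in> borel_measurable M"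
    "AE x in M. x \<in> A \<longrightarrow> \<bar>g x\<bar> \<le> \<bar>f x\<bar>"
  shows "g \<in> small M A e"
proof -
  have "measure M {x\<in>A. e \<le> \<bar>g x\<bar>} \<le> measure M {x\<in>A. e \<le> \<bar>f x\<bar>}"
    using assms by (intro measure_mono_AE level_fmeasurable) (auto simp: small_def elim: AE_mp)
  then show ?thesis using assms by (auto simp: small_def)
qed

lemma small_add:
  assumes "A \<in> fmeasurable M" "f \<in> small M A (e/2)" "g \<in> small M A (e/2)"
  shows "(\<lambda>x. f x + g x) \<in> small M A e"
proof -
  let ?F = "{x\<in>A. e/2 \<le> \<bar>f x\<bar>}" and ?G = "{x\<in>A. e/2 \<le> \<bar>g x\<bar>}"
  have fg: "f \<in> borel_measurable M" "g \<in> borel_measurable M" using assms by (auto simp: small_def)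
  have F: "?F \<in> fmeasurable M" "?G \<in> fmeasurable M"
    by (intro level_fmeasurable assms(1) fg)+
  have "measure M {x\<in>A. e \<le> \<bar>f x + g x\<bar>} \<le> measure M (?F \<union> ?G)"
    using fg F assms(1) by (intro measure_mono_fmeasurable) (auto intro!: fmeasurableD[OF level_fmeasurable])
  also have "\<dots> \<le> measure M ?F + measure M ?G" using F by (intro measure_Un_le) auto
  also have "\<dots> < e" using assms by (auto simp: small_def)
  finally show ?thesis using fg by (simp add: small_def)
qed

lemma small_AE_zero:
  assumes A: "A \<in> fmeasurable M" and f: "f \<in> borel_measurable M" and s: "\<And>e. 0 < e \<Longrightarrow> f \<in> small M A e"
  shows "AE x in M. x \<in> A \<longrightarrow> f x = 0"
proof -
  have "measure M {x\<in>A. e \<le> \<bar>f x\<bar>} = 0" if e: "0 < e" for e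
  proof (rule ccontr)
    let ?m = "measure M {x\<in>A. e \<le> \<bar>f x\<bar>}"
    assume "?m \<noteq> 0"
    then have m: "?m > 0" by (simp add: zero_less_measure_iff)
    \<comment> \<open>At the level \<open>min e ?m\<close> the level set contains the one at level
      \<open>e\<close>, so its measure is not below \<open>?m\<close>.\<close>
    then have "f \<in> small M A (min e ?m)" using s e by simp
    moreover have "?m \<le> measure M {x\<in>A. min e ?m \<le> \<bar>f x\<bar>}"
      using A f by (intro measure_mono_AE level_fmeasurable) auto
    ultimately show False by (auto simp: small_def)
  qed
  then have "{x\<in>A. 1 / Suc n \<le> \<bar>f x\<bar>} \<in> null_sets M" for n
    using level_fmeasurable[OF A f] fmeasurableD2[OF level_fmeasurable[OF A f]]
    by (auto simp: null_sets_def emeasure_eq_ennreal_measure)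
  then have "AE x in M. x \<notin> {x\<in>A. 1 / Suc n \<le> \<bar>f x\<bar>}" for n by (rule AE_not_in)
  then have "AE x in M. \<forall>n. x \<notin> {x\<in>A. 1 / Suc n \<le> \<bar>f x\<bar>}" unfolding AE_all_countable by blast
  then show ?thesis
  proof eventually_elim
    case (elim x)
    show ?case
    proof (intro impI, rule ccontr)
      assume "x \<in> A" "f x \<noteq> 0"
      then obtain n where "inverse (real (Suc n)) < \<bar>f x\<bar>" using reals_Archimedean[of "\<bar>f x\<bar>"] by auto
      then show False using elim \<open>x \<in> A\<close> by (auto simp: inverse_eq_divide not_le dest: spec[of _ n])
    qed
  qed
qed

text \<open>Borel-Cantelli: the exceptional sets have summable measures, so almost every point of
  \<open>A\<close> lies in only finitely many of them, and there \<open>c k\<close> is eventually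
  bounded by \<open>(1/2)^k\<close>.\<close>

lemma small_summable_tendsto:
  assumes A: "A \<in> fmeasurable M" and c: "\<And>k. c k \<in> small M A ((1/2)^k)"
  shows "AE x in M. x \<in> A \<longrightarrow> (\<lambda>k. c k x) \<longlonglongrightarrow> 0"
proof -
  let ?B = "\<lambda>k. {x\<in>A. (1/2)^k \<le> \<bar>c k x\<bar>}"
  have B: "?B k \<in> fmeasurable M" for k using c A by (intro level_fmeasurable) (auto simp: small_def)
  have "AE x in M. eventually (\<lambda>k. x \<in> space M - ?B k) sequentially"
  proof (rule borel_cantelli_AE1)
    show "?B k \<in> sets M" "emeasure M (?B k) < \<infinity>" for k
      using B[of k] by (auto simp: fmeasurable_def)
    have "summable (\<lambda>k. (1/2::real)^k)" by (intro summable_geometric) simp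
    then show "summable (\<lambda>k. measure M (?B k))"
      by (rule summable_comparison_test') (use c in \<open>auto simp: small_def intro: less_imp_le\<close>)
  qed
  then show ?thesis
  proof eventually_elim
    case (elim x)
    show ?case
    proof
      assume x: "x \<in> A"
      have "(\<lambda>k. (1/2::real)^k) \<longlonglongrightarrow> 0" by (intro LIMSEQ_power_zero) simp
      then show "(\<lambda>k. c k x) \<longlonglongrightarrow> 0"
        by (rule Lim_null_comparison[rotated]) (use elim x in \<open>auto elim!: eventually_mono\<close>)
    qed
  qed
qed

text \<open>Along a minimizing sequence for \<open>\<integral>\<^sub>A min d 1\<close> the pointwise infimum is a lower bound of all of \<open>D\<close>.\<close>

lemma directed_Inf_small:
  assumes A: "A \<in> fmeasurable M" and e: "0 < e" and ne: "D \<noteq> {}"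
    and meas: "\<And>d. d \<in> D \<Longrightarrow> d \<in> borel_measurable M"
    and nn: "\<And>d. d \<in> D \<Longrightarrow> AE x in M. 0 \<le> d x"
    and dir: "\<And>c d. c \<in> D \<Longrightarrow> d \<in> D \<Longrightarrow> \<exists>b\<in>D. AE x in M. b x \<le> min (c x) (d x)"
    and inf: "\<And>h. h \<in> borel_measurable M \<Longrightarrow> (\<And>d. d \<in> D \<Longrightarrow> AE x in M. h x \<le> d x) \<Longrightarrow> AE x in M. h x \<le> 0"
  shows "\<exists>d\<in>D. d \<in> small M A e"
proof -
  \<comment> \<open>Cutting off to \<open>A\<close> and to values in \<open>[0,1]\<close> makes all
    integrals finite, while a small integral still forces smallness in measure on
    \<open>A\<close>.\<close>
  define b where "b d x = indicator A x * max 0 (min (d x) 1)" for d :: "'a \<Rightarrow> real" and x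
  define J where "J d = (\<integral>x. b d x \<partial>M)" for d
  have [measurable]: "A \<in> sets M" using A by auto
  have bm [measurable]: "b d \<in> borel_measurable M" if [measurable]: "d \<in> borel_measurable M" for d
    unfolding b_def[abs_def] by measurable
  have iA: "integrable M (indicator A :: 'a \<Rightarrow> real)" using A by (auto simp: fmeasurable_def)
  have bint: "integrable M (b d)" if "d \<in> borel_measurable M" for d
    by (rule Bochner_Integration.integrable_bound[OF iA bm[OF that]]) (auto simp: b_def indicator_def)
  have J0: "0 \<le> J d" for d unfolding J_def by (intro integral_nonneg_AE) (auto simp: b_def indicator_def)
  define \<iota> where "\<iota> = Inf (J ` D)"
  have \<iota>_le: "\<iota> \<le> J d" if "d \<in> D" for d
    unfolding \<iota>_def by (rule cInf_lower) (use that J0 in \<open>auto intro!: bdd_belowI[of _ 0]\<close>)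
  have "\<exists>d\<in>D. J d < \<iota> + 1 / Suc n" for n
    using cInf_lessD[of "J ` D" "\<iota> + 1 / Suc n"] ne by (auto simp: \<iota>_def)
  then obtain s where s: "\<And>n. s n \<in> D" "\<And>n. J (s n) < \<iota> + 1 / Suc n" by metis
  have sm [measurable]: "s n \<in> borel_measurable M" for n using meas s by auto
  \<comment> \<open>The running minima need not lie in \<open>D\<close>, but each has an element
    \<open>q\<close> of \<open>D\<close> below it, so their integrals do not fall under
    \<open>\<iota>\<close>.\<close>
  define p where "p n x = Min ((\<lambda>k. s k x) ` {..n})" for n x
  have pSuc: "p (Suc n) x = min (p n x) (s (Suc n) x)" for n x
    unfolding p_def by (simp add: atMost_Suc min.commute)
  have p0: "p 0 x = s 0 x" for x by (simp add: p_def)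
  have pm [measurable]: "p n \<in> borel_measurable M" for n
  proof (induction n)
    case 0 show ?case using p0 sm[of 0] by (simp add: p0[abs_def] cong: measurable_cong)
  next
    case (Suc n)
    have "(\<lambda>x. min (p n x) (s (Suc n) x)) \<in> borel_measurable M" using Suc sm by measurable
    then show ?case by (simp add: pSuc[abs_def] cong: measurable_cong)
  qed
  have "\<exists>q\<in>D. AE x in M. q x \<le> p n x" for n
  proof (induction n)
    case 0 show ?case using s by (auto simp: p0)
  next
    case (Suc n)
    then obtain q where q: "q \<in> D" "AE x in M. q x \<le> p n x" by blast
    obtain r where r: "r \<in> D" "AE x in M. r x \<le> min (q x) (s (Suc n) x)" using dir[OF q(1) s(1)] by blast
    have "AE x in M. r x \<le> p (Suc n) x" using q(2) r(2) by eventually_elim (auto simp: pSuc)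
    then show ?case using r by blast
  qed
  then obtain q where q: "\<And>n. q n \<in> D" "\<And>n. AE x in M. q n x \<le> p n x" by metis
  have Jmono: "J c \<le> J d" if "c \<in> borel_measurable M" "d \<in> borel_measurable M" "AE x in M. c x \<le> d x" for c d
    unfolding J_def
    by (rule integral_mono_AE[OF bint bint]) (use that in \<open>auto simp: b_def indicator_def elim!: eventually_mono\<close>)
  have \<iota>p: "\<iota> \<le> J (p n)" for n
    using \<iota>_le[OF q(1)[of n]] Jmono[OF meas[OF q(1)] pm q(2), of n] by linarith
  define h where "h x = (INF n. b (p n) x)" for x
  have hm [measurable]: "h \<in> borel_measurable M" unfolding h_def[abs_def] by measurable
  have b01: "0 \<le> b d x" "b d x \<le> 1" for d x by (auto simp: b_def indicator_def)
  have bdd: "bdd_below (range (\<lambda>n. b (p n) x))" for x by (rule bdd_belowI[of _ 0]) (auto simp: b01)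
  have dec: "decseq (\<lambda>n. b (p n) x)" for x
    by (rule decseq_SucI) (auto simp: b_def pSuc indicator_def)
  have hlim: "(\<lambda>n. b (p n) x) \<longlonglongrightarrow> h x" for x
    unfolding h_def by (rule LIMSEQ_decseq_INF[OF bdd dec])
  have h01: "0 \<le> h x" "h x \<le> indicator A x" for x
    unfolding h_def using cINF_lower[OF bdd, of 0 x]
    by (auto intro: cINF_greatest simp: b01) (auto simp: b_def indicator_def split: if_splits)
  have "(\<lambda>n. J (p n)) \<longlonglongrightarrow> (\<integral>x. h x \<partial>M)"
    unfolding J_def
  proof (rule integral_dominated_convergence[OF _ _ iA])
    show "AE x in M. norm (b (p n) x) \<le> indicat_real A x" for n by (auto simp: b_def indicator_def)
  qed (simp_all add: hlim)
  then have \<iota>h: "\<iota> \<le> (\<integral>x. h x \<partial>M)" by (rule LIMSEQ_le_const) (use \<iota>p in auto)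
  have hint: "integrable M h"
    by (rule Bochner_Integration.integrable_bound[OF iA hm]) (use h01 in auto)
  \<comment> \<open>If \<open>r \<in> D\<close> lies below both \<open>s n\<close> and
    \<open>d\<close>, the positive part of \<open>h - b d\<close> is at most
    \<open>b (s n) - b r\<close>, whose integral is at most \<open>J (s n) - \<iota>\<close>. This
    tends to zero.\<close>
  have hle: "AE x in M. h x \<le> d x" if d: "d \<in> D" for d
  proof -
    note [measurable] = meas[OF d]
    have "integrable M (\<lambda>x. max 0 (h x - b d x))"
    proof (rule Bochner_Integration.integrable_bound[OF hint])
      have "norm (max 0 (h x - b d x)) \<le> norm (h x)" for x using h01[of x] b01[of d x] by simp
      then show "AE x in M. norm (max 0 (h x - b d x)) \<le> norm (h x)" by simp
    qed measurable
    note int = this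
    have "(\<integral>x. max 0 (h x - b d x) \<partial>M) \<le> 1 / Suc n" for n
    proof -
      obtain r where r: "r \<in> D" "AE x in M. r x \<le> min (s n x) (d x)" using dir[OF s(1) d] by blast
      have "(\<integral>x. max 0 (h x - b d x) \<partial>M) \<le> (\<integral>x. b (s n) x - b r x \<partial>M)"
      proof (rule integral_mono_AE[OF int])
        show "integrable M (\<lambda>x. b (s n) x - b r x)" using bint meas r s by auto
        have hs: "h x \<le> b (s n) x" for x
        proof -
          have "h x \<le> b (p n) x" unfolding h_def by (rule cINF_lower[OF bdd]) auto
          also have "\<dots> \<le> b (s n) x"
          proof -
            have "p n x \<le> s n x" unfolding p_def by (rule Min_le) auto
            then show ?thesis by (auto simp: b_def indicator_def)
          qed
          finally show ?thesis .
        qed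
        show "AE x in M. max 0 (h x - b d x) \<le> b (s n) x - b r x"
          using r(2)
        proof eventually_elim
          case (elim x)
          have "b r x \<le> b (s n) x" "b r x \<le> b d x" using elim by (auto simp: b_def indicator_def)
          then show ?case using hs[of x] by auto
        qed
      qed
      also have "\<dots> = J (s n) - J r" unfolding J_def using bint meas r s by (intro Bochner_Integration.integral_diff) auto
      also have "\<dots> \<le> 1 / Suc n" using s(2)[of n] \<iota>_le[OF r(1)] by linarith
      finally show ?thesis .
    qed
    then have "(\<integral>x. max 0 (h x - b d x) \<partial>M) \<le> 0"
      by (intro LIMSEQ_le_const[OF LIMSEQ_inverse_real_of_nat]) (auto simp: inverse_eq_divide)
    moreover have "0 \<le> (\<integral>x. max 0 (h x - b d x) \<partial>M)" by (intro integral_nonneg_AE) auto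
    ultimately have "(\<integral>x. max 0 (h x - b d x) \<partial>M) = 0" by linarith
    then have "AE x in M. max 0 (h x - b d x) = 0" by (subst (asm) integral_nonneg_eq_0_iff_AE[OF int]) auto
    \<comment> \<open>From \<open>b d\<close> to \<open>d\<close>: on \<open>A\<close> truncating a
      nonnegative value at 1 does not raise it, and off \<open>A\<close> the function
      \<open>h\<close> is zero.\<close>
    then show ?thesis using nn[OF d]
    proof eventually_elim
      case (elim x)
      then show ?case using h01[of x] by (cases "x \<in> A") (auto simp: b_def max_def min_def split: if_splits)
    qed
  qed
  have "AE x in M. h x \<le> 0" by (rule inf[OF hm hle])
  then have "AE x in M. h x = 0" by eventually_elim (use h01 in \<open>auto intro: antisym\<close>)
  then have "(\<integral>x. h x \<partial>M) = 0" by (subst integral_cong_AE[of _ _ "\<lambda>_. 0"]) auto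
  then have \<iota>0: "\<iota> \<le> 0" using \<iota>h by simp
  \<comment> \<open>Chebyshev: almost everywhere on the level set of \<open>e\<close> the truncation
    \<open>b (s n)\<close> is at least \<open>min e 1\<close>, so an integral below
    \<open>min e 1 * e\<close> gives a level set of measure below \<open>e\<close>.\<close>
  define \<delta> where "\<delta> = min e 1 * e / 2"
  have "0 < \<delta>" using e by (simp add: \<delta>_def)
  then obtain n where "1 / real (Suc n) < \<delta>" using reals_Archimedean by (auto simp: inverse_eq_divide)
  then have Jd: "J (s n) < \<delta>" using s(2)[of n] \<iota>0 by linarith
  have "min e 1 * measure M {x\<in>A. e \<le> \<bar>s n x\<bar>} = (\<integral>x. min e 1 * indicator {x\<in>A. e \<le> \<bar>s n x\<bar>} x \<partial>M)"
    using level_fmeasurable[OF A sm[of n], of e] by simp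
  also have "\<dots> \<le> J (s n)"
    unfolding J_def
  proof (rule integral_mono_AE[OF _ bint[OF sm]])
    show "integrable M (\<lambda>x. min e 1 * indicator {x\<in>A. e \<le> \<bar>s n x\<bar>} x)"
      using level_fmeasurable[OF A sm[of n], of e] by (auto simp: fmeasurable_def)
    show "AE x in M. min e 1 * indicator {x\<in>A. e \<le> \<bar>s n x\<bar>} x \<le> b (s n) x"
      using nn[OF s(1)[of n]] by eventually_elim (use e in \<open>auto simp: b_def indicator_def\<close>)
  qed
  also have "\<dots> < min e 1 * e" using Jd J0[of "s n"] unfolding \<delta>_def by linarith
  finally have "measure M {x\<in>A. e \<le> \<bar>s n x\<bar>} < e" using e by (auto simp: mult_less_cancel_left)
  then have "s n \<in> small M A e" using sm by (simp add: small_def)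
  then show ?thesis using s(1) by blast
qed

text \<open>Continuity from above: for \<open>\<eta> = 1 / Suc n\<close> the sets decrease to the
  empty set. Up to small measure, a nonnegative \<open>y\<close> is thus bounded away from zero on
  its support in \<open>A\<close>.\<close>

lemma pos_level:
  assumes A: "A \<in> fmeasurable M" and y: "y \<in> borel_measurable M" and e: "0 < e"
  shows "\<exists>\<eta>>0. measure M {x\<in>A. 0 < y x \<and> y x < (\<eta>::real)} < e"
proof -
  have [measurable]: "A \<in> sets M" "y \<in> borel_measurable M" using A y by auto
  let ?B = "\<lambda>n. {x\<in>A. 0 < y x \<and> y x < 1 / Suc n}"
  have B: "?B n \<in> fmeasurable M" for n by (rule Collect_fmeasurable[OF A]) measurable
  have "(\<lambda>n. measure M (?B n)) \<longlonglongrightarrow> measure M (\<Inter>n. ?B n)"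
  proof (rule Lim_measure_decseq)
    show "range ?B \<subseteq> sets M" using B by blast
    have "1 / real (Suc (Suc n)) \<le> 1 / real (Suc n)" for n by (intro divide_left_mono) auto
    then show "decseq ?B"
      by (intro decseq_SucI Collect_mono) (auto dest: less_le_trans simp del: of_nat_Suc)
    show "emeasure M (?B n) \<noteq> \<infinity>" for n using fmeasurableD2[OF B] by simp
  qed
  moreover have "(\<Inter>n. ?B n) = {}"
  proof -
    have False if "x \<in> (\<Inter>n. ?B n)" for x
    proof -
      have "0 < y x" using that by blast
      then obtain n where "inverse (real (Suc n)) < y x" using reals_Archimedean by blast
      moreover have "y x < 1 / Suc n" using that by blast
      ultimately show False by (simp add: inverse_eq_divide)
    qed
    then show ?thesis by blast
  qed
  ultimately have "(\<lambda>n. measure M (?B n)) \<longlonglongrightarrow> 0" by simp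
  then have "\<forall>\<^sub>F n in sequentially. measure M (?B n) < e" using e by (rule order_tendstoD)
  then obtain n where "measure M (?B n) < e" by (auto simp: eventually_sequentially)
  then show ?thesis by (intro exI[of _ "1 / Suc n"]) auto
qed

section \<open>Regular sublattices of measurable functions\<close>

text \<open>The operations act pointwise on functions, while order relations are read almost
  everywhere; no quotient is formed at this level.\<close>

locale function_lattice =
  fixes M :: "'x measure" and F :: "('x \<Rightarrow> real) set"
  assumes measurable: "f \<in> F \<Longrightarrow> f \<in> borel_measurable M"
    and zero: "(\<lambda>x. 0) \<in> F"
    and add: "f \<in> F \<Longrightarrow> g \<in> F \<Longrightarrow> (\<lambda>x. f x + g x) \<in> F"
    and scale: "f \<in> F \<Longrightarrow> (\<lambda>x. c * f x) \<in> F"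
    and max: "f \<in> F \<Longrightarrow> g \<in> F \<Longrightarrow> (\<lambda>x. max (f x) (g x)) \<in> F"
begin

lemma diff: "f \<in> F \<Longrightarrow> g \<in> F \<Longrightarrow> (\<lambda>x. f x - g x) \<in> F"
  using add[of f "\<lambda>x. -1 * g x"] scale[of g "-1"] by simp

lemma min: "f \<in> F \<Longrightarrow> g \<in> F \<Longrightarrow> (\<lambda>x. min (f x) (g x)) \<in> F"
  using scale[OF max[OF scale[of f "-1"] scale[of g "-1"]], of "-1"]
  by (simp add: minus_max_eq_min)

lemma abs: "f \<in> F \<Longrightarrow> (\<lambda>x. \<bar>f x\<bar>) \<in> F"
proof -
  have "(\<lambda>x. \<bar>f x\<bar>) = (\<lambda>x. max (f x) (-1 * f x))" by (auto simp: max_def)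
  then show "f \<in> F \<Longrightarrow> (\<lambda>x. \<bar>f x\<bar>) \<in> F" using max[OF _ scale[of f "-1"]] by simp
qed

section \<open>Down-directed null families and uo-null filters\<close>

text \<open>The family \<open>D\<close> decreases to zero in \<open>F\<close>. Nonnegative lower
  bounds suffice to test the infimum, because a lower bound may be replaced by its positive
  part.\<close>

definition down_null :: "('x \<Rightarrow> real) set \<Rightarrow> bool" where
  "down_null D \<longleftrightarrow> D \<subseteq> F \<and> D \<noteq> {} \<and> (\<forall>d\<in>D. AE x in M. 0 \<le> d x) \<and>
     (\<forall>c\<in>D. \<forall>d\<in>D. \<exists>b\<in>D. AE x in M. b x \<le> min (c x) (d x)) \<and>
     (\<forall>w\<in>F. (AE x in M. 0 \<le> w x) \<longrightarrow> (\<forall>d\<in>D. AE x in M. w x \<le> d x) \<longrightarrow> (AE x in M. w x = 0))"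

text \<open>Filters on functions replace nets of functions, so that no index type has to be fixed; the
  dominating nets are directed sets \<open>D\<close> ordered by reverse inequality.\<close>

definition uo_null :: "('x \<Rightarrow> real) filter \<Rightarrow> bool" where
  "uo_null G \<longleftrightarrow> (\<forall>y\<in>F. (AE x in M. 0 \<le> y x) \<longrightarrow>
     (\<exists>D. down_null D \<and> (\<forall>d\<in>D. eventually (\<lambda>f. AE x in M. min (f x) (y x) \<le> d x) G)))"

text \<open>Truncation by \<open>y\<close> does not raise a function, so one dominating family
  serves every \<open>y\<close>: order convergence to zero implies uo-convergence.\<close>

lemma down_null_uo_null:
  assumes D: "down_null D" and ev: "\<And>d. d \<in> D \<Longrightarrow> eventually (\<lambda>f. AE x in M. f x \<le> d x) G"
  shows "uo_null G"
  unfolding uo_null_def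
proof (intro ballI impI exI conjI)
  show "down_null D" by fact
  fix y d assume "d \<in> D"
  show "eventually (\<lambda>f. AE x in M. min (f x) (y x) \<le> d x) G"
    using ev[OF \<open>d \<in> D\<close>] by (rule eventually_mono) (auto elim!: eventually_mono simp: min_le_iff_disj)
qed

lemma archimedean_AE:
  assumes "\<And>k::nat. AE x in M. real k * v x \<le> (y x :: real)"
  shows "AE x in M. v x \<le> 0"
proof -
  have "AE x in M. \<forall>k::nat. real k * v x \<le> y x" using assms by (simp add: AE_all_countable)
  then show ?thesis
  proof eventually_elim
    case (elim x)
    show ?case
    proof (rule ccontr)
      assume "\<not> v x \<le> 0"
      then obtain k :: nat where "y x < real k * v x" using ex_less_of_nat_mult[of "v x" "y x"] by auto
      then show False using elim by (simp add: not_less[symmetric])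
    qed
  qed
qed

section \<open>Ideals and disjoint complements\<close>

definition ideal :: "('x \<Rightarrow> real) set \<Rightarrow> bool" where
  "ideal J \<longleftrightarrow> J \<subseteq> F \<and> (\<lambda>x. 0) \<in> J \<and> (\<forall>f\<in>J. \<forall>g\<in>J. (\<lambda>x. f x + g x) \<in> J) \<and>
     (\<forall>f\<in>J. \<forall>g\<in>F. (AE x in M. \<bar>g x\<bar> \<le> \<bar>f x\<bar>) \<longrightarrow> g \<in> J)"

text \<open>The disjoint complement of \<open>J\<close> within \<open>F\<close>, usually written
  \<open>J\<^sup>d\<close>.\<close>

definition compl :: "('x \<Rightarrow> real) set \<Rightarrow> ('x \<Rightarrow> real) set" where
  "compl J = {c\<in>F. \<forall>z\<in>J. AE x in M. min \<bar>c x\<bar> \<bar>z x\<bar> = 0}"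

lemma compl_subset: "compl J \<subseteq> F" by (auto simp: compl_def)

lemma compl_antimono: "I \<subseteq> J \<Longrightarrow> compl J \<subseteq> compl I"
  by (auto simp: compl_def)

lemma compl_solid:
  assumes "c \<in> compl J" "g \<in> F" "AE x in M. \<bar>g x\<bar> \<le> \<bar>c x\<bar>"
  shows "g \<in> compl J"
  using assms unfolding compl_def by (auto simp: min_def elim!: AE_mp split: if_splits)

lemma compl_max:
  assumes "c \<in> compl J" "d \<in> compl J" "AE x in M. 0 \<le> c x" "AE x in M. 0 \<le> d x"
  shows "(\<lambda>x. max (c x) (d x)) \<in> compl J"
  unfolding compl_def
proof (intro CollectI conjI ballI)
  show "(\<lambda>x. max (c x) (d x)) \<in> F" using assms max compl_subset by blast
  fix z assume "z \<in> J"
  then have "AE x in M. min \<bar>c x\<bar> \<bar>z x\<bar> = 0" "AE x in M. min \<bar>d x\<bar> \<bar>z x\<bar> = 0" using assms by (auto simp: compl_def)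
  then show "AE x in M. min \<bar>max (c x) (d x)\<bar> \<bar>z x\<bar> = 0" by eventually_elim (auto simp: max_def)
qed

lemma ideal_Int_compl:
  assumes "c \<in> compl J" "c \<in> J"
  shows "AE x in M. c x = 0"
  using assms by (auto simp: compl_def)

text \<open>This is the order density of \<open>J + J\<^sup>d\<close>: a lower bound \<open>w\<close> is disjoint from \<open>J\<close>, and anything in
  \<open>J\<close> or in \<open>J\<^sup>d\<close> below \<open>w\<close> is zero, because all its multiples stay below \<open>f\<close>.\<close>

lemma down_null_decomposition:
  assumes J: "ideal J" and f: "f \<in> F" and f0: "AE x in M. 0 \<le> f x"
  shows "down_null {(\<lambda>x. f x - (z x + c x)) | z c. z \<in> J \<and> c \<in> compl J \<and>
     (AE x in M. 0 \<le> z x \<and> 0 \<le> c x \<and> z x + c x \<le> f x)}" (is "down_null ?D")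
  unfolding down_null_def
proof (intro conjI ballI impI)
  have JF: "J \<subseteq> F" and J0: "(\<lambda>x. 0) \<in> J"
    and Jadd: "\<And>f g. f \<in> J \<Longrightarrow> g \<in> J \<Longrightarrow> (\<lambda>x. f x + g x) \<in> J"
    and Jsolid: "\<And>f g. f \<in> J \<Longrightarrow> g \<in> F \<Longrightarrow> AE x in M. \<bar>g x\<bar> \<le> \<bar>f x\<bar> \<Longrightarrow> g \<in> J"
    using J by (auto simp: ideal_def)
  have C0: "(\<lambda>x. 0) \<in> compl J" using zero by (auto simp: compl_def)
  show "?D \<subseteq> F" using JF compl_subset f by (auto intro!: diff add)
  have 0: "(\<lambda>x. f x - (0 + 0)) \<in> ?D" using J0 C0 f0
    by (intro CollectI exI[of _ "\<lambda>x. 0"]) auto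
  then show "?D \<noteq> {}" by blast
  show "AE x in M. 0 \<le> d x" if d: "d \<in> ?D" for d
  proof -
    obtain z c where zc: "d = (\<lambda>x. f x - (z x + c x))"
      "AE x in M. 0 \<le> z x \<and> 0 \<le> c x \<and> z x + c x \<le> f x" using d by blast
    show ?thesis using zc(2) by eventually_elim (simp add: zc(1))
  qed
  show "\<exists>b\<in>?D. AE x in M. b x \<le> min (d x) (e x)" if d: "d \<in> ?D" and e: "e \<in> ?D" for d e
  proof -
    obtain z c where zc: "d = (\<lambda>x. f x - (z x + c x))" "z \<in> J" "c \<in> compl J"
      "AE x in M. 0 \<le> z x \<and> 0 \<le> c x \<and> z x + c x \<le> f x" using d by blast
    obtain z' c' where zc': "e = (\<lambda>x. f x - (z' x + c' x))" "z' \<in> J" "c' \<in> compl J"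
      "AE x in M. 0 \<le> z' x \<and> 0 \<le> c' x \<and> z' x + c' x \<le> f x" using e by blast
    let ?z = "\<lambda>x. max (z x) (z' x)" and ?c = "\<lambda>x. max (c x) (c' x)"
    have z: "?z \<in> J"
    proof (rule Jsolid[OF Jadd[OF zc(2) zc'(2)]])
      show "?z \<in> F" using max zc zc' JF by blast
      show "AE x in M. \<bar>?z x\<bar> \<le> \<bar>z x + z' x\<bar>" using zc(4) zc'(4) by eventually_elim auto
    qed
    have c: "?c \<in> compl J"
      by (rule compl_max) (use zc zc' in \<open>auto elim: eventually_mono\<close>)
    \<comment> \<open>The sum of the two maxima stays below \<open>f\<close>: in the mixed cases
      \<open>z + c'\<close> and \<open>z' + c\<close> one summand vanishes by disjointness.\<close>
    have "AE x in M. min \<bar>c x\<bar> \<bar>z' x\<bar> = 0" "AE x in M. min \<bar>c' x\<bar> \<bar>z x\<bar> = 0"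
      using zc(2,3) zc'(2,3) by (auto simp: compl_def)
    then have "AE x in M. 0 \<le> ?z x \<and> 0 \<le> ?c x \<and> ?z x + ?c x \<le> f x" using zc(4) zc'(4)
      by eventually_elim (auto simp: max_def min_def split: if_splits)
    then have "(\<lambda>x. f x - (?z x + ?c x)) \<in> ?D" using z c
      by (intro CollectI exI[of _ ?z] exI[of _ ?c] conjI) auto
    then show ?thesis by (rule rev_bexI) (auto simp: zc(1) zc'(1))
  qed
  show "AE x in M. w x = 0" if w: "w \<in> F" "AE x in M. 0 \<le> w x" and le: "\<forall>d\<in>?D. AE x in M. w x \<le> d x" for w
  proof -
    have *: "AE x in M. v x = 0" if v: "v \<in> J \<or> v \<in> compl J" "AE x in M. 0 \<le> v x" "AE x in M. v x \<le> w x" for v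
    proof -
      \<comment> \<open>If \<open>k * v \<le> f\<close>, then \<open>f - k * v\<close> belongs to
        \<open>?D\<close>, hence \<open>v \<le> w \<le> f - k * v\<close>, which is the bound for
        \<open>k + 1\<close>.\<close>
      have "AE x in M. real k * v x \<le> f x" for k
      proof (induction k)
        case 0 show ?case using f0 by simp
      next
        case (Suc k)
        have "(\<lambda>x. real k * v x) \<in> J" if "v \<in> J"
          by (induction k) (use J0 Jadd[OF that] in \<open>auto simp: distrib_right\<close>)
        moreover have "(\<lambda>x. real k * v x) \<in> compl J" if "v \<in> compl J"
          unfolding compl_def
        proof (intro CollectI conjI ballI)
          show "(\<lambda>x. real k * v x) \<in> F" using that compl_subset by (auto intro: scale)
          fix z assume "z \<in> J"
          then have "AE x in M. min \<bar>v x\<bar> \<bar>z x\<bar> = 0" using that by (simp add: compl_def)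
          then show "AE x in M. min \<bar>real k * v x\<bar> \<bar>z x\<bar> = 0"
            by eventually_elim (auto simp: min_def split: if_splits)
        qed
        ultimately have "(\<lambda>x. f x - (real k * v x + 0)) \<in> ?D \<or> (\<lambda>x. f x - (0 + real k * v x)) \<in> ?D"
          using v(1)
        proof (elim disjE)
          assume "v \<in> J \<Longrightarrow> (\<lambda>x. real k * v x) \<in> J" "v \<in> J"
          then show ?thesis using C0 Suc v(2)
            by (intro disjI1 CollectI exI[of _ "\<lambda>x. real k * v x"] exI[of _ "\<lambda>x. 0"]) auto
        next
          assume "v \<in> compl J \<Longrightarrow> (\<lambda>x. real k * v x) \<in> compl J" "v \<in> compl J"
          then show ?thesis using J0 Suc v(2)
            by (intro disjI2 CollectI exI[of _ "\<lambda>x. real k * v x"] exI[of _ "\<lambda>x. 0"]) auto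
        qed
        then have "AE x in M. w x \<le> f x - real k * v x"
          using bspec[OF le, of "\<lambda>x. f x - (real k * v x + 0)"] bspec[OF le, of "\<lambda>x. f x - (0 + real k * v x)"]
          by auto
        then show ?case using v(3) by eventually_elim (auto simp: distrib_right)
      qed
      then have "AE x in M. v x \<le> 0" by (rule archimedean_AE)
      then show ?thesis using v(2) by eventually_elim auto
    qed
    have "w \<in> compl J"
      unfolding compl_def
    proof (intro CollectI conjI ballI)
      show "w \<in> F" by fact
      fix z assume z: "z \<in> J"
      let ?v = "\<lambda>x. min \<bar>w x\<bar> \<bar>z x\<bar>"
      have "?v \<in> J" by (rule Jsolid[OF z]) (use w z JF min abs in auto)
      then show "AE x in M. ?v x = 0"
        by (intro *) (use w in \<open>auto elim!: eventually_mono\<close>)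
    qed
    then show ?thesis by (intro *) (use w in auto)
  qed
qed

end

section \<open>Consequences of regularity\<close>

text \<open>The lower bound \<open>h\<close> ranges over all measurable functions: \<open>D\<close>
  decreases to zero in the whole function space and not only among the elements of
  \<open>F\<close>.\<close>

locale regular_function_lattice = function_lattice +
  assumes regular: "down_null D \<Longrightarrow> h \<in> borel_measurable M \<Longrightarrow>
      (\<And>d. d \<in> D \<Longrightarrow> AE x in M. h x \<le> d x) \<Longrightarrow> AE x in M. h x \<le> 0"
begin

lemma down_null_small:
  assumes "down_null D" "A \<in> fmeasurable M" "0 < e"
  shows "\<exists>d\<in>D. d \<in> small M A e"
  by (rule directed_Inf_small[OF assms(2,3)])
     (use assms(1) measurable regular[OF assms(1)] in \<open>auto simp: down_null_def\<close>)

text \<open>A substitute for a weak unit. The measure of the support of \<open>y\<close> in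
  \<open>A\<close> nearly attains its supremum; if some \<open>f\<close> had much support elsewhere,
  \<open>max \<bar>f\<bar> y\<close> would exceed that supremum.\<close>

lemma almost_full_support:
  assumes A: "A \<in> fmeasurable M" and e: "0 < e"
  obtains y where "y \<in> F" "AE x in M. 0 \<le> y x"
    "\<And>f. f \<in> F \<Longrightarrow> measure M {x\<in>A. f x \<noteq> 0 \<and> \<not> 0 < y x} < e"
proof -
  let ?P = "{y\<in>F. AE x in M. 0 \<le> y x}"
  let ?m = "\<lambda>y. measure M {x\<in>A. 0 < y x}"
  have S: "{x\<in>A. 0 < y x} \<in> fmeasurable M" if "y \<in> F" for y
    by (rule Collect_fmeasurable[OF A]) (use measurable[OF that] in measurable)
  have bdd: "bdd_above (?m ` ?P)"
    using S A by (intro bdd_aboveI[of _ "measure M A"]) (auto intro!: measure_mono_fmeasurable)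
  have ne: "?P \<noteq> {}" using zero by auto
  obtain y where y: "y \<in> ?P" "Sup (?m ` ?P) - e < ?m y"
    using less_cSUP_iff[OF ne bdd, of "Sup (?m ` ?P) - e"] e by auto
  show thesis
  proof (rule that)
    show "y \<in> F" "AE x in M. 0 \<le> y x" using y by auto
    fix f assume f: "f \<in> F"
    let ?g = "\<lambda>x. max \<bar>f x\<bar> (y x)"
    have "?g \<in> F" using f y by (intro max abs) auto
    then have g: "?g \<in> ?P" by (simp add: le_max_iff_disj)
    have eq: "{x\<in>A. f x \<noteq> 0 \<and> \<not> 0 < y x} = {x\<in>A. 0 < ?g x} - {x\<in>A. 0 < y x}" by (auto simp: less_max_iff_disj)
    have "measure M {x\<in>A. f x \<noteq> 0 \<and> \<not> 0 < y x} = ?m ?g - ?m y"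
      unfolding eq
    proof (rule measurable_measure_Diff)
      show "{x\<in>A. 0 < ?g x} \<in> fmeasurable M" using S g by blast
      show "{x\<in>A. 0 < y x} \<in> sets M" using S y by blast
    qed (auto simp: less_max_iff_disj)
    also have "\<dots> < e" using y(2) cSUP_upper[OF g bdd] by linarith
    finally show "measure M {x\<in>A. f x \<noteq> 0 \<and> \<not> 0 < y x} < e" .
  qed
qed

text \<open>Truncation by an element \<open>y\<close> of nearly full support loses little: where
  \<open>y\<close> is bounded away from zero, a small value of \<open>min f y\<close> can only come
  from a small value of \<open>f\<close>.\<close>

lemma uo_null_small:
  assumes F: "eventually (\<lambda>f. f \<in> F \<and> (AE x in M. 0 \<le> f x)) G"
    and G: "uo_null G" and A: "A \<in> fmeasurable M" and e: "0 < e"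
  shows "eventually (\<lambda>f. f \<in> small M A e) G"
proof -
  obtain y where y: "y \<in> F" "AE x in M. 0 \<le> y x"
    and yf: "\<And>f. f \<in> F \<Longrightarrow> measure M {x\<in>A. f x \<noteq> 0 \<and> \<not> 0 < y x} < e/3"
    using almost_full_support[OF A, of "e/3"] e by auto
  obtain \<eta> where \<eta>: "\<eta> > 0" "measure M {x\<in>A. 0 < y x \<and> y x < \<eta>} < e/3"
    using pos_level[OF A measurable[OF y(1)], of "e/3"] e by auto
  let ?d = "min (e/3) \<eta>"
  obtain D where D: "down_null D" "\<And>d. d \<in> D \<Longrightarrow> eventually (\<lambda>f. AE x in M. min (f x) (y x) \<le> d x) G"
    using G y unfolding uo_null_def by blast
  obtain d where d: "d \<in> D" "d \<in> small M A ?d" using down_null_small[OF D(1) A, of ?d] e \<eta> by auto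
  show ?thesis using F D(2)[OF d(1)]
  proof eventually_elim
    case (elim f)
    have [measurable]: "A \<in> sets M" "f \<in> borel_measurable M" "y \<in> borel_measurable M" "d \<in> borel_measurable M"
      using A elim y measurable d by (auto simp: small_def)
    \<comment> \<open>Outside these sets, wherever \<open>f\<close> is nonzero,
      \<open>y \<ge> \<eta> > d\<close>; then \<open>min f y \<le> d\<close> forces
      \<open>f \<le> d < e/3\<close>. Each of the sets has measure below \<open>e/3\<close>.\<close>
    let ?B1 = "{x\<in>A. f x \<noteq> 0 \<and> \<not> 0 < y x}" and ?B2 = "{x\<in>A. 0 < y x \<and> y x < \<eta>}"
      and ?B3 = "{x\<in>A. ?d \<le> \<bar>d x\<bar>}"
    have B: "?B1 \<in> fmeasurable M" "?B2 \<in> fmeasurable M" "?B3 \<in> fmeasurable M"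
      by (intro Collect_fmeasurable[OF A]; measurable)+
    have "measure M {x\<in>A. e \<le> \<bar>f x\<bar>} \<le> measure M (?B1 \<union> ?B2 \<union> ?B3)"
    proof (rule measure_mono_AE)
      show "{x\<in>A. e \<le> \<bar>f x\<bar>} \<in> fmeasurable M" by (intro Collect_fmeasurable[OF A]) measurable
      show "?B1 \<union> ?B2 \<union> ?B3 \<in> fmeasurable M" by (intro fmeasurable.Un B)
      have "AE x in M. 0 \<le> f x" using elim by simp
      then show "AE x in M. x \<in> {x\<in>A. e \<le> \<bar>f x\<bar>} \<longrightarrow> x \<in> ?B1 \<union> ?B2 \<union> ?B3"
        using elim(2) by eventually_elim (use e in \<open>auto simp: min_def split: if_splits\<close>)
    qed
    also have "\<dots> \<le> measure M (?B1 \<union> ?B2) + measure M ?B3" using B by (intro measure_Un_le) auto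
    also have "\<dots> \<le> measure M ?B1 + measure M ?B2 + measure M ?B3" using B by (intro add_right_mono measure_Un_le) auto
    also have "\<dots> < e"
    proof -
      have "measure M ?B1 < e/3" using yf elim by blast
      moreover have "measure M ?B3 < e/3" using d(2) by (auto simp: small_def)
      ultimately show ?thesis using \<eta>(2) by linarith
    qed
    finally show ?case by (simp add: small_def)
  qed
qed

text \<open>The suprema in the hypothesis are those of the space of all measurable functions, although
  uo-convergence in \<open>F\<close> refers to suprema in \<open>F\<close>, of which there may be few.\<close>

lemma uo_nullI:
  assumes nn: "eventually (\<lambda>f. f \<in> F \<and> (AE x in M. 0 \<le> f x)) G"
    and w0: "\<And>w. w \<in> F \<Longrightarrow> AE x in M. 0 \<le> w x \<Longrightarrow>
      (\<And>P u. eventually (\<lambda>f. f \<in> P) G \<Longrightarrow> P \<subseteq> F \<Longrightarrow> u \<in> borel_measurable M \<Longrightarrow> AE x in M. 0 \<le> u x \<Longrightarrow>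
         (\<And>f. f \<in> P \<Longrightarrow> AE x in M. min (f x) (w x) \<le> u x) \<Longrightarrow> AE x in M. w x \<le> u x) \<Longrightarrow>
      AE x in M. w x = 0"
  shows "uo_null G"
  unfolding uo_null_def
proof (intro ballI impI)
  fix y assume y: "y \<in> F" "AE x in M. 0 \<le> y x"
  \<comment> \<open>The largest candidate for a dominating family: all nonnegative eventual upper
    bounds of \<open>min f y\<close> in \<open>F\<close>. The point is that its infimum in
    \<open>F\<close> is zero.\<close>
  define D where "D = {z\<in>F. (AE x in M. 0 \<le> z x) \<and> eventually (\<lambda>f. AE x in M. min (f x) (y x) \<le> z x) G}"
  have yD: "y \<in> D" using y by (auto simp: D_def intro!: always_eventually)
  have "down_null D"
    unfolding down_null_def
  proof (intro conjI ballI impI)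
    show "D \<subseteq> F" "D \<noteq> {}" using yD by (auto simp: D_def)
    show "AE x in M. 0 \<le> d x" if "d \<in> D" for d using that by (simp add: D_def)
    show "\<exists>b\<in>D. AE x in M. b x \<le> min (c x) (d x)" if c: "c \<in> D" and d: "d \<in> D" for c d
    proof (intro bexI)
      show "(\<lambda>x. min (c x) (d x)) \<in> D"
        unfolding D_def
      proof (intro CollectI conjI)
        show "(\<lambda>x. min (c x) (d x)) \<in> F" using c d min by (auto simp: D_def)
        have "AE x in M. 0 \<le> c x" "AE x in M. 0 \<le> d x" using c d by (auto simp: D_def)
        then show "AE x in M. 0 \<le> min (c x) (d x)" by eventually_elim auto
        have "eventually (\<lambda>f. AE x in M. min (f x) (y x) \<le> c x) G"
          "eventually (\<lambda>f. AE x in M. min (f x) (y x) \<le> d x) G" using c d by (auto simp: D_def)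
        then show "eventually (\<lambda>f. AE x in M. min (f x) (y x) \<le> min (c x) (d x)) G"
          by eventually_elim (auto elim: AE_mp)
      qed
    qed auto
    fix w assume w: "w \<in> F" "AE x in M. 0 \<le> w x" and wD: "\<forall>d\<in>D. AE x in M. w x \<le> d x"
    show "AE x in M. w x = 0"
    proof (rule w0[OF w])
      fix P u assume P: "eventually (\<lambda>f. f \<in> P) G" "P \<subseteq> F" and u: "u \<in> borel_measurable M" "AE x in M. 0 \<le> u x"
        and Pu: "\<And>f. f \<in> P \<Longrightarrow> AE x in M. min (f x) (w x) \<le> u x"
      \<comment> \<open>Once \<open>E\<close> is known to decrease to zero in \<open>F\<close>,
        regularity applies to the measurable function \<open>w - u\<close>. It is a lower bound of
        \<open>E\<close>, because \<open>u\<close> dominates every \<open>s \<in> C\<close>; hence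
        \<open>w \<le> u\<close>.\<close>
      define U where "U = {u\<in>borel_measurable M. \<forall>f\<in>P. AE x in M. min (f x) (w x) \<le> u x}"
      have wU: "w \<in> U" using w measurable by (auto simp: U_def)
      define C where "C = {s\<in>F. (AE x in M. 0 \<le> s x) \<and> (\<forall>u\<in>U. (AE x in M. 0 \<le> u x) \<longrightarrow> (AE x in M. s x \<le> u x))}"
      have CU: "AE x in M. s x \<le> w x" if "s \<in> C" for s
        using that wU w by (auto simp: C_def)
      define E where "E = (\<lambda>s x. w x - s x) ` C"
      have archim: "AE x in M. v x = 0" if v: "v \<in> F" "AE x in M. 0 \<le> v x" and vE: "\<forall>d\<in>E. AE x in M. v x \<le> d x" for v
      proof -
        have C0: "(\<lambda>x. 0) \<in> C" using zero by (auto simp: C_def)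
        have vw: "AE x in M. v x \<le> w x"
        proof -
          have "(\<lambda>x. w x - 0) \<in> E" unfolding E_def by (rule image_eqI[OF _ C0]) simp
          then show ?thesis using vE by fastforce
        qed
        have bound: "AE x in M. min (f x) (w x) \<le> w x - v x" if f: "f \<in> P" "AE x in M. 0 \<le> f x" for f
        proof -
          have "(\<lambda>x. min (f x) (w x)) \<in> C"
            unfolding C_def
          proof (intro CollectI conjI ballI impI)
            show "(\<lambda>x. min (f x) (w x)) \<in> F" using f P w min by blast
            show "AE x in M. 0 \<le> min (f x) (w x)" using f(2) w(2) by eventually_elim auto
          qed (use f in \<open>auto simp: U_def\<close>)
          then have "(\<lambda>x. w x - min (f x) (w x)) \<in> E" by (auto simp: E_def)
          then have "AE x in M. v x \<le> w x - min (f x) (w x)" by (rule bspec[OF vE])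
          then show ?thesis by eventually_elim auto
        qed
        \<comment> \<open>Subtracting \<open>v\<close> from an eventual upper bound \<open>z\<close> of \<open>f \<and> y\<close> gives another one, since \<open>w \<le> z\<close>
          and \<open>f \<and> w \<le> w - v\<close>.\<close>
        have "(\<lambda>x. y x - real k * v x) \<in> D" for k
        proof (induction k)
          case 0 show ?case using yD by simp
        next
          case (Suc k)
          let ?z = "\<lambda>x. y x - real k * v x"
          have z: "eventually (\<lambda>f. AE x in M. min (f x) (y x) \<le> ?z x) G" using Suc by (simp add: D_def)
          have wz: "AE x in M. w x \<le> ?z x" by (rule bspec[OF wD Suc])
          have eq: "y x - real (Suc k) * v x = ?z x - v x" for x by (simp add: distrib_right)
          show ?case
            unfolding D_def eq
          proof (intro CollectI conjI)
            show "(\<lambda>x. ?z x - v x) \<in> F" using y v scale diff by blast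
            show "AE x in M. 0 \<le> ?z x - v x" using wz vw by eventually_elim linarith
            show "eventually (\<lambda>f. AE x in M. min (f x) (y x) \<le> ?z x - v x) G"
              using z nn P(1)
            proof eventually_elim
              case (elim f)
              have f0: "AE x in M. 0 \<le> f x" using elim by simp
              show ?case using elim(1) bound[OF elim(3) f0] wz vw f0 w(2) v(2)
                by eventually_elim (smt (verit) min_def)
            qed
          qed
        qed
        then have wk: "AE x in M. w x \<le> y x - real k * v x" for k by (rule bspec[OF wD])
        have "AE x in M. real k * v x \<le> y x" for k
          using wk[of k] w(2) by eventually_elim linarith
        then have "AE x in M. v x \<le> 0" by (rule archimedean_AE)
        then show ?thesis using v(2) by eventually_elim auto
      qed
      have E: "down_null E"
        unfolding down_null_def
      proof (intro conjI ballI impI)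
        show "E \<subseteq> F" using w diff by (auto simp: E_def C_def)
        show "E \<noteq> {}" using zero by (auto simp: E_def C_def)
        show "AE x in M. 0 \<le> d x" if "d \<in> E" for d using that CU by (auto simp: E_def)
        show "\<exists>b\<in>E. AE x in M. b x \<le> min (c x) (d x)" if c: "c \<in> E" and d: "d \<in> E" for c d
        proof -
          obtain s t where st: "s \<in> C" "t \<in> C" "c = (\<lambda>x. w x - s x)" "d = (\<lambda>x. w x - t x)"
            using c d by (auto simp: E_def)
          have "(\<lambda>x. max (s x) (t x)) \<in> C"
            unfolding C_def
          proof (intro CollectI conjI ballI impI)
            show "(\<lambda>x. max (s x) (t x)) \<in> F" using st max by (auto simp: C_def)
            have "AE x in M. 0 \<le> s x" using st by (simp add: C_def)
            then show "AE x in M. 0 \<le> max (s x) (t x)" by eventually_elim auto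
            fix u assume "u \<in> U" "AE x in M. 0 \<le> u x"
            then have "AE x in M. s x \<le> u x" "AE x in M. t x \<le> u x" using st by (auto simp: C_def)
            then show "AE x in M. max (s x) (t x) \<le> u x" by eventually_elim auto
          qed
          then have "(\<lambda>x. w x - max (s x) (t x)) \<in> E" by (auto simp: E_def)
          then show ?thesis by (rule rev_bexI) (auto simp: st)
        qed
      qed (use archim in auto)
      have uU: "u \<in> U" using u Pu by (simp add: U_def)
      have "AE x in M. w x - u x \<le> 0"
      proof (rule regular[OF E])
        show "(\<lambda>x. w x - u x) \<in> borel_measurable M" using u measurable[OF w(1)] by measurable
        fix d assume "d \<in> E"
        then obtain s where s: "s \<in> C" "d = (\<lambda>x. w x - s x)" by (auto simp: E_def)
        have "AE x in M. s x \<le> u x" using s uU u(2) by (simp add: C_def)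
        then show "AE x in M. w x - u x \<le> d x" by (auto simp: s)
      qed
      then show "AE x in M. w x \<le> u x" by eventually_elim simp
    qed
  qed
  then show "\<exists>D. down_null D \<and> (\<forall>d\<in>D. eventually (\<lambda>f. AE x in M. min (f x) (y x) \<le> d x) G)"
    by (intro exI[of _ D]) (simp add: D_def)
qed

end

section \<open>Solid neighbourhoods of zero in a uo-Lebesgue topology\<close>

text \<open>\<open>\<V>\<close> stands for the solid neighbourhoods of zero of a uo-Lebesgue topology.\<close>

locale uo_nbhds = regular_function_lattice +
  fixes \<V> :: "('a \<Rightarrow> real) set set"
  assumes nonempty: "\<V> \<noteq> {}"
    and subset: "V \<in> \<V> \<Longrightarrow> V \<subseteq> F"
    and zero_in: "V \<in> \<V> \<Longrightarrow> (\<lambda>x. 0) \<in> V"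
    and solid: "V \<in> \<V> \<Longrightarrow> f \<in> V \<Longrightarrow> g \<in> F \<Longrightarrow> AE x in M. \<bar>g x\<bar> \<le> \<bar>f x\<bar> \<Longrightarrow> g \<in> V"
    and half: "V \<in> \<V> \<Longrightarrow> \<exists>W\<in>\<V>. \<forall>f\<in>W. \<forall>g\<in>W. (\<lambda>x. f x + g x) \<in> V"
    and Int: "V \<in> \<V> \<Longrightarrow> W \<in> \<V> \<Longrightarrow> \<exists>U\<in>\<V>. U \<subseteq> V \<inter> W"
    and uo_null: "V \<in> \<V> \<Longrightarrow> eventually (\<lambda>f. f \<in> F \<and> (AE x in M. 0 \<le> f x)) G \<Longrightarrow> uo_null G \<Longrightarrow>
      eventually (\<lambda>f. f \<in> V) G"
begin

text \<open>The tails of \<open>D\<close> generate a uo-null filter, so some tail lies in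
  \<open>V\<close>, and a tail contains its starting element.\<close>

lemma down_null_in:
  assumes D: "down_null D" and V: "V \<in> \<V>"
  shows "\<exists>d\<in>D. d \<in> V"
proof -
  let ?S = "\<lambda>d. {c\<in>D. AE x in M. c x \<le> d x}"
  define G where "G = (INF d\<in>D. principal (?S d))"
  have DF: "D \<subseteq> F" "D \<noteq> {}" "\<And>d. d \<in> D \<Longrightarrow> AE x in M. 0 \<le> d x" using D by (auto simp: down_null_def)
  have ev: "eventually P G \<longleftrightarrow> (\<exists>d\<in>D. eventually P (principal (?S d)))" for P
    unfolding G_def
  proof (rule eventually_INF_base[OF DF(2)])
    fix c d assume "c \<in> D" "d \<in> D"
    then obtain b where b: "b \<in> D" "AE x in M. b x \<le> min (c x) (d x)"
      using D unfolding down_null_def by blast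
    have "?S b \<subseteq> ?S c \<inter> ?S d"
      using b(2) by (auto elim: AE_mp)
    then show "\<exists>b\<in>D. principal (?S b) \<le> Lattices.inf (principal (?S c)) (principal (?S d))"
      using b(1) by (intro bexI[of _ b]) simp_all
  qed
  have *: "eventually (\<lambda>f. f \<in> V) G"
  proof (rule uo_null[OF V])
    obtain d where "d \<in> D" using DF by blast
    then show "eventually (\<lambda>f. f \<in> F \<and> (AE x in M. 0 \<le> f x)) G"
      using DF unfolding ev by (intro bexI[of _ d]) (auto simp: eventually_principal)
    show "uo_null G"
      by (rule down_null_uo_null[OF D]) (auto simp: ev eventually_principal)
  qed
  then obtain d where d: "d \<in> D" "\<forall>f\<in>?S d. f \<in> V" unfolding ev by (auto simp: eventually_principal)
  have "d \<in> ?S d" using d(1) by simp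
  then show ?thesis using d by blast
qed

lemma decomposition:
  assumes "ideal J" "f \<in> F" "AE x in M. 0 \<le> f x" "V \<in> \<V>"
  obtains z c where "z \<in> J" "c \<in> compl J" "AE x in M. 0 \<le> z x \<and> 0 \<le> c x \<and> z x + c x \<le> f x"
    "(\<lambda>x. f x - (z x + c x)) \<in> V"
  using down_null_in[OF down_null_decomposition[OF assms(1-3)] assms(4)] by blast

lemma half_subset:
  assumes "V \<in> \<V>"
  obtains W where "W \<in> \<V>" "\<forall>f\<in>W. \<forall>g\<in>W. (\<lambda>x. f x + g x) \<in> V" "W \<subseteq> V"
proof -
  obtain W where W: "W \<in> \<V>" "\<forall>f\<in>W. \<forall>g\<in>W. (\<lambda>x. f x + g x) \<in> V" using half[OF assms] by blast
  have "f \<in> V" if "f \<in> W" for f using bspec[OF bspec[OF W(2) that] zero_in[OF W(1)]] by simp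
  then show thesis using that W by blast
qed

end

section \<open>Functions vanishing on a set of finite measure\<close>

definition vanishing :: "'x measure \<Rightarrow> ('x \<Rightarrow> real) set \<Rightarrow> 'x set \<Rightarrow> ('x \<Rightarrow> real) set" where
  "vanishing M F A = {f\<in>F. AE x in M. x \<in> A \<longrightarrow> f x = 0}"

context function_lattice begin

lemma ideal_vanishing: "ideal (vanishing M F A)"
  unfolding ideal_def vanishing_def
proof (intro conjI ballI impI CollectI)
  fix f g assume f: "f \<in> {f\<in>F. AE x in M. x \<in> A \<longrightarrow> f x = 0}"
  show "g \<in> F" if "g \<in> F" by fact
  show "AE x in M. x \<in> A \<longrightarrow> g x = 0" if le: "AE x in M. \<bar>g x\<bar> \<le> \<bar>f x\<bar>"
  proof -
    have "AE x in M. x \<in> A \<longrightarrow> f x = 0" using f by simp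
    then show ?thesis using le by eventually_elim auto
  qed
  assume g: "g \<in> {f\<in>F. AE x in M. x \<in> A \<longrightarrow> f x = 0}"
  show "(\<lambda>x. f x + g x) \<in> F" using f g by (auto intro: add)
  have "AE x in M. x \<in> A \<longrightarrow> f x = 0" "AE x in M. x \<in> A \<longrightarrow> g x = 0" using f g by auto
  then show "AE x in M. x \<in> A \<longrightarrow> f x + g x = 0" by eventually_elim auto
qed (auto intro: zero)

end

text \<open>If the support of \<open>f\<close> had infinite measure, it would contain a set of
  positive finite measure, on which \<open>f\<close> would have to vanish. So the support itself is
  one of the sets \<open>A\<close>.\<close>

lemma AE_zero_on_fmeasurable:
  assumes sf: "\<And>B. B \<in> sets M \<Longrightarrow> emeasure M B = \<infinity> \<Longrightarrow> \<exists>C\<in>sets M. C \<subseteq> B \<and> 0 < emeasure M C \<and> emeasure M C < \<infinity>"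
    and f: "f \<in> borel_measurable M"
    and 0: "\<And>A. A \<in> fmeasurable M \<Longrightarrow> AE x in M. x \<in> A \<longrightarrow> f x = (0::real)"
  shows "AE x in M. f x = 0"
proof -
  let ?B = "{x\<in>space M. f x \<noteq> 0}"
  have B: "?B \<in> sets M" using f by measurable
  have null: "emeasure M C = 0" if C: "C \<in> fmeasurable M" "C \<subseteq> ?B" for C
  proof -
    have "AE x in M. x \<notin> C" using 0[OF C(1)] by eventually_elim (use C(2) in auto)
    then show ?thesis using AE_iff_measurable[of C M "\<lambda>x. x \<notin> C"] C sets.sets_into_space by fastforce
  qed
  have "emeasure M ?B \<noteq> \<infinity>"
    using sf[OF B] null by (metis fmeasurableI less_irrefl)
  then have "?B \<in> fmeasurable M" using B by (auto intro: fmeasurableI simp: less_top)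
  from 0[OF this] show ?thesis using AE_space by eventually_elim auto
qed

locale semifinite_uo_nbhds = uo_nbhds +
  assumes semifinite: "B \<in> sets M \<Longrightarrow> emeasure M B = \<infinity> \<Longrightarrow>
      \<exists>C\<in>sets M. C \<subseteq> B \<and> 0 < emeasure M C \<and> emeasure M C < \<infinity>"
begin

lemma vanishing_subset:
  assumes V: "V \<in> \<V>"
  shows "\<exists>A\<in>fmeasurable M. vanishing M F A \<subseteq> V"
proof (rule ccontr)
  assume neg: "\<not> ?thesis"
  let ?S = "\<lambda>A. {f\<in>vanishing M F A. (AE x in M. 0 \<le> f x) \<and> f \<notin> V}"
  have S: "?S A \<noteq> {}" if A: "A \<in> fmeasurable M" for A
  proof -
    obtain f where f: "f \<in> vanishing M F A" "f \<notin> V" using neg A by blast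
    have fF: "f \<in> F" using f by (simp add: vanishing_def)
    have "AE x in M. x \<in> A \<longrightarrow> f x = 0" using f by (simp add: vanishing_def)
    then have "(\<lambda>x. \<bar>f x\<bar>) \<in> vanishing M F A" using abs[OF fF] by (simp add: vanishing_def)
    moreover have "(\<lambda>x. \<bar>f x\<bar>) \<notin> V" using solid[OF V, of "\<lambda>x. \<bar>f x\<bar>" f] fF f by auto
    ultimately have "(\<lambda>x. \<bar>f x\<bar>) \<in> ?S A" by simp
    then show ?thesis by blast
  qed
  \<comment> \<open>Enlarging \<open>A\<close> shrinks \<open>?S A\<close>, so these sets form a
    filter base, directed through unions.\<close>
  define G where "G = (INF A\<in>fmeasurable M. principal (?S A))"
  have ev: "eventually P G \<longleftrightarrow> (\<exists>A\<in>fmeasurable M. eventually P (principal (?S A)))" for P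
    unfolding G_def
  proof (rule eventually_INF_base)
    show "fmeasurable M \<noteq> {}" by blast
    fix A B assume AB: "A \<in> fmeasurable M" "B \<in> fmeasurable M"
    have "?S (A \<union> B) \<subseteq> ?S A \<inter> ?S B" unfolding vanishing_def by (auto elim!: eventually_mono)
    then show "\<exists>C\<in>fmeasurable M. principal (?S C) \<le> Lattices.inf (principal (?S A)) (principal (?S B))"
      using AB by (intro bexI[of _ "A \<union> B"] fmeasurable.Un) simp_all
  qed
  have nn: "eventually (\<lambda>f. f \<in> F \<and> (AE x in M. 0 \<le> f x)) G"
    unfolding ev by (intro bexI[of _ "{}"]) (auto simp: eventually_principal vanishing_def)
  have "uo_null G"
  proof (rule uo_nullI[OF nn])
    fix w assume w: "w \<in> F" "AE x in M. 0 \<le> w x"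
      and sup: "\<And>P u. eventually (\<lambda>f. f \<in> P) G \<Longrightarrow> P \<subseteq> F \<Longrightarrow> u \<in> borel_measurable M \<Longrightarrow> AE x in M. 0 \<le> u x \<Longrightarrow>
         (\<And>f. f \<in> P \<Longrightarrow> AE x in M. min (f x) (w x) \<le> u x) \<Longrightarrow> AE x in M. w x \<le> u x"
    note [measurable] = measurable[OF w(1)]
    show "AE x in M. w x = 0"
    proof (rule AE_zero_on_fmeasurable[OF semifinite measurable[OF w(1)]])
      fix A assume A: "A \<in> fmeasurable M"
      then have [measurable]: "A \<in> sets M" by auto
      \<comment> \<open>Every \<open>f \<in> ?S A\<close> vanishes on \<open>A\<close>, so cutting
        \<open>w\<close> off outside \<open>A\<close> still leaves an upper bound of the functions
        \<open>min f w\<close>. Therefore \<open>w\<close> vanishes on \<open>A\<close>.\<close>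
      have "AE x in M. w x \<le> w x * indicator (space M - A) x"
      proof (rule sup)
        show "eventually (\<lambda>f. f \<in> ?S A) G" using A by (auto simp: ev eventually_principal)
        show "?S A \<subseteq> F" by (auto simp: vanishing_def)
        show "(\<lambda>x. w x * indicator (space M - A) x) \<in> borel_measurable M" by measurable
        show "AE x in M. 0 \<le> w x * indicator (space M - A) x" using w(2) by eventually_elim auto
        fix f assume f: "f \<in> ?S A"
        then have "AE x in M. x \<in> A \<longrightarrow> f x = 0" by (simp add: vanishing_def)
        then show "AE x in M. min (f x) (w x) \<le> w x * indicator (space M - A) x"
          using AE_space by eventually_elim (auto simp: indicator_def)
      qed
      then show "AE x in M. x \<in> A \<longrightarrow> w x = 0" using w(2) by eventually_elim auto
    qed
  qed
  then have "eventually (\<lambda>f. f \<in> V) G" by (rule uo_null[OF V nn])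
  then obtain A where "A \<in> fmeasurable M" "\<forall>f\<in>?S A. f \<in> V" unfolding ev by (auto simp: eventually_principal)
  then show False using S by blast
qed

text \<open>Two applications of the criterion for uo-null filters. The pointwise suprema of
  \<open>min (c k) w\<close> over tails are upper bounds, and the limit on \<open>A\<close> then
  forces \<open>w = 0\<close> on \<open>A\<close>. So \<open>w\<close> lies in the ideal from which
  all \<open>c k\<close> are disjoint, and zero itself becomes an upper bound.\<close>

lemma small_tendsto_uo_null:
  assumes A: "A \<in> fmeasurable M" and c: "\<And>k. c k \<in> compl (vanishing M F A)"
    and nn: "\<And>k. AE x in M. 0 \<le> c k x"
    and lim: "AE x in M. x \<in> A \<longrightarrow> (\<lambda>k. c k x) \<longlonglongrightarrow> 0"
  shows "uo_null (filtermap c sequentially)"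
proof (rule uo_nullI)
  have cF: "c k \<in> F" for k using c compl_subset by blast
  show "eventually (\<lambda>f. f \<in> F \<and> (AE x in M. 0 \<le> f x)) (filtermap c sequentially)"
    using cF nn by (simp add: eventually_filtermap)
  fix w assume w: "w \<in> F" "AE x in M. 0 \<le> w x"
    and sup: "\<And>P u. eventually (\<lambda>f. f \<in> P) (filtermap c sequentially) \<Longrightarrow> P \<subseteq> F \<Longrightarrow> u \<in> borel_measurable M \<Longrightarrow> AE x in M. 0 \<le> u x \<Longrightarrow>
       (\<And>f. f \<in> P \<Longrightarrow> AE x in M. min (f x) (w x) \<le> u x) \<Longrightarrow> AE x in M. w x \<le> u x"
  have [measurable]: "w \<in> borel_measurable M" "\<And>k. c k \<in> borel_measurable M"
    using measurable w cF by auto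
  have "AE x in M. w x \<le> (SUP k. min (c (k + n) x) (w x))" for n
  proof (rule sup)
    show "eventually (\<lambda>f. f \<in> c ` {n..}) (filtermap c sequentially)"
      unfolding eventually_filtermap eventually_sequentially by auto
    show "c ` {n..} \<subseteq> F" using cF by auto
    have bdd: "bdd_above (range (\<lambda>k. min (c (k + n) x) (w x)))" for x
      by (rule bdd_aboveI2[of _ _ "w x"]) simp
    show "(\<lambda>x. SUP k. min (c (k + n) x) (w x)) \<in> borel_measurable M"
      by (intro borel_measurable_cSUP bdd) auto
    have up: "min (c (k + n) x) (w x) \<le> (SUP k. min (c (k + n) x) (w x))" for k x
      by (rule cSUP_upper[OF _ bdd]) simp
    show "AE x in M. 0 \<le> (SUP k. min (c (k + n) x) (w x))"
      using nn[of "0 + n"] w(2)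
    proof eventually_elim
      case (elim x)
      then show ?case using up[of 0 x] by linarith
    qed
    fix f assume "f \<in> c ` {n..}"
    then obtain k where "f = c (k + n)" by (metis atLeast_iff imageE le_add_diff_inverse2)
    then show "AE x in M. min (f x) (w x) \<le> (SUP k. min (c (k + n) x) (w x))" using up by simp
  qed
  then have "AE x in M. \<forall>n. w x \<le> (SUP k. min (c (k + n) x) (w x))" by (simp add: AE_all_countable)
  then have "AE x in M. x \<in> A \<longrightarrow> w x = 0" using lim w(2)
  proof eventually_elim
    case (elim x)
    show ?case
    proof (intro impI, rule ccontr)
      assume "x \<in> A" "w x \<noteq> 0"
      then have pos: "0 < w x / 2" using elim by simp
      have "(\<lambda>k. c k x) \<longlonglongrightarrow> 0" using elim \<open>x \<in> A\<close> by simp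
      then have "\<forall>\<^sub>F k in sequentially. c k x < w x / 2" using pos by (rule order_tendstoD)
      then obtain n where n: "\<And>k. n \<le> k \<Longrightarrow> c k x < w x / 2" by (auto simp: eventually_sequentially)
      have "(SUP k. min (c (k + n) x) (w x)) \<le> w x / 2"
      proof (rule cSUP_least)
        show "min (c (k + n) x) (w x) \<le> w x / 2" for k using n[of "k + n"] by linarith
      qed simp
      moreover have "w x \<le> (SUP k. min (c (k + n) x) (w x))" using elim by blast
      ultimately show False using pos by linarith
    qed
  qed
  then have wJ: "w \<in> vanishing M F A" using w by (simp add: vanishing_def)
  have "AE x in M. w x \<le> 0"
  proof (rule sup)
    show "eventually (\<lambda>f. f \<in> range c) (filtermap c sequentially)" by (simp add: eventually_filtermap)
    fix f assume "f \<in> range c"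
    then obtain k where k: "f = c k" by blast
    have "AE x in M. min \<bar>c k x\<bar> \<bar>w x\<bar> = 0" using c[of k] wJ by (simp add: compl_def)
    then show "AE x in M. min (f x) (w x) \<le> 0" unfolding k by eventually_elim (auto simp: min_def split: if_splits)
  qed (use cF in auto)
  then show "AE x in M. w x = 0" using w(2) by eventually_elim auto
qed

theorem small_subset:
  assumes V: "V \<in> \<V>"
  shows "\<exists>A\<in>fmeasurable M. \<exists>e>0. F \<inter> small M A e \<subseteq> V"
proof -
  \<comment> \<open>Two halvings, because \<open>\<bar>f k\<bar>\<close> will be written as three
    summands: an error term, \<open>z\<close> and \<open>c\<close>. The first two lie in
    \<open>W\<close>; if \<open>c\<close> did too, \<open>\<bar>f k\<bar>\<close> and hence
    \<open>f k\<close> would lie in \<open>V\<close>.\<close>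
  obtain W0 where W0: "W0 \<in> \<V>" "\<forall>f\<in>W0. \<forall>g\<in>W0. (\<lambda>x. f x + g x) \<in> V" "W0 \<subseteq> V"
    by (rule half_subset[OF V])
  obtain W where W: "W \<in> \<V>" "\<forall>f\<in>W. \<forall>g\<in>W. (\<lambda>x. f x + g x) \<in> W0" "W \<subseteq> W0"
    by (rule half_subset[OF W0(1)])
  obtain A where A: "A \<in> fmeasurable M" "vanishing M F A \<subseteq> W" using vanishing_subset[OF W(1)] by blast
  let ?J = "vanishing M F A"
  have "\<exists>k. F \<inter> small M A ((1/2)^k) \<subseteq> V"
  proof (rule ccontr)
    assume "\<not> ?thesis"
    then have "\<exists>f. f \<in> F \<and> f \<in> small M A ((1/2)^k) \<and> f \<notin> V" for k by blast
    then obtain f where f: "\<And>k. f k \<in> F" "\<And>k. f k \<in> small M A ((1/2)^k)" "\<And>k. f k \<notin> V" by metis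
    have "\<exists>c. c \<in> compl ?J \<and> (AE x in M. 0 \<le> c x) \<and> (AE x in M. c x \<le> \<bar>f k x\<bar>) \<and> c \<notin> W" for k
    proof -
      obtain z c where zc: "z \<in> ?J" "c \<in> compl ?J" "AE x in M. 0 \<le> z x \<and> 0 \<le> c x \<and> z x + c x \<le> \<bar>f k x\<bar>"
        "(\<lambda>x. \<bar>f k x\<bar> - (z x + c x)) \<in> W"
        by (rule decomposition[OF ideal_vanishing abs[OF f(1)] _ W(1)]) auto
      have "c \<notin> W"
      proof
        assume c: "c \<in> W"
        have "(\<lambda>x. \<bar>f k x\<bar> - (z x + c x) + z x) \<in> W0"
          by (rule bspec[OF bspec[OF W(2) zc(4)] subsetD[OF A(2) zc(1)]])
        from bspec[OF bspec[OF W0(2) this] subsetD[OF W(3) c]]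
        have "(\<lambda>x. \<bar>f k x\<bar> - (z x + c x) + z x + c x) \<in> V" .
        then have "(\<lambda>x. \<bar>f k x\<bar>) \<in> V" by (simp add: algebra_simps)
        then have "f k \<in> V" using solid[OF V _ f(1)] by simp
        then show False using f(3) by blast
      qed
      moreover have "AE x in M. 0 \<le> c x" "AE x in M. c x \<le> \<bar>f k x\<bar>"
        using zc(3) by (eventually_elim, simp)+
      ultimately show ?thesis using zc(2) by blast
    qed
    then obtain c where c: "\<And>k. c k \<in> compl ?J" "\<And>k. AE x in M. 0 \<le> c k x" "\<And>k. AE x in M. c k x \<le> \<bar>f k x\<bar>" "\<And>k. c k \<notin> W"
      by metis
    have cF: "c k \<in> F" for k using c compl_subset by blast
    have cs: "c k \<in> small M A ((1/2)^k)" for k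
    proof (rule small_solid[OF A(1) f(2) measurable[OF cF]])
      show "AE x in M. x \<in> A \<longrightarrow> \<bar>c k x\<bar> \<le> \<bar>f k x\<bar>" using c(2)[of k] c(3)[of k] by eventually_elim auto
    qed
    have "uo_null (filtermap c sequentially)"
      by (rule small_tendsto_uo_null[OF A(1) c(1,2) small_summable_tendsto[OF A(1) cs]])
    then have "eventually (\<lambda>f. f \<in> W) (filtermap c sequentially)"
      by (rule uo_null[OF W(1), rotated]) (simp add: eventually_filtermap cF c(2))
    then show False using c(4) by (simp add: eventually_filtermap)
  qed
  then obtain k where "F \<inter> small M A ((1/2)^k) \<subseteq> V" by blast
  then show ?thesis using A(1) by (intro bexI[of _ A] exI[of _ "(1/2)^k"]) simp_all
qed

end

section \<open>Normal sequences of neighbourhoods\<close>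

context uo_nbhds begin

text \<open>Countable chains make arguments by sequences and by measure possible, although
  \<open>\<V>\<close> itself may have no countable base. The intersection of a chain consists of the
  functions that it does not separate from zero.\<close>

definition normal_seq :: "(nat \<Rightarrow> ('a \<Rightarrow> real) set) \<Rightarrow> bool" where
  "normal_seq W \<longleftrightarrow> (\<forall>k. W k \<in> \<V>) \<and> (\<forall>k. \<forall>f\<in>W (Suc k). \<forall>g\<in>W (Suc k). (\<lambda>x. f x + g x) \<in> W k)"

lemma normal_seqD:
  assumes "normal_seq W"
  shows "W k \<in> \<V>" "f \<in> W (Suc k) \<Longrightarrow> g \<in> W (Suc k) \<Longrightarrow> (\<lambda>x. f x + g x) \<in> W k"
  using assms by (auto simp: normal_seq_def)

text \<open>Dependent choice: each term is taken inside \<open>X (Suc k)\<close> and inside a half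
  of its predecessor. Countably many requirements can thus be met by one sequence.\<close>

lemma normal_seq_below:
  fixes X :: "nat \<Rightarrow> ('a \<Rightarrow> real) set"
  assumes "\<And>k. X k \<in> \<V>"
  shows "\<exists>W. normal_seq W \<and> (\<forall>k. W k \<subseteq> X k)"
proof -
  have "\<exists>W. \<forall>k. (W k \<in> \<V> \<and> W k \<subseteq> X k) \<and> (\<forall>f\<in>W (Suc k). \<forall>g\<in>W (Suc k). (\<lambda>x. f x + g x) \<in> W k)"
  proof (rule dependent_nat_choice)
    show "\<exists>V. V \<in> \<V> \<and> V \<subseteq> X 0" using assms by blast
    fix V k assume "V \<in> \<V> \<and> V \<subseteq> X k"
    then obtain H where H: "H \<in> \<V>" "\<forall>f\<in>H. \<forall>g\<in>H. (\<lambda>x. f x + g x) \<in> V" using half by blast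
    obtain U where "U \<in> \<V>" "U \<subseteq> H \<inter> X (Suc k)" using Int[OF H(1) assms] by blast
    then show "\<exists>U. (U \<in> \<V> \<and> U \<subseteq> X (Suc k)) \<and> (\<forall>f\<in>U. \<forall>g\<in>U. (\<lambda>x. f x + g x) \<in> V)"
      using H(2) by (intro exI[of _ U]) blast
  qed
  then obtain W where W: "\<And>k. W k \<in> \<V>" "\<And>k. W k \<subseteq> X k"
    "\<And>k. \<forall>f\<in>W (Suc k). \<forall>g\<in>W (Suc k). (\<lambda>x. f x + g x) \<in> W k" by blast
  show ?thesis by (intro exI[of _ W] conjI allI) (use W in \<open>auto simp: normal_seq_def\<close>)
qed

lemma ideal_INT_normal_seq:
  assumes W: "normal_seq W"
  shows "ideal (\<Inter>k. W k)"
  unfolding ideal_def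
proof (intro conjI ballI impI)
  show "(\<Inter>k. W k) \<subseteq> F" using subset[OF normal_seqD(1)[OF W, of 0]] by blast
  show "(\<lambda>x. 0) \<in> (\<Inter>k. W k)" using zero_in normal_seqD(1)[OF W] by blast
  show "(\<lambda>x. f x + g x) \<in> (\<Inter>k. W k)" if "f \<in> (\<Inter>k. W k)" "g \<in> (\<Inter>k. W k)" for f g
    using normal_seqD(2)[OF W] that by blast
  show "g \<in> (\<Inter>k. W k)" if "f \<in> (\<Inter>k. W k)" "g \<in> F" "AE x in M. \<bar>g x\<bar> \<le> \<bar>f x\<bar>" for f g
    using solid[OF normal_seqD(1)[OF W]] that by blast
qed

text \<open>The intersection is closed for the given neighbourhoods: \<open>f\<close> is the sum of
  \<open>f - d\<close> and \<open>d\<close>, both in \<open>W (Suc k)\<close>, and so lies in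
  \<open>W k\<close>.\<close>

lemma INT_normal_seq_closed:
  assumes W: "normal_seq W" and d: "\<And>V. V \<in> \<V> \<Longrightarrow> \<exists>d\<in>(\<Inter>k. W k). (\<lambda>x. f x - d x) \<in> V"
  shows "f \<in> (\<Inter>k. W k)"
proof
  fix k
  obtain d where "d \<in> (\<Inter>k. W k)" "(\<lambda>x. f x - d x) \<in> W (Suc k)" using d[OF normal_seqD(1)[OF W]] by blast
  then show "f \<in> W k" using normal_seqD(2)[OF W, of "\<lambda>x. f x - d x" k d] by simp
qed

text \<open>The first summand and the remaining sum both lie in \<open>W (Suc n)\<close>, so the
  total lies in \<open>W n\<close>, whatever its length. This is why the indices start at
  \<open>Suc n\<close>.\<close>

lemma normal_seq_sum:
  assumes W: "normal_seq W" and c: "\<And>k. c k \<in> W k"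
  shows "(\<lambda>x. \<Sum>j<m. c (Suc n + j) x) \<in> W n"
proof (induction m arbitrary: n)
  case 0 show ?case using zero_in[OF normal_seqD(1)[OF W]] by simp
next
  case (Suc m)
  have "(\<lambda>x. c (Suc n) x + (\<Sum>j<m. c (Suc (Suc n) + j) x)) \<in> W n"
    by (rule normal_seqD(2)[OF W c Suc.IH])
  then show ?case by (simp add: sum.lessThan_Suc_shift del: sum.lessThan_Suc)
qed

end

section \<open>Neighbourhoods of a Hausdorff topology are contained in neighbourhoods for
  convergence in measure\<close>

locale hausdorff_uo_nbhds = semifinite_uo_nbhds +
  assumes hausdorff: "f \<in> F \<Longrightarrow> \<not> (AE x in M. f x = 0) \<Longrightarrow> \<exists>V\<in>\<V>. f \<notin> V"
begin

text \<open>By exhaustion: among all normal sequences \<open>W\<close> one chooses countably many together with elements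
  \<open>c\<close> of the disjoint complement of \<open>\<Inter>k. W k\<close> whose supports fill as much of \<open>A\<close> as possible.\<close>

lemma normal_seq_vanishing:
  assumes A: "A \<in> fmeasurable M"
  obtains U where "normal_seq U" "(\<Inter>k. U k) \<subseteq> vanishing M F A"
proof -
  let ?J = "vanishing M F A"
  define Q where "Q = {c. (\<exists>W. normal_seq W \<and> c \<in> compl (\<Inter>k. W k)) \<and> (AE x in M. 0 \<le> c x)}"
  let ?m = "\<lambda>c. measure M {x\<in>A. 0 < c x}"
  have QF: "Q \<subseteq> F" using compl_subset by (auto simp: Q_def)
  have S: "{x\<in>A. 0 < c x} \<in> fmeasurable M" if "c \<in> F" for c
    by (rule Collect_fmeasurable[OF A]) (use measurable[OF that] in measurable)
  have bdd: "bdd_above (?m ` Q)"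
    using S QF A by (intro bdd_aboveI[of _ "measure M A"]) (auto intro!: measure_mono_fmeasurable)
  have ne: "Q \<noteq> {}"
  proof -
    obtain V where V: "V \<in> \<V>" using nonempty by blast
    obtain W where "normal_seq W" using normal_seq_below[of "\<lambda>_. V", OF V] by blast
    then have "(\<lambda>x. 0) \<in> Q" using zero by (auto simp: Q_def compl_def)
    then show ?thesis by blast
  qed
  define s where "s = Sup (?m ` Q)"
  have "\<exists>c\<in>Q. s - 1 / Suc i < ?m c" for i
    using less_cSUP_iff[OF ne bdd, of "s - 1 / Suc i"] by (simp add: s_def)
  then obtain c where cQ: "\<And>i. c i \<in> Q" and cs: "\<And>i. s - 1 / Suc i < ?m (c i)" by metis
  have c0: "AE x in M. 0 \<le> c i x" for i using cQ[of i] by (simp add: Q_def)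
  have cF: "c i \<in> F" for i using cQ QF by blast
  have "\<forall>i. \<exists>W. normal_seq W \<and> c i \<in> compl (\<Inter>k. W k)" using cQ by (simp add: Q_def)
  then obtain W where W: "\<And>i. normal_seq (W i)" "\<And>i. c i \<in> compl (\<Inter>k. W i k)" by metis
  \<comment> \<open>All members of all the sequences \<open>W i\<close> in a single enumeration; the
    intersection of \<open>U\<close> is then contained in the intersection of each
    \<open>W i\<close>.\<close>
  let ?X = "\<lambda>n. W (fst (prod_decode n)) (snd (prod_decode n))"
  obtain U where U: "normal_seq U" "\<forall>n. U n \<subseteq> ?X n"
    using normal_seq_below[of ?X, OF normal_seqD(1)[OF W(1)]] by blast
  have "U (prod_encode (i, k)) \<subseteq> W i k" for i k using U(2)[rule_format, of "prod_encode (i, k)"] by simp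
  then have UW: "(\<Inter>k. U k) \<subseteq> (\<Inter>k. W i k)" for i by blast
  have cU: "c i \<in> compl (\<Inter>k. U k)" for i using compl_antimono[OF UW] W(2) by blast
  \<comment> \<open>Maximality of the choice: an element \<open>d\<close> belonging to a further
    refinement adds no support in \<open>A\<close> to that of the \<open>c i\<close>, as otherwise
    some \<open>max d (c i)\<close> would have a support of measure above \<open>s\<close>.\<close>
  have supp: "AE x in M. x \<in> A \<longrightarrow> 0 < d x \<longrightarrow> (\<exists>i. 0 < c i x)"
    if U': "normal_seq U'" "(\<Inter>k. U' k) \<subseteq> (\<Inter>k. U k)" and d: "d \<in> compl (\<Inter>k. U' k)" "AE x in M. 0 \<le> d x" for U' d
  proof -
    let ?B = "{x\<in>A. 0 < d x \<and> (\<forall>i. \<not> 0 < c i x)}"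
    have dF: "d \<in> F" using d compl_subset by blast
    note [measurable] = measurable[OF dF] measurable[OF cF]
    have B: "?B \<in> fmeasurable M" by (rule Collect_fmeasurable[OF A]) measurable
    have "measure M ?B \<le> 1 / Suc i" for i
    proof -
      let ?g = "\<lambda>x. max (d x) (c i x)"
      have "?g \<in> compl (\<Inter>k. U' k)" using compl_max[OF d(1) _ d(2) c0] cU compl_antimono[OF U'(2)] by blast
      moreover have "AE x in M. 0 \<le> ?g x" using d(2) by eventually_elim auto
      ultimately have g: "?g \<in> Q" using U'(1) by (auto simp: Q_def)
      have "measure M ?B \<le> measure M ({x\<in>A. 0 < ?g x} - {x\<in>A. 0 < c i x})"
        using B S[OF subsetD[OF QF g]] S[OF cF] by (intro measure_mono_fmeasurable) (auto intro: fmeasurable.Diff)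
      also have "\<dots> = ?m ?g - ?m (c i)"
      proof (rule measurable_measure_Diff)
        show "{x\<in>A. 0 < ?g x} \<in> fmeasurable M" using S QF g by blast
        show "{x\<in>A. 0 < c i x} \<in> sets M" using S cF by blast
      qed (auto simp: less_max_iff_disj)
      also have "\<dots> \<le> 1 / Suc i"
        using cSUP_upper[OF g bdd] cs[of i] unfolding s_def by linarith
      finally show ?thesis .
    qed
    then have "measure M ?B \<le> 0"
      by (intro LIMSEQ_le_const[OF LIMSEQ_inverse_real_of_nat]) (auto simp: inverse_eq_divide)
    then have "measure M ?B = 0" by (simp add: order_antisym)
    then have "?B \<in> null_sets M"
      using B by (auto simp: null_sets_def emeasure_eq_ennreal_measure fmeasurableD2)
    then have "AE x in M. x \<notin> ?B" by (rule AE_not_in)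
    then show ?thesis by eventually_elim blast
  qed
  \<comment> \<open>Otherwise some \<open>V\<close> excludes \<open>d\<close>, and \<open>U\<close>
    is refined to a sequence \<open>U'\<close> starting inside \<open>V\<close>. The part
    \<open>b\<close> of \<open>d\<close> disjoint from the intersection of \<open>U'\<close> lies in
    the intersection of \<open>U\<close>, so it is disjoint from all \<open>c i\<close> and by
    \<open>supp\<close> vanishes on \<open>A\<close>. Being below \<open>d \<in> compl ?J\<close>,
    it is zero. So \<open>d\<close> is approximated from the intersection of \<open>U'\<close> and
    hence lies in \<open>V\<close>, a contradiction.\<close>
  have zero: "AE x in M. d x = 0" if d: "d \<in> compl ?J" "d \<in> (\<Inter>k. U k)" "AE x in M. 0 \<le> d x" for d
  proof (rule ccontr)
    have dF: "d \<in> F" using d compl_subset by blast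
    assume "\<not> (AE x in M. d x = 0)"
    then obtain V where V: "V \<in> \<V>" "d \<notin> V" using hausdorff[OF dF] by blast
    \<comment> \<open>\<open>V\<close> takes index 0 and \<open>U\<close> is shifted by one, so that
      \<open>U' 0 \<subseteq> V\<close> and \<open>U' (Suc k) \<subseteq> U k\<close>.\<close>
    let ?Y = "case_nat V U"
    have "?Y n \<in> \<V>" for n using V normal_seqD(1)[OF U(1)] by (cases n) auto
    then obtain U' where U': "normal_seq U'" "\<forall>n. U' n \<subseteq> ?Y n"
      using normal_seq_below[of ?Y] by blast
    have "U' (Suc k) \<subseteq> U k" for k using U'(2)[rule_format, of "Suc k"] by simp
    then have U'U: "(\<Inter>k. U' k) \<subseteq> (\<Inter>k. U k)" by blast
    have "d \<in> (\<Inter>k. U' k)"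
    proof (rule INT_normal_seq_closed[OF U'(1)])
      fix X assume X: "X \<in> \<V>"
      obtain z b where zb: "z \<in> (\<Inter>k. U' k)" "b \<in> compl (\<Inter>k. U' k)" "AE x in M. 0 \<le> z x \<and> 0 \<le> b x \<and> z x + b x \<le> d x"
        "(\<lambda>x. d x - (z x + b x)) \<in> X"
        using decomposition[OF ideal_INT_normal_seq[OF U'(1)] dF d(3) X] .
      have bF: "b \<in> F" using zb compl_subset by blast
      have b0: "AE x in M. 0 \<le> b x" and bd: "AE x in M. \<bar>b x\<bar> \<le> \<bar>d x\<bar>"
        using zb(3) by (eventually_elim, simp)+
      have bU: "b \<in> (\<Inter>k. U k)" using ideal_INT_normal_seq[OF U(1)] d(2) bF bd unfolding ideal_def by blast
      have "AE x in M. min \<bar>c i x\<bar> \<bar>b x\<bar> = 0" for i using cU[of i] bU by (simp add: compl_def)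
      then have "AE x in M. \<forall>i. min \<bar>c i x\<bar> \<bar>b x\<bar> = 0" unfolding AE_all_countable by blast
      then have "AE x in M. x \<in> A \<longrightarrow> b x = 0"
        using supp[OF U'(1) U'U zb(2) b0] b0
      proof eventually_elim
        case (elim x)
        show ?case
        proof (intro impI, rule ccontr)
          assume "x \<in> A" "b x \<noteq> 0"
          then obtain i where "0 < c i x" using elim by auto
          then show False using elim(1)[rule_format, of i] \<open>b x \<noteq> 0\<close> by (auto simp: min_def split: if_splits)
        qed
      qed
      then have "b \<in> ?J" using bF by (simp add: vanishing_def)
      then have "AE x in M. b x = 0" using ideal_Int_compl[OF compl_solid[OF d(1) bF bd]] by blast
      then have "AE x in M. \<bar>d x - z x\<bar> \<le> \<bar>d x - (z x + b x)\<bar>" by eventually_elim simp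
      moreover have "(\<lambda>x. d x - z x) \<in> F"
        using zb(1) subset[OF normal_seqD(1)[OF U'(1), of 0]] by (intro diff[OF dF]) blast
      ultimately have "(\<lambda>x. d x - z x) \<in> X" using solid[OF X zb(4)] by blast
      then show "\<exists>z\<in>(\<Inter>k. U' k). (\<lambda>x. d x - z x) \<in> X" using zb(1) by blast
    qed
    then have "d \<in> U' 0" by blast
    then show False using U'(2)[rule_format, of 0] V(2) by auto
  qed
  have "f \<in> ?J" if f: "f \<in> (\<Inter>k. U k)" for f
  proof -
    have id: "ideal (\<Inter>k. U k)" by (rule ideal_INT_normal_seq[OF U(1)])
    have fF: "f \<in> F" using f subset[OF normal_seqD(1)[OF U(1), of 0]] by blast
    note [measurable] = measurable[OF fF] fmeasurableD[OF A]
    have a0: "AE x in M. 0 \<le> \<bar>f x\<bar>" by simp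
    \<comment> \<open>The part of \<open>f\<close> on \<open>A\<close> is a lower bound of the
      remainders \<open>\<bar>f\<bar> - (z + b)\<close>: \<open>z\<close> vanishes on
      \<open>A\<close>, and \<open>b\<close> is zero by the previous step. Regularity applies
      although this lower bound need not lie in \<open>F\<close>.\<close>
    have "AE x in M. \<bar>f x\<bar> * indicator A x \<le> 0"
    proof (rule regular[OF down_null_decomposition[OF ideal_vanishing[of A] abs[OF fF] a0]])
      show "(\<lambda>x. \<bar>f x\<bar> * indicator A x) \<in> borel_measurable M" by measurable
      fix d assume "d \<in> {(\<lambda>x. \<bar>f x\<bar> - (z x + c x)) |z c. z \<in> ?J \<and> c \<in> compl ?J \<and>
          (AE x in M. 0 \<le> z x \<and> 0 \<le> c x \<and> z x + c x \<le> \<bar>f x\<bar>)}"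
      then obtain z b where zb: "d = (\<lambda>x. \<bar>f x\<bar> - (z x + b x))" "z \<in> ?J" "b \<in> compl ?J"
        "AE x in M. 0 \<le> z x \<and> 0 \<le> b x \<and> z x + b x \<le> \<bar>f x\<bar>" by blast
      have bF: "b \<in> F" using zb compl_subset by blast
      have b0: "AE x in M. 0 \<le> b x" and bf: "AE x in M. \<bar>b x\<bar> \<le> \<bar>f x\<bar>"
        using zb(4) by (eventually_elim, simp)+
      have "b \<in> (\<Inter>k. U k)" using id f bF bf unfolding ideal_def by blast
      then have "AE x in M. b x = 0" using zero[OF zb(3) _ b0] by blast
      moreover have "AE x in M. x \<in> A \<longrightarrow> z x = 0" using zb(2) by (simp add: vanishing_def)
      ultimately show "AE x in M. \<bar>f x\<bar> * indicator A x \<le> d x"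
        using zb(4) by eventually_elim (auto simp: zb(1) indicator_def)
    qed
    then have "AE x in M. x \<in> A \<longrightarrow> f x = 0" by eventually_elim auto
    then show ?thesis using fF by (simp add: vanishing_def)
  qed
  then show thesis using that[OF U(1)] by blast
qed

theorem subset_small:
  assumes A: "A \<in> fmeasurable M" and e: "0 < e"
  shows "\<exists>V\<in>\<V>. V \<subseteq> small M A e"
proof (rule ccontr)
  assume neg: "\<not> ?thesis"
  let ?J = "vanishing M F A"
  obtain W where W: "normal_seq W" "(\<Inter>k. W k) \<subseteq> ?J" using normal_seq_vanishing[OF A] .
  \<comment> \<open>Up to an error small in measure, \<open>\<bar>f\<bar>\<close> is
    \<open>z + c\<close>. Since \<open>z\<close> vanishes on \<open>A\<close>, the failure of
    \<open>f\<close> to be small at \<open>e\<close> passes to \<open>c\<close> at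
    \<open>e/2\<close>.\<close>
  have "\<exists>c. c \<in> W k \<and> c \<in> compl ?J \<and> (AE x in M. 0 \<le> c x) \<and> c \<notin> small M A (e/2)" for k
  proof -
    have Wk: "W k \<in> \<V>" by (rule normal_seqD(1)[OF W(1)])
    then obtain f where f: "f \<in> W k" "f \<notin> small M A e" using neg by blast
    have fF: "f \<in> F" using subset[OF Wk] f by blast
    have a0: "AE x in M. 0 \<le> \<bar>f x\<bar>" by simp
    have "\<exists>d\<in>{(\<lambda>x. \<bar>f x\<bar> - (z x + c x)) |z c. z \<in> ?J \<and> c \<in> compl ?J \<and>
          (AE x in M. 0 \<le> z x \<and> 0 \<le> c x \<and> z x + c x \<le> \<bar>f x\<bar>)}. d \<in> small M A (e/2)"
      using e by (intro down_null_small[OF down_null_decomposition[OF ideal_vanishing abs[OF fF] a0] A]) auto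
    then obtain z c where zc: "z \<in> ?J" "c \<in> compl ?J"
      "AE x in M. 0 \<le> z x \<and> 0 \<le> c x \<and> z x + c x \<le> \<bar>f x\<bar>" "(\<lambda>x. \<bar>f x\<bar> - (z x + c x)) \<in> small M A (e/2)" by blast
    have cF: "c \<in> F" using zc compl_subset by blast
    have c0: "AE x in M. 0 \<le> c x" and cf: "AE x in M. \<bar>c x\<bar> \<le> \<bar>f x\<bar>"
      using zc(3) by (eventually_elim, simp)+
    have "c \<notin> small M A (e/2)"
    proof
      assume "c \<in> small M A (e/2)"
      from small_add[OF A zc(4) this] have s: "(\<lambda>x. \<bar>f x\<bar> - (z x + c x) + c x) \<in> small M A e" .
      have "AE x in M. x \<in> A \<longrightarrow> z x = 0" using zc(1) by (simp add: vanishing_def)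
      then have "AE x in M. x \<in> A \<longrightarrow> \<bar>f x\<bar> \<le> \<bar>\<bar>f x\<bar> - (z x + c x) + c x\<bar>" by eventually_elim auto
      then have "f \<in> small M A e" by (rule small_solid[OF A s measurable[OF fF]])
      then show False using f(2) by blast
    qed
    then show ?thesis using solid[OF Wk f(1) cF cf] zc(2) c0 by blast
  qed
  then obtain c where c: "\<And>k. c k \<in> W k" "\<And>k. c k \<in> compl ?J" "\<And>k. AE x in M. 0 \<le> c k x" "\<And>k. c k \<notin> small M A (e/2)"
    by metis
  have cF: "c k \<in> F" for k using c(2) compl_subset by blast
  have nn: "eventually (\<lambda>f. f \<in> F \<and> (AE x in M. 0 \<le> f x)) (filtermap c sequentially)"
    using cF c(3) by (simp add: eventually_filtermap)
  have "uo_null (filtermap c sequentially)"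
  proof (rule uo_nullI[OF nn])
    fix w assume w: "w \<in> F" "AE x in M. 0 \<le> w x"
      and sup: "\<And>P u. eventually (\<lambda>f. f \<in> P) (filtermap c sequentially) \<Longrightarrow> P \<subseteq> F \<Longrightarrow> u \<in> borel_measurable M \<Longrightarrow> AE x in M. 0 \<le> u x \<Longrightarrow>
         (\<And>f. f \<in> P \<Longrightarrow> AE x in M. min (f x) (w x) \<le> u x) \<Longrightarrow> AE x in M. w x \<le> u x"
    \<comment> \<open>The partial sums \<open>?s m\<close> of terms beyond \<open>Suc k\<close> all
      lie in \<open>W (Suc k)\<close>, and \<open>w - min (?s m) w\<close> decreases to zero, so it
      enters \<open>W (Suc k)\<close> for some \<open>m\<close>. By solidity
      \<open>min (?s m) w\<close> lies there too, and the two add up to \<open>w\<close>.\<close>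
    have "w \<in> W k" for k
    proof -
      let ?n = "Suc k"
      let ?s = "\<lambda>m x. \<Sum>j<m. c (Suc ?n + j) x"
      let ?p = "\<lambda>m x. w x - min (?s m x) (w x)"
      let ?D = "range ?p"
      have sW: "?s m \<in> W ?n" for m by (rule normal_seq_sum[OF W(1) c(1)])
      have sF: "?s m \<in> F" for m using sW subset[OF normal_seqD(1)[OF W(1)]] by blast
      have c0: "AE x in M. \<forall>j. 0 \<le> c j x" using c(3) unfolding AE_all_countable by blast
      have s0: "AE x in M. 0 \<le> ?s m x" for m using c0 by eventually_elim (simp add: sum_nonneg)
      have smono: "AE x in M. ?s m x \<le> ?s m' x" if "m \<le> m'" for m m'
        using c0 by eventually_elim (use that in \<open>auto intro!: sum_mono2\<close>)
      have pF: "(\<lambda>x. min (?s m x) (w x)) \<in> F" for m by (rule min[OF sF w(1)])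
      have "down_null ?D"
        unfolding down_null_def
      proof (intro conjI ballI impI)
        show "?D \<subseteq> F" using diff[OF w(1) pF] by blast
        show "?D \<noteq> {}" by simp
        show "AE x in M. 0 \<le> d x" if "d \<in> ?D" for d using that by auto
        show "\<exists>b\<in>?D. AE x in M. b x \<le> min (d x) (d' x)" if d: "d \<in> ?D" and d': "d' \<in> ?D" for d d'
        proof -
          obtain m m' where m: "d = (\<lambda>x. w x - min (?s m x) (w x))" "d' = (\<lambda>x. w x - min (?s m' x) (w x))"
            using d d' by blast
          let ?l = "Orderings.max m m'"
          have "AE x in M. w x - min (?s ?l x) (w x) \<le> min (d x) (d' x)"
            using smono[of m ?l, OF max.cobounded1] smono[of m' ?l, OF max.cobounded2]
            unfolding m by eventually_elim (auto simp: min_def)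
          then show ?thesis by (intro bexI[OF _ rangeI[of ?p ?l]])
        qed
        fix v assume v: "v \<in> F" "AE x in M. 0 \<le> v x" and vD: "\<forall>d\<in>?D. AE x in M. v x \<le> d x"
        have vm: "AE x in M. v x \<le> w x - min (?s m x) (w x)" for m by (rule bspec[OF vD rangeI])
        \<comment> \<open>Each \<open>c j\<close> of the tail is at most a partial sum, so a common
          lower bound \<open>v\<close> of \<open>?D\<close> makes \<open>w - v\<close> an upper
          bound of all \<open>min (c j) w\<close>. Then \<open>w \<le> w - v\<close>, that is,
          \<open>v \<le> 0\<close>.\<close>
        have "AE x in M. w x \<le> w x - v x"
        proof (rule sup)
          show "eventually (\<lambda>f. f \<in> c ` {Suc ?n..}) (filtermap c sequentially)"
            unfolding eventually_filtermap eventually_sequentially by auto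
          show "c ` {Suc ?n..} \<subseteq> F" using cF by auto
          show "(\<lambda>x. w x - v x) \<in> borel_measurable M" using measurable diff w v by blast
          show "AE x in M. 0 \<le> w x - v x" using vm[of 0] w(2) by eventually_elim simp
          fix f assume "f \<in> c ` {Suc ?n..}"
          then obtain j where f: "f = c (Suc ?n + j)" by (metis atLeast_iff imageE le_add_diff_inverse)
          show "AE x in M. min (f x) (w x) \<le> w x - v x"
            using vm[of "Suc j"] c0
          proof eventually_elim
            case (elim x)
            have "f x \<le> ?s (Suc j) x" unfolding f
              by (rule member_le_sum[of j "{..<Suc j}" "\<lambda>j. c (Suc ?n + j) x"]) (use elim in auto)
            then show ?case using elim(1) by (auto simp: min_def split: if_splits)
          qed
        qed
        then show "AE x in M. v x = 0" using v(2) by eventually_elim auto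
      qed
      then obtain m where m: "(\<lambda>x. w x - min (?s m x) (w x)) \<in> W ?n"
        using down_null_in[OF _ normal_seqD(1)[OF W(1)]] by blast
      have "(\<lambda>x. min (?s m x) (w x)) \<in> W ?n"
      proof (rule solid[OF normal_seqD(1)[OF W(1)] sW pF])
        show "AE x in M. \<bar>min (?s m x) (w x)\<bar> \<le> \<bar>?s m x\<bar>" using s0 w(2) by eventually_elim auto
      qed
      from normal_seqD(2)[OF W(1) m this] show ?thesis by simp
    qed
    \<comment> \<open>Now \<open>w\<close> is disjoint from every \<open>c k\<close>, so zero is an
      upper bound of all \<open>min (c k) w\<close>.\<close>
    then have wJ: "w \<in> ?J" using W(2) by blast
    have "AE x in M. w x \<le> 0"
    proof (rule sup)
      show "eventually (\<lambda>f. f \<in> range c) (filtermap c sequentially)" by (simp add: eventually_filtermap)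
      fix f assume "f \<in> range c"
      then obtain k where k: "f = c k" by blast
      have "AE x in M. min \<bar>c k x\<bar> \<bar>w x\<bar> = 0" using c(2)[of k] wJ by (simp add: compl_def)
      then show "AE x in M. min (f x) (w x) \<le> 0" unfolding k by eventually_elim (auto simp: min_def split: if_splits)
    qed (use cF in auto)
    then show "AE x in M. w x = 0" using w(2) by eventually_elim auto
  qed
  then have "eventually (\<lambda>f. f \<in> small M A (e/2)) (filtermap c sequentially)"
    using e by (intro uo_null_small[OF nn _ A]) auto
  then show False using c(4) by (simp add: eventually_filtermap)
qed

end

section \<open>Classes of measurable functions\<close>

text \<open>All representatives of the classes in \<open>E\<close>, so that pointwise operations can
  be performed on functions without returning to the chosen \<open>rep\<close>.\<close>

definition members :: "'x measure \<Rightarrow> ('x \<Rightarrow> real) set set \<Rightarrow> ('x \<Rightarrow> real) set" where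
  "members M E = {f \<in> borel_measurable M. ae_class M f \<in> E}"

lemma le_ae_class_iff:
  assumes "f \<in> borel_measurable M" "g \<in> borel_measurable M"
  shows "ae_class M f \<sqsubseteq>\<^bsub>L0 M\<^esub> ae_class M g \<longleftrightarrow> (AE x in M. f x \<le> g x)"
  unfolding L0_simps
proof
  show "AE x in M. f x \<le> g x" if "AE x in M. rep (ae_class M f) x \<le> rep (ae_class M g) x"
    using that rep_ae_class(2)[OF assms(1)] rep_ae_class(2)[OF assms(2)] by eventually_elim simp
  show "AE x in M. rep (ae_class M f) x \<le> rep (ae_class M g) x" if "AE x in M. f x \<le> g x"
    using that rep_ae_class(2)[OF assms(1)] rep_ae_class(2)[OF assms(2)] by eventually_elim simp
qed

lemma vadd_ae_class:
  assumes "f \<in> borel_measurable M" "g \<in> borel_measurable M"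
  shows "vadd (L0 M) (ae_class M f) (ae_class M g) = ae_class M (\<lambda>x. f x + g x)"
proof -
  have "AE x in M. rep (ae_class M f) x + rep (ae_class M g) x = f x + g x"
    using rep_ae_class(2)[OF assms(1)] rep_ae_class(2)[OF assms(2)] by eventually_elim simp
  then show ?thesis
    unfolding L0_simps using rep_ae_class(1)[OF assms(1)] rep_ae_class(1)[OF assms(2)] assms
    by (subst ae_class_eq_iff) auto
qed

lemma vscale_ae_class:
  assumes "f \<in> borel_measurable M"
  shows "vscale (L0 M) c (ae_class M f) = ae_class M (\<lambda>x. c * f x)"
proof -
  have "AE x in M. c * rep (ae_class M f) x = c * f x"
    using rep_ae_class(2)[OF assms(1)] by eventually_elim simp
  then show ?thesis
    unfolding L0_simps using rep_ae_class(1)[OF assms(1)] assms by (subst ae_class_eq_iff) auto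
qed

text \<open>Makes \<open>L0 M\<close> itself an instance of the results about
  \<open>restrict_vl (L0 M) E\<close>.\<close>

lemma restrict_vl_carrier: "restrict_vl (L0 M) (carrier (L0 M)) = L0 M"
  by (simp add: L0_def)

lemma restrict_vl_simps [simp]:
  "vadd (restrict_vl V E) = vadd V" "vzero (restrict_vl V E) = vzero V" "vscale (restrict_vl V E) = vscale V"
  "(\<sqsubseteq>\<^bsub>restrict_vl V E\<^esub>) = (\<sqsubseteq>\<^bsub>V\<^esub>)" "vdiff (restrict_vl V E) = vdiff V"
  by (simp_all add: vdiff_def fun_eq_iff)

text \<open>The join is a choice of a least upper bound relative to the carrier \<open>E\<close>.
  The pointwise maximum is one, and antisymmetry almost everywhere makes it the only one.\<close>

lemma join_restrict_vl:
  assumes E: "E \<subseteq> carrier (L0 M)" and f: "f \<in> members M E" and g: "g \<in> members M E"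
    and m: "(\<lambda>x. max (f x) (g x)) \<in> members M E"
  shows "ae_class M f \<squnion>\<^bsub>restrict_vl (L0 M) E\<^esub> ae_class M g = ae_class M (\<lambda>x. max (f x) (g x))"
proof -
  let ?R = "restrict_vl (L0 M) E" and ?m = "\<lambda>x. max (f x) (g x)"
  have meas: "f \<in> borel_measurable M" "g \<in> borel_measurable M" "?m \<in> borel_measurable M"
    and cl: "ae_class M f \<in> E" "ae_class M g \<in> E" "ae_class M ?m \<in> E"
    using f g m by (auto simp: members_def)
  have lub: "is_lub ?R (ae_class M ?m) {ae_class M f, ae_class M g}"
    unfolding least_def
  proof (intro conjI ballI)
    show "Upper ?R {ae_class M f, ae_class M g} \<subseteq> carrier ?R" by (auto simp: Upper_def)
    show "ae_class M ?m \<in> Upper ?R {ae_class M f, ae_class M g}"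
      using cl by (auto simp: Upper_def le_ae_class_iff meas)
    fix u assume "u \<in> Upper ?R {ae_class M f, ae_class M g}"
    then have u: "u \<in> carrier (L0 M)" "ae_class M f \<sqsubseteq>\<^bsub>L0 M\<^esub> u" "ae_class M g \<sqsubseteq>\<^bsub>L0 M\<^esub> u"
      using cl E by (auto simp: Upper_def)
    obtain h where h: "h \<in> borel_measurable M" "u = ae_class M h" by (rule L0_cases[OF u(1)])
    have "AE x in M. f x \<le> h x" "AE x in M. g x \<le> h x" using u(2,3) by (simp_all add: h le_ae_class_iff meas)
    then have "AE x in M. ?m x \<le> h x" by eventually_elim simp
    then show "ae_class M ?m \<sqsubseteq>\<^bsub>?R\<^esub> u" by (simp add: h le_ae_class_iff meas)
  qed
  show ?thesis
    unfolding join_def sup_def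
  proof (rule some_equality)
    show "is_lub ?R (ae_class M ?m) {ae_class M f, ae_class M g}" by (rule lub)
    fix u assume u: "is_lub ?R u {ae_class M f, ae_class M g}"
    note u = u[unfolded least_def] and m = lub[unfolded least_def]
    have "u \<sqsubseteq>\<^bsub>?R\<^esub> ae_class M ?m" "ae_class M ?m \<sqsubseteq>\<^bsub>?R\<^esub> u" "u \<in> carrier ?R"
      using bspec[OF u[THEN conjunct2, THEN conjunct2] m[THEN conjunct2, THEN conjunct1]] bspec[OF m[THEN conjunct2, THEN conjunct2] u[THEN conjunct2, THEN conjunct1]] u[THEN conjunct1] u[THEN conjunct2, THEN conjunct1] by auto
    then have le: "u \<sqsubseteq>\<^bsub>L0 M\<^esub> ae_class M ?m" "ae_class M ?m \<sqsubseteq>\<^bsub>L0 M\<^esub> u" "u \<in> carrier (L0 M)" using E by auto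
    have "AE x in M. rep u x = rep (ae_class M ?m) x"
      using le(1,2) unfolding L0_simps by eventually_elim simp
    then show "u = ae_class M ?m" using le(3) ae_class_in_L0[OF meas(3)] by (intro L0_eqI)
  qed
qed

lemma meet_restrict_vl:
  assumes E: "E \<subseteq> carrier (L0 M)" and f: "f \<in> members M E" and g: "g \<in> members M E"
    and m: "(\<lambda>x. min (f x) (g x)) \<in> members M E"
  shows "ae_class M f \<sqinter>\<^bsub>restrict_vl (L0 M) E\<^esub> ae_class M g = ae_class M (\<lambda>x. min (f x) (g x))"
proof -
  let ?R = "restrict_vl (L0 M) E" and ?m = "\<lambda>x. min (f x) (g x)"
  have meas: "f \<in> borel_measurable M" "g \<in> borel_measurable M" "?m \<in> borel_measurable M"
    and cl: "ae_class M f \<in> E" "ae_class M g \<in> E" "ae_class M ?m \<in> E"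
    using f g m by (auto simp: members_def)
  have glb: "is_glb ?R (ae_class M ?m) {ae_class M f, ae_class M g}"
    unfolding greatest_def
  proof (intro conjI ballI)
    show "Lower ?R {ae_class M f, ae_class M g} \<subseteq> carrier ?R" by (auto simp: Lower_def)
    show "ae_class M ?m \<in> Lower ?R {ae_class M f, ae_class M g}"
      using cl by (auto simp: Lower_def le_ae_class_iff meas)
    fix u assume "u \<in> Lower ?R {ae_class M f, ae_class M g}"
    then have u: "u \<in> carrier (L0 M)" "u \<sqsubseteq>\<^bsub>L0 M\<^esub> ae_class M f" "u \<sqsubseteq>\<^bsub>L0 M\<^esub> ae_class M g"
      using cl E by (auto simp: Lower_def)
    obtain h where h: "h \<in> borel_measurable M" "u = ae_class M h" by (rule L0_cases[OF u(1)])
    have "AE x in M. h x \<le> f x" "AE x in M. h x \<le> g x" using u(2,3) by (simp_all add: h le_ae_class_iff meas)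
    then have "AE x in M. h x \<le> ?m x" by eventually_elim simp
    then show "u \<sqsubseteq>\<^bsub>?R\<^esub> ae_class M ?m" by (simp add: h le_ae_class_iff meas)
  qed
  show ?thesis
    unfolding meet_def inf_def
  proof (rule some_equality)
    show "is_glb ?R (ae_class M ?m) {ae_class M f, ae_class M g}" by (rule glb)
    fix u assume u: "is_glb ?R u {ae_class M f, ae_class M g}"
    note u = u[unfolded greatest_def] and m = glb[unfolded greatest_def]
    have "u \<sqsubseteq>\<^bsub>?R\<^esub> ae_class M ?m" "ae_class M ?m \<sqsubseteq>\<^bsub>?R\<^esub> u" "u \<in> carrier ?R"
      using bspec[OF u[THEN conjunct2, THEN conjunct2] m[THEN conjunct2, THEN conjunct1]] bspec[OF m[THEN conjunct2, THEN conjunct2] u[THEN conjunct2, THEN conjunct1]] u[THEN conjunct1] u[THEN conjunct2, THEN conjunct1] by auto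
    then have le: "u \<sqsubseteq>\<^bsub>L0 M\<^esub> ae_class M ?m" "ae_class M ?m \<sqsubseteq>\<^bsub>L0 M\<^esub> u" "u \<in> carrier (L0 M)" using E by auto
    have "AE x in M. rep u x = rep (ae_class M ?m) x"
      using le(1,2) unfolding L0_simps by eventually_elim simp
    then show "u = ae_class M ?m" using le(3) ae_class_in_L0[OF meas(3)] by (intro L0_eqI)
  qed
qed

lemma members_carrier: "members M (carrier (L0 M)) = borel_measurable M"
  by (auto simp: members_def ae_class_in_L0)

lemma ae_class_max:
  assumes "f \<in> borel_measurable M" "g \<in> borel_measurable M"
  shows "ae_class M f \<squnion>\<^bsub>L0 M\<^esub> ae_class M g = ae_class M (\<lambda>x. max (f x) (g x))"
  using join_restrict_vl[of "carrier (L0 M)" M f g] assms by (simp add: members_carrier restrict_vl_carrier)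

section \<open>Vector sublattices of \<open>L0 M\<close> as lattices of functions\<close>

locale L0_sublattice =
  fixes M :: "'x measure" and E :: "('x \<Rightarrow> real) set set"
  assumes sublattice: "vector_sublattice (L0 M) E"
begin

abbreviation R :: "('x \<Rightarrow> real) set vlattice" where "R \<equiv> restrict_vl (L0 M) E"

abbreviation F :: "('x \<Rightarrow> real) set" where "F \<equiv> members M E"

lemma subset_carrier: "E \<subseteq> carrier (L0 M)"
  using sublattice by (simp add: vector_sublattice_def)

sublocale function_lattice M F
proof
  fix f g assume f: "f \<in> F"
  then show "f \<in> borel_measurable M" by (simp add: members_def)
  show "(\<lambda>x. c * f x) \<in> F" for c
    using f sublattice vscale_ae_class[of f M c, symmetric] by (auto simp: members_def vector_sublattice_def)
  assume g: "g \<in> F"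
  show "(\<lambda>x. f x + g x) \<in> F"
    using f g sublattice vadd_ae_class[of f M g, symmetric] by (auto simp: members_def vector_sublattice_def)
  have "ae_class M f \<squnion>\<^bsub>L0 M\<^esub> ae_class M g \<in> E"
    using f g sublattice by (auto simp: members_def vector_sublattice_def)
  then show "(\<lambda>x. max (f x) (g x)) \<in> F"
    using f g ae_class_max[of f M g] by (auto simp: members_def)
next
  show "(\<lambda>x. 0) \<in> F" using sublattice by (simp add: members_def vector_sublattice_def L0_simps)
qed

lemma rep_mem: "a \<in> E \<Longrightarrow> rep a \<in> F"
  using subset_carrier ae_class_rep[of a M] rep_measurable[of a M] by (auto simp: members_def)

lemma ae_class_mem: "f \<in> F \<Longrightarrow> ae_class M f \<in> E"
  by (simp add: members_def)

lemma ae_class_rep: "a \<in> E \<Longrightarrow> ae_class M (rep a) = a"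
  using subset_carrier ae_class_rep by blast

lemma rep_ae_class: "f \<in> F \<Longrightarrow> AE x in M. rep (ae_class M f) x = f x"
  by (intro rep_ae_class measurable)

lemma le_iff: "f \<in> F \<Longrightarrow> g \<in> F \<Longrightarrow> ae_class M f \<sqsubseteq>\<^bsub>L0 M\<^esub> ae_class M g \<longleftrightarrow> (AE x in M. f x \<le> g x)"
  by (intro le_ae_class_iff measurable)

lemma vadd_class: "f \<in> F \<Longrightarrow> g \<in> F \<Longrightarrow> vadd (L0 M) (ae_class M f) (ae_class M g) = ae_class M (\<lambda>x. f x + g x)"
  by (intro vadd_ae_class measurable)

lemma vscale_class: "f \<in> F \<Longrightarrow> vscale (L0 M) c (ae_class M f) = ae_class M (\<lambda>x. c * f x)"
  by (intro vscale_ae_class measurable)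

lemma vdiff_class: "f \<in> F \<Longrightarrow> g \<in> F \<Longrightarrow> vdiff (L0 M) (ae_class M f) (ae_class M g) = ae_class M (\<lambda>x. f x - g x)"
  using vscale_class[of g "-1"] vadd_class[of f "\<lambda>x. - 1 * g x"] scale[of g "-1"]
  by (simp add: vdiff_def)

lemma meet_class: "f \<in> F \<Longrightarrow> g \<in> F \<Longrightarrow> ae_class M f \<sqinter>\<^bsub>R\<^esub> ae_class M g = ae_class M (\<lambda>x. min (f x) (g x))"
  by (intro meet_restrict_vl subset_carrier min)

lemma vabs_class: "f \<in> F \<Longrightarrow> vabs R (ae_class M f) = ae_class M (\<lambda>x. \<bar>f x\<bar>)"
proof -
  assume f: "f \<in> F"
  have "(\<lambda>x. max (f x) (-1 * f x)) = (\<lambda>x. \<bar>f x\<bar>)" by (auto simp: max_def)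
  then show ?thesis
    using join_restrict_vl[OF subset_carrier f scale[OF f, of "-1"] max[OF f scale[OF f, of "-1"]]] f
    by (simp add: vabs_def vscale_class)
qed

lemma vzero_class: "vzero (L0 M) = ae_class M (\<lambda>x. 0)"
  by (simp add: L0_simps)

lemma vzero_mem: "vzero (L0 M) \<in> E"
  unfolding vzero_class by (rule ae_class_mem[OF zero])

lemma E_cases:
  assumes "a \<in> E"
  obtains f where "f \<in> F" "a = ae_class M f"
  using rep_mem[OF assms] ae_class_rep[OF assms] by metis

section \<open>Order and uo-convergence translated between nets of classes and families of
  functions\<close>

lemma decreases_to_down_null:
  assumes "decreases_to R I r y (vzero (L0 M))"
  shows "down_null ((\<lambda>i. rep (y i)) ` I)"
proof -
  have dir: "directed I r" and y: "\<And>i. i \<in> I \<Longrightarrow> y i \<in> E"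
    and mono: "\<And>i j. i \<in> I \<Longrightarrow> j \<in> I \<Longrightarrow> r i j \<Longrightarrow> y j \<sqsubseteq>\<^bsub>L0 M\<^esub> y i"
    and glb: "is_glb R (vzero (L0 M)) (y ` I)"
    using assms unfolding decreases_to_def by auto
  have yI: "y ` I \<inter> E = y ` I" using y by blast
  show ?thesis
    unfolding down_null_def
  proof (intro conjI ballI impI)
    show "(\<lambda>i. rep (y i)) ` I \<subseteq> F" using y rep_mem by blast
    show "(\<lambda>i. rep (y i)) ` I \<noteq> {}" using directed_nonempty[OF dir] by simp
    fix d assume d: "d \<in> (\<lambda>i. rep (y i)) ` I"
    then obtain i where i: "i \<in> I" "d = rep (y i)" by blast
    have "vzero (L0 M) \<sqsubseteq>\<^bsub>L0 M\<^esub> y i" using glb i(1) y by (auto simp: greatest_def Lower_def)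
    then show "AE x in M. 0 \<le> d x" 
      using rep_ae_class[OF zero] unfolding L0_simps i by eventually_elim simp
    fix c assume c: "c \<in> (\<lambda>i. rep (y i)) ` I"
    then obtain j where j: "j \<in> I" "c = rep (y j)" by blast
    obtain k where k: "k \<in> I" "r i k" "r j k" using directed_ub[OF dir i(1) j(1)] .
    have "AE x in M. rep (y k) x \<le> rep (y i) x" "AE x in M. rep (y k) x \<le> rep (y j) x"
      using mono[OF i(1) k(1,2)] mono[OF j(1) k(1,3)] unfolding L0_simps by auto
    then have "AE x in M. rep (y k) x \<le> min (d x) (c x)" unfolding i j by eventually_elim simp
    then show "\<exists>b\<in>(\<lambda>i. rep (y i)) ` I. AE x in M. b x \<le> min (d x) (c x)"
      using k(1) by (intro bexI[OF _ imageI]) auto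
  next
    fix w assume w: "w \<in> F" "AE x in M. 0 \<le> w x" and wD: "\<forall>d\<in>(\<lambda>i. rep (y i)) ` I. AE x in M. w x \<le> d x"
    have "ae_class M w \<sqsubseteq>\<^bsub>L0 M\<^esub> y i" if i: "i \<in> I" for i
      using le_iff[OF w(1) rep_mem[OF y[OF i]]] wD i by (simp add: ae_class_rep y)
    then have "ae_class M w \<in> Lower R (y ` I)"
      using ae_class_mem[OF w(1)] by (auto simp: Lower_def)
    then have "ae_class M w \<sqsubseteq>\<^bsub>L0 M\<^esub> vzero (L0 M)" using glb by (auto simp: greatest_def)
    then have "AE x in M. w x \<le> 0" unfolding vzero_class by (simp add: le_iff[OF w(1) zero])
    then show "AE x in M. w x = 0" using w(2) by eventually_elim simp
  qed
qed

lemma down_null_decreases_to: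
  assumes D: "down_null D"
  shows "decreases_to R (ae_class M ` D) (\<lambda>a b. b \<sqsubseteq>\<^bsub>L0 M\<^esub> a) (\<lambda>a. a) (vzero (L0 M))"
proof -
  have DF: "\<And>d. d \<in> D \<Longrightarrow> d \<in> F" and ne: "D \<noteq> {}" and nn: "\<And>d. d \<in> D \<Longrightarrow> AE x in M. 0 \<le> d x"
    and dir: "\<And>c d. c \<in> D \<Longrightarrow> d \<in> D \<Longrightarrow> \<exists>b\<in>D. AE x in M. b x \<le> min (c x) (d x)"
    and inf: "\<And>w. w \<in> F \<Longrightarrow> AE x in M. 0 \<le> w x \<Longrightarrow> \<forall>d\<in>D. AE x in M. w x \<le> d x \<Longrightarrow> AE x in M. w x = 0"
    using D unfolding down_null_def by blast+
  have "directed (ae_class M ` D) (\<lambda>a b. b \<sqsubseteq>\<^bsub>L0 M\<^esub> a)"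
    unfolding directed_def
  proof (intro conjI ballI impI)
    show "ae_class M ` D \<noteq> {}" using ne by simp
    show "a \<sqsubseteq>\<^bsub>L0 M\<^esub> a" for a by (simp add: L0_simps)
    show "c \<sqsubseteq>\<^bsub>L0 M\<^esub> a" if "b \<sqsubseteq>\<^bsub>L0 M\<^esub> a" "c \<sqsubseteq>\<^bsub>L0 M\<^esub> b" for a b c
      using that unfolding L0_simps by eventually_elim simp
    fix a b assume "a \<in> ae_class M ` D" "b \<in> ae_class M ` D"
    then obtain c d where cd: "c \<in> D" "d \<in> D" "a = ae_class M c" "b = ae_class M d" by blast
    obtain e where e: "e \<in> D" "AE x in M. e x \<le> min (c x) (d x)" using dir cd by blast
    have "AE x in M. e x \<le> c x" "AE x in M. e x \<le> d x" using e(2) by (eventually_elim, simp)+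
    then show "\<exists>k\<in>ae_class M ` D. k \<sqsubseteq>\<^bsub>L0 M\<^esub> a \<and> k \<sqsubseteq>\<^bsub>L0 M\<^esub> b"
      using e(1) cd by (intro bexI[OF _ imageI[OF e(1)]]) (simp add: le_iff DF)
  qed
  moreover have "is_glb R (vzero (L0 M)) (ae_class M ` D)"
    unfolding greatest_def
  proof (intro conjI ballI)
    show "Lower R (ae_class M ` D) \<subseteq> carrier R" by (auto simp: Lower_def)
    show "vzero (L0 M) \<in> Lower R (ae_class M ` D)"
      using vzero_mem nn DF zero by (auto simp: Lower_def vzero_class le_iff)
    fix u assume "u \<in> Lower R (ae_class M ` D)"
    then have u: "u \<in> E" "\<And>d. d \<in> D \<Longrightarrow> u \<sqsubseteq>\<^bsub>L0 M\<^esub> ae_class M d"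
      using DF ae_class_mem by (auto simp: Lower_def)
    obtain w where w: "w \<in> F" "u = ae_class M w" by (rule E_cases[OF u(1)])
    \<comment> \<open>The positive part is taken because \<open>down_null\<close> tests nonnegative
      lower bounds.\<close>
    have "AE x in M. max (w x) 0 = 0"
    proof (rule inf[OF max[OF w(1) zero]])
      show "\<forall>d\<in>D. AE x in M. max (w x) 0 \<le> d x"
      proof
        fix d assume d: "d \<in> D"
        have "AE x in M. w x \<le> d x" using u(2)[OF d] w d DF by (simp add: le_iff)
        then show "AE x in M. max (w x) 0 \<le> d x" using nn[OF d] by eventually_elim simp
      qed
    qed simp
    then have "AE x in M. w x \<le> 0" by eventually_elim (simp add: max_def split: if_splits)
    then show "u \<sqsubseteq>\<^bsub>R\<^esub> vzero (L0 M)" by (simp add: w vzero_class le_iff zero)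
  qed
  ultimately show ?thesis using DF ae_class_mem by (auto simp: decreases_to_def)
qed

end

locale L0_regular = L0_sublattice +
  assumes regular_sublattice: "regular_sublattice (L0 M) E"
begin

sublocale regular_function_lattice M F
proof
  fix D h assume D: "down_null D" and h: "h \<in> borel_measurable M" and le: "\<And>d. d \<in> D \<Longrightarrow> AE x in M. h x \<le> d x"
  have "decreases_to (L0 M) (ae_class M ` D) (\<lambda>a b. b \<sqsubseteq>\<^bsub>L0 M\<^esub> a) (\<lambda>a. a) (vzero (L0 M))"
    using regular_sublattice down_null_decreases_to[OF D] by (simp add: regular_sublattice_def)
  then have glb: "is_glb (L0 M) (vzero (L0 M)) (ae_class M ` D)" by (simp add: decreases_to_def)
  have DF: "d \<in> F" if "d \<in> D" for d using D that by (auto simp: down_null_def)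
  have "ae_class M h \<in> Lower (L0 M) (ae_class M ` D)"
    using le h DF measurable by (auto simp: Lower_def le_ae_class_iff ae_class_in_L0)
  then have "ae_class M h \<sqsubseteq>\<^bsub>L0 M\<^esub> vzero (L0 M)" using glb by (auto simp: greatest_def)
  then show "AE x in M. h x \<le> 0" unfolding vzero_class by (simp add: le_ae_class_iff h)
qed

lemma uo_convergent_uo_null:
  assumes I: "directed I r" and f: "f \<in> I \<rightarrow> E" and a: "a \<in> E" and uo: "uo_convergent R I r f a"
  shows "uo_null (filtermap (\<lambda>i x. \<bar>rep (f i) x - rep a x\<bar>) (net_filter I r))"
  unfolding uo_null_def
proof (intro ballI impI)
  fix y assume y: "y \<in> F" "AE x in M. 0 \<le> y x"
  let ?u = "\<lambda>i x. min \<bar>rep (f i) x - rep a x\<bar> (y x)"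
  have dF: "(\<lambda>x. rep (f i) x - rep a x) \<in> F" and uF: "?u i \<in> F" if "i \<in> I" for i
    using that f a rep_mem y by (auto intro!: min abs diff)
  have "vzero R \<sqsubseteq>\<^bsub>R\<^esub> ae_class M y" using y zero by (simp add: vzero_class le_iff)
  moreover have "ae_class M y \<in> carrier R" using ae_class_mem[OF y(1)] by simp
  ultimately have "order_convergent R I r (\<lambda>i. vabs R (vdiff R (f i) a) \<sqinter>\<^bsub>R\<^esub> ae_class M y) (vzero R)"
    using uo unfolding uo_convergent_def by blast
  then obtain J :: "('a \<Rightarrow> real) set set" and s z where z: "decreases_to R J s z (vzero R)"
    and conv: "\<And>j. j \<in> J \<Longrightarrow> \<exists>i0\<in>I. \<forall>i\<in>I. r i0 i \<longrightarrow>
      vabs R (vdiff R (vzero R) (vabs R (vdiff R (f i) a) \<sqinter>\<^bsub>R\<^esub> ae_class M y)) \<sqsubseteq>\<^bsub>R\<^esub> z j"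
    unfolding order_convergent_def by metis
  have zE: "z j \<in> E" if "j \<in> J" for j using z that by (auto simp: decreases_to_def)
  \<comment> \<open>Order convergence to zero of the truncations compares the modulus of their
    difference from \<open>vzero R\<close>; this is the source of the outer modulus and of
    \<open>0 - ?u i\<close>.\<close>
  have eq: "vabs R (vdiff R (vzero R) (vabs R (vdiff R (f i) a) \<sqinter>\<^bsub>R\<^esub> ae_class M y)) = ae_class M (\<lambda>x. \<bar>0 - ?u i x\<bar>)"
    if i: "i \<in> I" for i
  proof -
    have fi: "f i \<in> E" using f i by blast
    have "vdiff R (f i) a = ae_class M (\<lambda>x. rep (f i) x - rep a x)"
      using vdiff_class[OF rep_mem[OF fi] rep_mem[OF a]] by (simp add: ae_class_rep fi a)
    then have "vabs R (vdiff R (f i) a) \<sqinter>\<^bsub>R\<^esub> ae_class M y = ae_class M (?u i)"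
      using dF[OF i] by (simp add: vabs_class meet_class abs y)
    then have "vdiff R (vzero R) (vabs R (vdiff R (f i) a) \<sqinter>\<^bsub>R\<^esub> ae_class M y) = ae_class M (\<lambda>x. 0 - ?u i x)"
      using vdiff_class[OF zero uF[OF i]] by (simp add: vzero_class)
    then show ?thesis using vabs_class[OF diff[OF zero uF[OF i]]] by simp
  qed
  show "\<exists>D. down_null D \<and> (\<forall>d\<in>D. \<forall>\<^sub>F g in filtermap (\<lambda>i x. \<bar>rep (f i) x - rep a x\<bar>) (net_filter I r).
       AE x in M. min (g x) (y x) \<le> d x)"
  proof (intro exI conjI ballI)
    show "down_null ((\<lambda>j. rep (z j)) ` J)" using decreases_to_down_null z by simp
    fix d assume "d \<in> (\<lambda>j. rep (z j)) ` J"
    then obtain j where j: "j \<in> J" "d = rep (z j)" by blast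
    obtain i0 where i0: "i0 \<in> I" and le: "\<And>i. i \<in> I \<Longrightarrow> r i0 i \<Longrightarrow> ae_class M (\<lambda>x. \<bar>0 - ?u i x\<bar>) \<sqsubseteq>\<^bsub>L0 M\<^esub> z j"
      using conv[OF j(1)] eq by auto
    have "AE x in M. ?u i x \<le> d x" if i: "i \<in> I" "r i0 i" for i
    proof -
      have "AE x in M. \<bar>0 - ?u i x\<bar> \<le> d x"
        using le[OF i] le_iff[OF abs[OF diff[OF zero uF[OF i(1)]]] rep_mem[OF zE[OF j(1)]]]
        by (simp add: ae_class_rep zE j)
      then show ?thesis by eventually_elim linarith
    qed
    then show "\<forall>\<^sub>F g in filtermap (\<lambda>i x. \<bar>rep (f i) x - rep a x\<bar>) (net_filter I r). AE x in M. min (g x) (y x) \<le> d x"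
      unfolding eventually_filtermap eventually_net_filter[OF I] using i0 by blast
  qed
qed

text \<open>The filter is turned into a net indexed by the pairs of a set of the filter and a point of it.\<close>

lemma uo_Lebesgue_uo_null:
  assumes T: "uo_Lebesgue R T" and U: "openin T U" "vzero (L0 M) \<in> U"
    and nn: "eventually (\<lambda>g. g \<in> F \<and> (AE x in M. 0 \<le> g x)) G" and G: "uo_null G"
  shows "eventually (\<lambda>g. ae_class M g \<in> U) G"
proof (cases "G = bot")
  case False
  \<comment> \<open>On the positive cone the modulus of \<open>a - 0\<close> is \<open>a\<close>, so
    uo-convergence of the net concerns the same truncations as \<open>uo_null\<close>.\<close>
  let ?P = "{a\<in>E. vzero (L0 M) \<sqsubseteq>\<^bsub>L0 M\<^esub> a}"
  define I where "I = {(a, S). a \<in> S \<and> S \<subseteq> ?P \<and> eventually (\<lambda>g. ae_class M g \<in> S) G}"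
  define r where "r = (\<lambda>(i :: ('a \<Rightarrow> real) set \<times> ('a \<Rightarrow> real) set set) (j :: ('a \<Rightarrow> real) set \<times> ('a \<Rightarrow> real) set set). snd j \<subseteq> snd i)"
  \<comment> \<open>Since \<open>G\<close> is proper, each of its sets has a point that can serve as
    the first component of an index.\<close>
  have ex: "\<exists>a. (a, S) \<in> I" if "S \<subseteq> ?P" "eventually (\<lambda>g. ae_class M g \<in> S) G" for S
    using eventually_happens'[OF False that(2)] that by (auto simp: I_def)
  have evP: "eventually (\<lambda>g. ae_class M g \<in> ?P) G"
    using nn by eventually_elim (simp add: vzero_class le_iff zero ae_class_mem)
  have I: "directed I r"
    unfolding directed_def
  proof (intro conjI ballI impI)
    show "I \<noteq> {}" using ex[OF subset_refl evP] by blast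
    show "r i k" if "r i j" "r j k" for i j k using that by (auto simp: r_def)
    fix i j assume "i \<in> I" "j \<in> I"
    then have "eventually (\<lambda>g. ae_class M g \<in> snd i \<inter> snd j) G" "snd i \<inter> snd j \<subseteq> ?P"
      by (auto simp: I_def eventually_conj_iff)
    then obtain a where "(a, snd i \<inter> snd j) \<in> I" using ex by blast
    then show "\<exists>k\<in>I. r i k \<and> r j k" by (rule rev_bexI) (auto simp: r_def)
  qed (simp add: r_def)
  have "uo_convergent R I r fst (vzero R)"
    unfolding uo_convergent_def
  proof (intro ballI impI)
    fix b assume "b \<in> carrier R" "vzero R \<sqsubseteq>\<^bsub>R\<^esub> b"
    then have b: "b \<in> E" "vzero (L0 M) \<sqsubseteq>\<^bsub>L0 M\<^esub> b" by auto
    let ?y = "rep b"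
    have y: "?y \<in> F" by (rule rep_mem[OF b(1)])
    have y0: "AE x in M. 0 \<le> ?y x" using b le_iff[OF zero y] by (simp add: vzero_class ae_class_rep)
    obtain D where D: "down_null D" "\<And>d. d \<in> D \<Longrightarrow> eventually (\<lambda>g. AE x in M. min (g x) (?y x) \<le> d x) G"
      using G y y0 unfolding uo_null_def by blast
    have DF: "d \<in> F" if "d \<in> D" for d using D(1) that by (auto simp: down_null_def)
    show "order_convergent R I r (\<lambda>i. vabs R (vdiff R (fst i) (vzero R)) \<sqinter>\<^bsub>R\<^esub> b) (vzero R)"
      unfolding order_convergent_def
    proof (intro exI conjI ballI)
      show "decreases_to R (ae_class M ` D) (\<lambda>a b. b \<sqsubseteq>\<^bsub>L0 M\<^esub> a) (\<lambda>a. a) (vzero R)"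
        using down_null_decreases_to[OF D(1)] by simp
      fix j assume "j \<in> ae_class M ` D"
      then obtain d where d: "d \<in> D" "j = ae_class M d" by blast
      let ?S = "{a\<in>?P. AE x in M. min (rep a x) (?y x) \<le> d x}"
      have "eventually (\<lambda>g. ae_class M g \<in> ?S) G"
        using evP nn D(2)[OF d(1)]
      proof eventually_elim
        case (elim g)
        have "AE x in M. rep (ae_class M g) x = g x" using elim by (intro rep_ae_class) simp
        then have "AE x in M. min (rep (ae_class M g) x) (?y x) \<le> d x" using elim(3) by eventually_elim simp
        then show ?case using elim by simp
      qed
      then obtain a where a: "(a, ?S) \<in> I" using ex[of ?S] by blast
      have "vabs R (vdiff R (vzero R) (vabs R (vdiff R c (vzero R)) \<sqinter>\<^bsub>R\<^esub> b)) \<sqsubseteq>\<^bsub>R\<^esub> j"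
        if c: "c \<in> ?S" for c
      proof -
        have cE: "c \<in> E" and c0: "vzero (L0 M) \<sqsubseteq>\<^bsub>L0 M\<^esub> c" and cd: "AE x in M. min (rep c x) (?y x) \<le> d x"
          using c by auto
        have cF: "rep c \<in> F" by (rule rep_mem[OF cE])
        have c0: "AE x in M. 0 \<le> rep c x" using c0 le_iff[OF zero cF] by (simp add: vzero_class ae_class_rep cE)
        let ?u = "\<lambda>x. min \<bar>rep c x - 0\<bar> (?y x)"
        have uF: "?u \<in> F" by (intro min abs diff cF zero y)
        have "vdiff R c (vzero R) = ae_class M (\<lambda>x. rep c x - 0)"
          using vdiff_class[OF cF zero] by (simp add: vzero_class ae_class_rep cE)
        then have "vabs R (vdiff R c (vzero R)) = ae_class M (\<lambda>x. \<bar>rep c x - 0\<bar>)"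
          using vabs_class[OF diff[OF cF zero]] by simp
        then have "vabs R (vdiff R c (vzero R)) \<sqinter>\<^bsub>R\<^esub> b = ae_class M ?u"
          using meet_class[OF abs[OF diff[OF cF zero]] y] by (simp add: ae_class_rep b)
        then have "vdiff R (vzero R) (vabs R (vdiff R c (vzero R)) \<sqinter>\<^bsub>R\<^esub> b) = ae_class M (\<lambda>x. 0 - ?u x)"
          using vdiff_class[OF zero uF] by (simp add: vzero_class)
        then have "vabs R (vdiff R (vzero R) (vabs R (vdiff R c (vzero R)) \<sqinter>\<^bsub>R\<^esub> b)) = ae_class M (\<lambda>x. \<bar>0 - ?u x\<bar>)"
          using vabs_class[OF diff[OF zero uF]] by simp
        moreover have "AE x in M. \<bar>0 - ?u x\<bar> \<le> d x" using cd c0 y0 by eventually_elim auto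
        ultimately show ?thesis using le_iff[OF abs[OF diff[OF zero uF]] DF[OF d(1)]] d(2) by simp
      qed
      then show "\<exists>i0\<in>I. \<forall>i\<in>I. r i0 i \<longrightarrow>
          vabs R (vdiff R (vzero R) (vabs R (vdiff R (fst i) (vzero R)) \<sqinter>\<^bsub>R\<^esub> b)) \<sqsubseteq>\<^bsub>R\<^esub> j"
        using a by (intro bexI[OF _ a]) (auto simp: I_def r_def)
    qed
  qed
  moreover have "fst \<in> I \<rightarrow> carrier R" by (auto simp: I_def)
  moreover have "vzero R \<in> carrier R" using vzero_mem by simp
  ultimately have "limitin T fst (vzero R) (net_filter I r)" using uo_LebesgueD[OF T I] by blast
  then have "eventually (\<lambda>i. fst i \<in> U) (net_filter I r)" using U by (simp add: limitin_def)
  then obtain i0 where i0: "i0 \<in> I" "\<And>i. i \<in> I \<Longrightarrow> r i0 i \<Longrightarrow> fst i \<in> U"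
    unfolding eventually_net_filter[OF I] by blast
  \<comment> \<open>Every point of \<open>snd i0\<close>, paired with \<open>snd i0\<close>, is
    itself an index beyond \<open>i0\<close>; the values of the tail therefore fill the whole
    set.\<close>
  have "snd i0 \<subseteq> U"
  proof
    fix c assume c: "c \<in> snd i0"
    then have "(c, snd i0) \<in> I" using i0(1) by (auto simp: I_def)
    from i0(2)[OF this] show "c \<in> U" by (simp add: r_def)
  qed
  moreover have "eventually (\<lambda>g. ae_class M g \<in> snd i0) G" using i0(1) by (auto simp: I_def)
  ultimately show ?thesis by (auto elim: eventually_mono)
qed simp

end

section \<open>From a uo-Lebesgue topology to its solid neighbourhoods\<close>

context L0_regular begin

text \<open>Neighbourhoods of zero are pulled back to functions. A solid neighbourhood need not be
  open, hence the open set inside it.\<close>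

definition solid_nbhds :: "('a \<Rightarrow> real) set topology \<Rightarrow> ('a \<Rightarrow> real) set set" where
  "solid_nbhds T = {{f\<in>F. ae_class M f \<in> S} | S. solid R S \<and> (\<exists>W. openin T W \<and> vzero (L0 M) \<in> W \<and> W \<subseteq> S)}"

lemma topspace_linear: "linear_topology R T \<Longrightarrow> topspace T = E"
  by (simp add: linear_topology_def)

lemma add_preimage:
  assumes T: "linear_topology R T" and W: "openin T W" and a: "a \<in> E" "b \<in> E" "vadd (L0 M) a b \<in> W"
  obtains U V where "openin T U" "openin T V" "a \<in> U" "b \<in> V" "\<forall>x\<in>U. \<forall>y\<in>V. vadd (L0 M) x y \<in> W"
proof -
  let ?P = "{z \<in> topspace (prod_topology T T). (case z of (x, y) \<Rightarrow> vadd (L0 M) x y) \<in> W}"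
  have "continuous_map (prod_topology T T) T (\<lambda>(x, y). vadd (L0 M) x y)"
    using T by (simp add: linear_topology_def)
  then have P: "openin (prod_topology T T) ?P" using W unfolding continuous_map by (elim conjE allE impE)
  have "(a, b) \<in> ?P" using a by (simp add: topspace_linear[OF T])
  from P[unfolded openin_prod_topology_alt, rule_format, OF this]
  obtain U V where UV: "openin T U" "openin T V" "a \<in> U" "b \<in> V" "U \<times> V \<subseteq> ?P" by (elim exE conjE)
  have "\<forall>x\<in>U. \<forall>y\<in>V. vadd (L0 M) x y \<in> W"
  proof (intro ballI)
    fix x y assume "x \<in> U" "y \<in> V"
    then have "(x, y) \<in> ?P" using UV(5) by blast
    then show "vadd (L0 M) x y \<in> W" by simp
  qed
  then show thesis by (rule that[OF UV(1-4)])
qed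

lemma open_translation:
  assumes T: "linear_topology R T" and W: "openin T W" and a: "a \<in> E"
  shows "openin T {b\<in>E. vadd (L0 M) b a \<in> W}"
proof (subst openin_subopen, intro ballI)
  fix b assume b: "b \<in> {b\<in>E. vadd (L0 M) b a \<in> W}"
  then have "b \<in> E" "vadd (L0 M) b a \<in> W" by auto
  then obtain U V where UV: "openin T U" "openin T V" "b \<in> U" "a \<in> V" "\<forall>x\<in>U. \<forall>y\<in>V. vadd (L0 M) x y \<in> W"
    using add_preimage[OF T W _ a] by metis
  have "U \<subseteq> E" using openin_subset[OF UV(1)] topspace_linear[OF T] by simp
  then have "U \<subseteq> {b\<in>E. vadd (L0 M) b a \<in> W}" using UV(4,5) by auto
  then show "\<exists>U. openin T U \<and> b \<in> U \<and> U \<subseteq> {b\<in>E. vadd (L0 M) b a \<in> W}" using UV(1,3) by (intro exI[of _ U] conjI)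
qed

lemma vadd_mem: "a \<in> E \<Longrightarrow> b \<in> E \<Longrightarrow> vadd (L0 M) a b \<in> E"
  using sublattice by (simp add: vector_sublattice_def)

lemma vdiff_rep: "a \<in> E \<Longrightarrow> b \<in> E \<Longrightarrow> vdiff (L0 M) a b = ae_class M (\<lambda>x. rep a x - rep b x)"
  using vdiff_class[OF rep_mem rep_mem] by (simp add: ae_class_rep)

lemma vdiff_mem: "a \<in> E \<Longrightarrow> b \<in> E \<Longrightarrow> vdiff (L0 M) a b \<in> E"
  by (simp add: vdiff_rep ae_class_mem diff rep_mem)

lemma vadd_rep: "a \<in> E \<Longrightarrow> b \<in> E \<Longrightarrow> vadd (L0 M) a b = ae_class M (\<lambda>x. rep a x + rep b x)"
  by (simp add: L0_simps)

lemma rep_vdiff: "a \<in> E \<Longrightarrow> b \<in> E \<Longrightarrow> AE x in M. rep (vdiff (L0 M) a b) x = rep a x - rep b x"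
  using rep_ae_class[OF diff[OF rep_mem rep_mem]] by (simp add: vdiff_rep)

lemma rep_vadd: "a \<in> E \<Longrightarrow> b \<in> E \<Longrightarrow> AE x in M. rep (vadd (L0 M) a b) x = rep a x + rep b x"
  using rep_ae_class[OF add[OF rep_mem rep_mem]] by (simp add: vadd_rep)

lemma E_eqI: "a \<in> E \<Longrightarrow> b \<in> E \<Longrightarrow> AE x in M. rep a x = rep b x \<Longrightarrow> a = b"
  by (rule L0_eqI) (use subset_carrier in auto)

lemma vadd_vdiff_cancel: "a \<in> E \<Longrightarrow> b \<in> E \<Longrightarrow> vadd (L0 M) (vdiff (L0 M) b a) a = b"
proof (rule E_eqI)
  assume ab: "a \<in> E" "b \<in> E"
  show "AE x in M. rep (vadd (L0 M) (vdiff (L0 M) b a) a) x = rep b x"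
    using rep_vadd[OF vdiff_mem[OF ab(2,1)] ab(1)] rep_vdiff[OF ab(2,1)] by eventually_elim simp
qed (auto simp: vadd_mem vdiff_mem)

text \<open>Local solidity gives a base of such sets, continuity of addition at zero the halving
  property, and the uo-Lebesgue property, transferred from nets to filters, the last axiom.\<close>

lemma uo_nbhds_solid_nbhds:
  assumes T: "uo_Lebesgue R T"
  shows "uo_nbhds M F (solid_nbhds T)"
proof -
  have ls: "locally_solid R T" and lin: "linear_topology R T"
    using T by (auto simp: uo_Lebesgue_def locally_solid_def)
  have base: "\<exists>V\<in>solid_nbhds T. \<forall>f\<in>V. ae_class M f \<in> U" if U: "openin T U" "vzero (L0 M) \<in> U" for U
  proof -
    obtain S W where S: "solid R S" "S \<subseteq> U" "openin T W" "vzero (L0 M) \<in> W" "W \<subseteq> S"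
      using ls U unfolding locally_solid_def by auto
    then have "{f\<in>F. ae_class M f \<in> S} \<in> solid_nbhds T" by (auto simp: solid_nbhds_def)
    then show ?thesis by (rule rev_bexI) (use S(2) in auto)
  qed
  show ?thesis
  proof
    have "openin T E" using openin_topspace[of T] by (simp add: topspace_linear[OF lin])
    then show "solid_nbhds T \<noteq> {}" using base[of E] vzero_mem by blast
    fix V assume "V \<in> solid_nbhds T"
    then obtain S W where V: "V = {f\<in>F. ae_class M f \<in> S}" and S: "solid R S" "openin T W" "vzero (L0 M) \<in> W" "W \<subseteq> S"
      by (auto simp: solid_nbhds_def)
    show "V \<subseteq> F" using V by auto
    show "(\<lambda>x. 0) \<in> V" using V S zero by (auto simp: vzero_class)
    show "g \<in> V" if f: "f \<in> V" and g: "g \<in> F" and le: "AE x in M. \<bar>g x\<bar> \<le> \<bar>f x\<bar>" for f g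
    proof -
      have fF: "f \<in> F" using f V by simp
      have "vabs R (ae_class M g) \<sqsubseteq>\<^bsub>R\<^esub> vabs R (ae_class M f)"
        using le by (simp add: vabs_class fF g le_iff abs)
      moreover have "ae_class M g \<in> carrier R" using ae_class_mem[OF g] by simp
      ultimately have "ae_class M g \<in> S" using S(1) f V unfolding solid_def by blast
      then show ?thesis using V g by simp
    qed
    show "\<exists>W\<in>solid_nbhds T. \<forall>f\<in>W. \<forall>g\<in>W. (\<lambda>x. f x + g x) \<in> V"
    proof -
      have "vadd (L0 M) (vzero (L0 M)) (vzero (L0 M)) = vzero (L0 M)"
        using vadd_class[OF zero zero] by (simp add: vzero_class)
      then obtain U U' where U: "openin T U" "openin T U'" "vzero (L0 M) \<in> U" "vzero (L0 M) \<in> U'"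
        "\<forall>x\<in>U. \<forall>y\<in>U'. vadd (L0 M) x y \<in> W"
        using add_preimage[OF lin S(2) vzero_mem vzero_mem] S(3) by metis
      have "openin T (U \<inter> U')" "vzero (L0 M) \<in> U \<inter> U'" using U by auto
      then obtain V' where V': "V' \<in> solid_nbhds T" "\<forall>f\<in>V'. ae_class M f \<in> U \<inter> U'" using base by blast
      have "(\<lambda>x. f x + g x) \<in> V" if fg: "f \<in> V'" "g \<in> V'" for f g
      proof -
        have F: "f \<in> F" "g \<in> F" using V'(1) fg by (auto simp: solid_nbhds_def)
        have "vadd (L0 M) (ae_class M f) (ae_class M g) \<in> W" using U(5) V'(2) fg by blast
        then show ?thesis using S(4) F add by (auto simp: V vadd_class)
      qed
      then show ?thesis using V'(1) by blast
    qed
    show "eventually (\<lambda>f. f \<in> V) G"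
      if nn: "eventually (\<lambda>f. f \<in> F \<and> (AE x in M. 0 \<le> f x)) G" and G: "uo_null G" for G
      using uo_Lebesgue_uo_null[OF T S(2,3) nn G] nn
      by eventually_elim (use S(4) in \<open>auto simp: V\<close>)
    fix V' assume "V' \<in> solid_nbhds T"
    then obtain S' W' where V': "V' = {f\<in>F. ae_class M f \<in> S'}" and S': "solid R S'" "openin T W'" "vzero (L0 M) \<in> W'" "W' \<subseteq> S'"
      by (auto simp: solid_nbhds_def)
    have "openin T (W \<inter> W')" "vzero (L0 M) \<in> W \<inter> W'" using S S' by auto
    then obtain U where "U \<in> solid_nbhds T" "\<forall>f\<in>U. ae_class M f \<in> W \<inter> W'" using base by blast
    moreover from this have "U \<subseteq> F" by (auto simp: solid_nbhds_def)
    ultimately show "\<exists>U\<in>solid_nbhds T. U \<subseteq> V \<inter> V'" using S(4) S'(4) by (intro bexI[of _ U]) (auto simp: V V')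
  qed
qed

end

section \<open>The topology of convergence in measure\<close>

text \<open>Openness is prescribed by requiring a translate of some \<open>small M A e\<close>, cut
  down to \<open>E\<close>, around each point. That these translates are in turn neighbourhoods is
  the content of \<open>measure_topology_nbhd\<close>.\<close>

definition measure_topology :: "'x measure \<Rightarrow> ('x \<Rightarrow> real) set set \<Rightarrow> ('x \<Rightarrow> real) set topology" where
  "measure_topology M E = topology (\<lambda>U. U \<subseteq> E \<and> (\<forall>a\<in>U. \<exists>A\<in>fmeasurable M. \<exists>e>0. \<forall>b\<in>E.
     (\<lambda>x. rep b x - rep a x) \<in> small M A e \<longrightarrow> b \<in> U))"

lemma openin_measure_topology:
  "openin (measure_topology M E) U \<longleftrightarrow> U \<subseteq> E \<and> (\<forall>a\<in>U. \<exists>A\<in>fmeasurable M. \<exists>e>0. \<forall>b\<in>E.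
     (\<lambda>x. rep b x - rep a x) \<in> small M A e \<longrightarrow> b \<in> U)" (is "_ \<longleftrightarrow> ?P U")
proof -
  have "istopology ?P"
    unfolding istopology_def
  proof (intro conjI allI impI)
    fix U V assume U: "?P U" and V: "?P V"
    show "U \<inter> V \<subseteq> E" using U by blast
    show "\<forall>a\<in>U \<inter> V. \<exists>A\<in>fmeasurable M. \<exists>e>0. \<forall>b\<in>E. (\<lambda>x. rep b x - rep a x) \<in> small M A e \<longrightarrow> b \<in> U \<inter> V"
    proof
      fix a assume a: "a \<in> U \<inter> V"
      obtain A e where A: "A \<in> fmeasurable M" "e > 0" "\<forall>b\<in>E. (\<lambda>x. rep b x - rep a x) \<in> small M A e \<longrightarrow> b \<in> U"
        using U a by blast
      obtain B d where B: "B \<in> fmeasurable M" "d > 0" "\<forall>b\<in>E. (\<lambda>x. rep b x - rep a x) \<in> small M B d \<longrightarrow> b \<in> V"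
        using V a by blast
      have "small M (A \<union> B) (min e d) \<subseteq> small M A e" "small M (A \<union> B) (min e d) \<subseteq> small M B d"
        using A(1) B(1) by (intro small_mono fmeasurable.Un; auto)+
      then have "\<forall>b\<in>E. (\<lambda>x. rep b x - rep a x) \<in> small M (A \<union> B) (min e d) \<longrightarrow> b \<in> U \<inter> V"
        using A(3) B(3) by blast
      then show "\<exists>A\<in>fmeasurable M. \<exists>e>0. \<forall>b\<in>E. (\<lambda>x. rep b x - rep a x) \<in> small M A e \<longrightarrow> b \<in> U \<inter> V"
        using A B by (intro bexI[of _ "A \<union> B"] exI[of _ "min e d"] fmeasurable.Un) auto
    qed
  next
    fix \<K> assume K: "\<forall>K\<in>\<K>. ?P K"
    then show "\<Union>\<K> \<subseteq> E" by blast
    show "\<forall>a\<in>\<Union>\<K>. \<exists>A\<in>fmeasurable M. \<exists>e>0. \<forall>b\<in>E. (\<lambda>x. rep b x - rep a x) \<in> small M A e \<longrightarrow> b \<in> \<Union>\<K>"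
    proof
      fix a assume "a \<in> \<Union>\<K>"
      then obtain U where U: "U \<in> \<K>" "a \<in> U" by blast
      then obtain A e where A: "A \<in> fmeasurable M" "e > 0" "\<forall>b\<in>E. (\<lambda>x. rep b x - rep a x) \<in> small M A e \<longrightarrow> b \<in> U"
        using bspec[OF conjunct2[OF bspec[OF K U(1)]] U(2)] by blast
      show "\<exists>A\<in>fmeasurable M. \<exists>e>0. \<forall>b\<in>E. (\<lambda>x. rep b x - rep a x) \<in> small M A e \<longrightarrow> b \<in> \<Union>\<K>"
        by (intro bexI[OF _ A(1)] exI[of _ e] conjI A(2) ballI impI UnionI[OF U(1)] A(3)[rule_format])
    qed
  qed
  then show ?thesis unfolding measure_topology_def by (subst topology_inverse') (assumption, rule refl)
qed

lemma topspace_measure_topology [simp]: "topspace (measure_topology M E) = E"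
proof (rule antisym)
  show "topspace (measure_topology M E) \<subseteq> E"
    using openin_topspace[of "measure_topology M E"] unfolding openin_measure_topology by blast
  have "openin (measure_topology M E) E"
    unfolding openin_measure_topology by (auto intro!: bexI[of _ "{}"] exI[of _ 1])
  then show "E \<subseteq> topspace (measure_topology M E)" by (rule openin_subset)
qed

lemma small_diff_trans:
  assumes "A \<in> fmeasurable M" "(\<lambda>x. g x - f x) \<in> small M A (e/2)" "(\<lambda>x. h x - g x) \<in> small M A (e/2)"
  shows "(\<lambda>x. h x - f x) \<in> small M A e"
  using small_add[OF assms] by simp

text \<open>The set \<open>U\<close> is the interior of the \<open>small\<close> ball around
  \<open>a\<close>: the points having a whole ball inside it. It is open because a ball of half the
  parameter around such a point again consists of such points.\<close>

lemma measure_topology_nbhd: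
  assumes E: "E \<subseteq> carrier (L0 M)" and a: "a \<in> E" and A: "A \<in> fmeasurable M" and e: "0 < e"
  obtains U where "openin (measure_topology M E) U" "a \<in> U" "\<forall>b\<in>U. (\<lambda>x. rep b x - rep a x) \<in> small M A e"
proof -
  define U where "U = {b\<in>E. \<exists>B\<in>fmeasurable M. \<exists>d>0. \<forall>c\<in>E. (\<lambda>x. rep c x - rep b x) \<in> small M B d \<longrightarrow>
     (\<lambda>x. rep c x - rep a x) \<in> small M A e}"
  show thesis
  proof (rule that)
    show "openin (measure_topology M E) U"
      unfolding openin_measure_topology
    proof (intro conjI ballI)
      show "U \<subseteq> E" by (auto simp: U_def)
      fix b assume "b \<in> U"
      then obtain B d where b: "b \<in> E" "B \<in> fmeasurable M" "d > 0"
        "\<forall>c\<in>E. (\<lambda>x. rep c x - rep b x) \<in> small M B d \<longrightarrow> (\<lambda>x. rep c x - rep a x) \<in> small M A e"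
        unfolding U_def by blast
      have "c \<in> U" if c: "c \<in> E" "(\<lambda>x. rep c x - rep b x) \<in> small M B (d/2)" for c
      proof -
        have "(\<lambda>x. rep c' x - rep a x) \<in> small M A e"
          if c': "c' \<in> E" "(\<lambda>x. rep c' x - rep c x) \<in> small M B (d/2)" for c'
          using b(4) c'(1) small_diff_trans[OF b(2) c(2) c'(2)] by simp
        moreover have "0 < d/2" using b(3) by simp
        ultimately show ?thesis using c(1) b(2) unfolding U_def by blast
      qed
      then show "\<exists>A\<in>fmeasurable M. \<exists>e>0. \<forall>c\<in>E. (\<lambda>x. rep c x - rep b x) \<in> small M A e \<longrightarrow> c \<in> U"
        using b(3) by (intro bexI[OF _ b(2)] exI[of _ "d/2"]) simp
    qed
    show "a \<in> U" unfolding U_def using a A e by blast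
    show "\<forall>b\<in>U. (\<lambda>x. rep b x - rep a x) \<in> small M A e"
    proof
      fix b assume "b \<in> U"
      then obtain B d where b: "b \<in> E" "d > 0"
          "\<forall>c\<in>E. (\<lambda>x. rep c x - rep b x) \<in> small M B d \<longrightarrow> (\<lambda>x. rep c x - rep a x) \<in> small M A e"
        unfolding U_def by blast
      show "(\<lambda>x. rep b x - rep a x) \<in> small M A e" using bspec[OF b(3) b(1)] zero_small[OF b(2), of M B] by simp
    qed
  qed
qed

lemma limitin_measure_topology:
  assumes E: "E \<subseteq> carrier (L0 M)" and f: "eventually (\<lambda>i. f i \<in> E) G" and a: "a \<in> E"
  shows "limitin (measure_topology M E) f a G \<longleftrightarrow>
    (\<forall>A\<in>fmeasurable M. \<forall>e>0. eventually (\<lambda>i. (\<lambda>x. rep (f i) x - rep a x) \<in> small M A e) G)"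
proof (intro iffI ballI allI impI)
  fix A :: "'a set" and e :: real
  assume lim: "limitin (measure_topology M E) f a G" and A: "A \<in> fmeasurable M" and e: "0 < e"
  obtain U where U: "openin (measure_topology M E) U" "a \<in> U" "\<forall>b\<in>U. (\<lambda>x. rep b x - rep a x) \<in> small M A e"
    by (rule measure_topology_nbhd[OF E a A e])
  then have "eventually (\<lambda>i. f i \<in> U) G" using lim unfolding limitin_def by blast
  then show "eventually (\<lambda>i. (\<lambda>x. rep (f i) x - rep a x) \<in> small M A e) G"
    by eventually_elim (use U(3) in blast)
next
  assume *: "\<forall>A\<in>fmeasurable M. \<forall>e>0. eventually (\<lambda>i. (\<lambda>x. rep (f i) x - rep a x) \<in> small M A e) G"
  show "limitin (measure_topology M E) f a G"
    unfolding limitin_def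
  proof (intro conjI allI impI)
    fix U assume U: "openin (measure_topology M E) U \<and> a \<in> U"
    then obtain A e where A: "A \<in> fmeasurable M" "e > 0" "\<forall>b\<in>E. (\<lambda>x. rep b x - rep a x) \<in> small M A e \<longrightarrow> b \<in> U"
      unfolding openin_measure_topology by blast
    have "eventually (\<lambda>i. (\<lambda>x. rep (f i) x - rep a x) \<in> small M A e) G" using * A by blast
    with f show "eventually (\<lambda>i. f i \<in> U) G" by eventually_elim (use A(3) in blast)
  qed (use a in simp)
qed

text \<open>The sets \<open>small M A e\<close> do not depend on \<open>E\<close>, so the balls of
  \<open>E\<close> are traces of balls of \<open>L0 M\<close>. An open \<open>U\<close> of
  \<open>E\<close> is the trace of the union of all open sets of \<open>L0 M\<close> whose trace
  lies in \<open>U\<close>.\<close>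

lemma subtopology_measure_topology:
  assumes E: "E \<subseteq> carrier (L0 M)"
  shows "measure_topology M E = subtopology (measure_topology M (carrier (L0 M))) E"
  unfolding topology_eq
proof (intro allI iffI)
  fix U assume "openin (subtopology (measure_topology M (carrier (L0 M))) E) U"
  then obtain W where W: "openin (measure_topology M (carrier (L0 M))) W" "U = W \<inter> E" by (auto simp: openin_subtopology)
  show "openin (measure_topology M E) U"
    unfolding openin_measure_topology
  proof (intro conjI ballI)
    fix a assume "a \<in> U"
    then have "a \<in> W" using W(2) by simp
    then obtain A e where A: "A \<in> fmeasurable M" "e > 0"
      "\<forall>b\<in>carrier (L0 M). (\<lambda>x. rep b x - rep a x) \<in> small M A e \<longrightarrow> b \<in> W"
      using W(1) unfolding openin_measure_topology by blast
    then have "\<forall>b\<in>E. (\<lambda>x. rep b x - rep a x) \<in> small M A e \<longrightarrow> b \<in> U" using E W(2) by auto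
    then show "\<exists>A\<in>fmeasurable M. \<exists>e>0. \<forall>b\<in>E. (\<lambda>x. rep b x - rep a x) \<in> small M A e \<longrightarrow> b \<in> U"
      using A(1,2) by blast
  qed (simp add: W(2))
next
  fix U assume U: "openin (measure_topology M E) U"
  let ?T = "measure_topology M (carrier (L0 M))"
  define \<K> where "\<K> = {W. openin ?T W \<and> W \<inter> E \<subseteq> U}"
  have "U = \<Union>\<K> \<inter> E"
  proof
    show "\<Union>\<K> \<inter> E \<subseteq> U" by (auto simp: \<K>_def)
    show "U \<subseteq> \<Union>\<K> \<inter> E"
    proof
      fix a assume a: "a \<in> U"
      have aE: "a \<in> E" and aL: "a \<in> carrier (L0 M)" using a U E unfolding openin_measure_topology by auto
      obtain A e where A: "A \<in> fmeasurable M" "e > 0" "\<forall>b\<in>E. (\<lambda>x. rep b x - rep a x) \<in> small M A e \<longrightarrow> b \<in> U"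
        using U a unfolding openin_measure_topology by blast
      obtain W where W: "openin ?T W" "a \<in> W" "\<forall>b\<in>W. (\<lambda>x. rep b x - rep a x) \<in> small M A e"
        by (rule measure_topology_nbhd[OF subset_refl aL A(1,2)])
      then have "W \<inter> E \<subseteq> U" using A(3) by blast
      then have "W \<in> \<K>" using W(1) by (simp add: \<K>_def)
      then show "a \<in> \<Union>\<K> \<inter> E" using W(2) aE by blast
    qed
  qed
  moreover have "openin ?T (\<Union>\<K>)" by (rule openin_Union) (simp add: \<K>_def)
  ultimately show "openin (subtopology ?T E) U"
    unfolding openin_subtopology by (intro exI[of _ "\<Union>\<K>"] conjI)
qed

section \<open>Uniqueness of the Hausdorff uo-Lebesgue topology\<close>

context L0_regular begin

text \<open>Translations reduce the comparison to neighbourhoods of zero: \<open>inner\<close> comes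
  from \<open>small_subset\<close> and \<open>outer\<close> from
  \<open>subset_small\<close>.\<close>

lemma hausdorff_uo_Lebesgue_unique:
  assumes sf: "semi_finite M" and T: "hausdorff_uo_Lebesgue R T"
  shows "T = measure_topology M E"
proof -
  have uo: "uo_Lebesgue R T" and haus: "Hausdorff_space T" using T by (auto simp: hausdorff_uo_Lebesgue_def)
  have ls: "locally_solid R T" and lin: "linear_topology R T"
    using uo by (auto simp: uo_Lebesgue_def locally_solid_def)
  note tE = topspace_linear[OF lin]
  interpret N: uo_nbhds M F "solid_nbhds T" by (rule uo_nbhds_solid_nbhds[OF uo])
  interpret N: hausdorff_uo_nbhds M F "solid_nbhds T"
  proof
    show "\<exists>C\<in>sets M. C \<subseteq> B \<and> 0 < emeasure M C \<and> emeasure M C < \<infinity>" if "B \<in> sets M" "emeasure M B = \<infinity>" for B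
      using sf that unfolding semi_finite_def by blast
    fix f assume f: "f \<in> F" "\<not> (AE x in M. f x = 0)"
    have ne: "ae_class M f \<noteq> vzero (L0 M)"
      using f by (simp add: vzero_class ae_class_eq_iff measurable zero)
    then obtain U where U: "openin T U" "vzero (L0 M) \<in> U" "ae_class M f \<notin> U"
      using haus ae_class_mem[OF f(1)] vzero_mem unfolding Hausdorff_space_def tE disjnt_iff by metis
    then obtain S W where S: "solid R S" "S \<subseteq> U" "openin T W" "vzero (L0 M) \<in> W" "W \<subseteq> S"
      using ls unfolding locally_solid_def by auto
    then have "{f\<in>F. ae_class M f \<in> S} \<in> solid_nbhds T" by (auto simp: solid_nbhds_def)
    then show "\<exists>V\<in>solid_nbhds T. f \<notin> V" by (rule rev_bexI) (use S(2) U(3) in auto)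
  qed
  have inner: "\<exists>A\<in>fmeasurable M. \<exists>e>0. \<forall>a\<in>E. rep a \<in> small M A e \<longrightarrow> a \<in> U" if U: "openin T U" "vzero (L0 M) \<in> U" for U
  proof -
    obtain S W where S: "solid R S" "S \<subseteq> U" "openin T W" "vzero (L0 M) \<in> W" "W \<subseteq> S"
      using ls U unfolding locally_solid_def by auto
    then have V: "{f\<in>F. ae_class M f \<in> S} \<in> solid_nbhds T" by (auto simp: solid_nbhds_def)
    obtain A e where A: "A \<in> fmeasurable M" "e > 0" "F \<inter> small M A e \<subseteq> {f\<in>F. ae_class M f \<in> S}"
      using N.small_subset[OF V] by blast
    have "a \<in> U" if a: "a \<in> E" "rep a \<in> small M A e" for a
    proof -
      have "ae_class M (rep a) \<in> S" using A(3) rep_mem[OF a(1)] a(2) by blast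
      then show ?thesis using S(2) by (auto simp: ae_class_rep a)
    qed
    then show ?thesis using A(1,2) by blast
  qed
  have outer: "\<exists>W. openin T W \<and> vzero (L0 M) \<in> W \<and> (\<forall>a\<in>W. rep a \<in> small M A e)" if A: "A \<in> fmeasurable M" "0 < e" for A e
  proof -
    obtain V where V: "V \<in> solid_nbhds T" "V \<subseteq> small M A e" using N.subset_small[OF A] by blast
    then obtain S W where S: "V = {f\<in>F. ae_class M f \<in> S}" "openin T W" "vzero (L0 M) \<in> W" "W \<subseteq> S"
      by (auto simp: solid_nbhds_def)
    have "rep a \<in> small M A e" if a: "a \<in> W" for a
    proof -
      have aE: "a \<in> E" using openin_subset[OF S(2)] a tE by auto
      then have "rep a \<in> V" using S a rep_mem ae_class_rep by auto
      then show ?thesis using V(2) by blast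
    qed
    then show ?thesis using S by blast
  qed
  show ?thesis
    unfolding topology_eq
  proof (intro allI iffI)
    fix U assume U: "openin T U"
    show "openin (measure_topology M E) U"
      unfolding openin_measure_topology
    proof (intro conjI ballI)
      show UE: "U \<subseteq> E" using openin_subset[OF U] tE by simp
      fix a assume a: "a \<in> U"
      then have aE: "a \<in> E" using UE by blast
      have "vadd (L0 M) (vzero (L0 M)) a = a"
        using vadd_class[OF zero rep_mem[OF aE]] by (simp add: vzero_class ae_class_rep aE)
      then have "vzero (L0 M) \<in> {b\<in>E. vadd (L0 M) b a \<in> U}" using vzero_mem a by simp
      from inner[OF open_translation[OF lin U aE] this] obtain A e where A: "A \<in> fmeasurable M" "e > 0"
        "\<forall>b\<in>E. rep b \<in> small M A e \<longrightarrow> b \<in> {b\<in>E. vadd (L0 M) b a \<in> U}" by blast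
      have "b \<in> U" if b: "b \<in> E" "(\<lambda>x. rep b x - rep a x) \<in> small M A e" for b
      proof -
        have d: "vdiff (L0 M) b a \<in> E" using vdiff_mem b aE by blast
        have "rep (vdiff (L0 M) b a) \<in> small M A e"
          using rep_vdiff[OF b(1) aE] by (intro small_solid[OF A(1) b(2)] measurable rep_mem d) (auto elim: eventually_mono)
        then have "vadd (L0 M) (vdiff (L0 M) b a) a \<in> U" using A(3) d by blast
        then show ?thesis by (simp add: vadd_vdiff_cancel b aE)
      qed
      then show "\<exists>A\<in>fmeasurable M. \<exists>e>0. \<forall>b\<in>E. (\<lambda>x. rep b x - rep a x) \<in> small M A e \<longrightarrow> b \<in> U" using A by blast
    qed
  next
    fix U assume U: "openin (measure_topology M E) U"
    show "openin T U"
    proof (subst openin_subopen, intro ballI)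
      fix a assume a: "a \<in> U"
      have UE: "U \<subseteq> E" using U by (simp add: openin_measure_topology)
      then have aE: "a \<in> E" using a by blast
      obtain A e where A: "A \<in> fmeasurable M" "e > 0" "\<forall>b\<in>E. (\<lambda>x. rep b x - rep a x) \<in> small M A e \<longrightarrow> b \<in> U"
        using U a unfolding openin_measure_topology by blast
      obtain W where W: "openin T W" "vzero (L0 M) \<in> W" "\<forall>a\<in>W. rep a \<in> small M A e" using outer[OF A(1,2)] by blast
      let ?a = "vscale (L0 M) (-1) a"
      have na: "?a \<in> E" using sublattice aE by (auto simp: vector_sublattice_def)
      have eq: "vadd (L0 M) b ?a = vdiff (L0 M) b a" for b by (simp add: vdiff_def)
      have "vdiff (L0 M) a a = vzero (L0 M)" by (simp add: vdiff_rep aE vzero_class)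
      then have "a \<in> {b\<in>E. vadd (L0 M) b ?a \<in> W}" using aE W(2) by (simp add: eq)
      moreover have "{b\<in>E. vadd (L0 M) b ?a \<in> W} \<subseteq> U"
      proof
        fix b assume "b \<in> {b\<in>E. vadd (L0 M) b ?a \<in> W}"
        then have b: "b \<in> E" "rep (vdiff (L0 M) b a) \<in> small M A e" using W(3) by (auto simp: eq)
        have "(\<lambda>x. rep b x - rep a x) \<in> small M A e"
          using rep_vdiff[OF b(1) aE]
          by (intro small_solid[OF A(1) b(2)] measurable diff rep_mem b aE) (auto elim: eventually_mono)
        then show "b \<in> U" using A(3) b(1) by blast
      qed
      ultimately show "\<exists>W. openin T W \<and> a \<in> W \<and> W \<subseteq> U" using open_translation[OF lin W(1) na] by blast
    qed
  qed
qed

end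

section \<open>Existence of the Hausdorff uo-Lebesgue topology\<close>

text \<open>A real-valued measurable function is bounded on \<open>A\<close> up to small measure, by
  continuity from above. Continuity of scalar multiplication relies on this.\<close>

lemma large_level:
  assumes A: "A \<in> fmeasurable M" and f: "f \<in> borel_measurable M" and e: "0 < e"
  shows "\<exists>K>0. measure M {x\<in>A. K \<le> \<bar>f x :: real\<bar>} < e"
proof -
  let ?B = "\<lambda>n. {x\<in>A. real (Suc n) \<le> \<bar>f x\<bar>}"
  have B: "?B n \<in> fmeasurable M" for n by (rule level_fmeasurable[OF A f])
  have "(\<lambda>n. measure M (?B n)) \<longlonglongrightarrow> measure M (\<Inter>n. ?B n)"
  proof (rule Lim_measure_decseq)
    show "range ?B \<subseteq> sets M" using B by blast
    show "decseq ?B" by (intro decseq_SucI Collect_mono) auto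
    show "emeasure M (?B n) \<noteq> \<infinity>" for n using fmeasurableD2[OF B] by simp
  qed
  moreover have "(\<Inter>n. ?B n) = {}"
  proof -
    have False if x: "x \<in> (\<Inter>n. ?B n)" for x
    proof -
      obtain n where "\<bar>f x\<bar> < real n" using reals_Archimedean2 by blast
      moreover have "real (Suc n) \<le> \<bar>f x\<bar>" using x by blast
      ultimately show False by simp
    qed
    then show ?thesis by blast
  qed
  ultimately have "(\<lambda>n. measure M (?B n)) \<longlonglongrightarrow> 0" by simp
  then have "\<forall>\<^sub>F n in sequentially. measure M (?B n) < e" using e by (rule order_tendstoD)
  then obtain n where "measure M (?B n) < e" by (auto simp: eventually_sequentially)
  then show ?thesis by (intro exI[of _ "real (Suc n)"]) simp
qed

lemma continuous_map_measure_topology: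
  assumes g: "\<And>x. x \<in> topspace X \<Longrightarrow> g x \<in> E"
    and loc: "\<And>x A e. x \<in> topspace X \<Longrightarrow> A \<in> fmeasurable M \<Longrightarrow> 0 < e \<Longrightarrow>
      \<exists>N. openin X N \<and> x \<in> N \<and> (\<forall>y\<in>N. (\<lambda>t. rep (g y) t - rep (g x) t) \<in> small M A e)"
  shows "continuous_map X (measure_topology M E) g"
  unfolding continuous_map
proof (intro conjI allI impI)
  show "g ` topspace X \<subseteq> topspace (measure_topology M E)" using g by auto
  fix U assume U: "openin (measure_topology M E) U"
  show "openin X {x \<in> topspace X. g x \<in> U}"
  proof (subst openin_subopen, intro ballI)
    fix x assume "x \<in> {x \<in> topspace X. g x \<in> U}"
    then have x: "x \<in> topspace X" "g x \<in> U" by auto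
    obtain A e where A: "A \<in> fmeasurable M" "e > 0" "\<forall>b\<in>E. (\<lambda>t. rep b t - rep (g x) t) \<in> small M A e \<longrightarrow> b \<in> U"
      using bspec[OF conjunct2[OF U[unfolded openin_measure_topology]] x(2)] by blast
    obtain N where N: "openin X N" "x \<in> N" "\<forall>y\<in>N. (\<lambda>t. rep (g y) t - rep (g x) t) \<in> small M A e"
      using loc[OF x(1) A(1,2)] by blast
    have "N \<subseteq> {x \<in> topspace X. g x \<in> U}"
    proof
      fix y assume y: "y \<in> N"
      then have "y \<in> topspace X" using openin_subset[OF N(1)] by blast
      then show "y \<in> {x \<in> topspace X. g x \<in> U}" using g A(3) N(3) y by blast
    qed
    then show "\<exists>T. openin X T \<and> x \<in> T \<and> T \<subseteq> {x \<in> topspace X. g x \<in> U}" using N(1,2) by blast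
  qed
qed

context L0_regular begin

lemma small_scale_diff:
  assumes A: "A \<in> fmeasurable M" and e: "0 < e" and a: "a \<in> E"
  shows "\<exists>d>0. \<forall>c'. \<forall>b\<in>E. \<bar>c' - c\<bar> < d \<longrightarrow> (\<lambda>x. rep b x - rep a x) \<in> small M A d \<longrightarrow>
    (\<lambda>x. c' * rep b x - c * rep a x) \<in> small M A e"
proof -
  have am: "rep a \<in> borel_measurable M" by (intro measurable rep_mem a)
  obtain K where K: "K > 0" "measure M {x\<in>A. K \<le> \<bar>rep a x\<bar>} < e/2"
    using large_level[OF A am, of "e/2"] e by auto
  define L where "L = \<bar>c\<bar> + 1"
  have L: "L \<ge> 1" by (simp add: L_def)
  \<comment> \<open>The difference is split as \<open>c' * (b - a) + (c' - c) * a\<close>. The bound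
    1 gives \<open>\<bar>c'\<bar> \<le> L\<close>, \<open>e / (2 * L)\<close> controls the first
    summand, and \<open>e / (2 * K)\<close> controls the second where
    \<open>\<bar>a\<bar> < K\<close>.\<close>
  define d where "d = Min {1, e / (2 * K), e / (2 * L)}"
  have d: "0 < d" "d \<le> 1" "d \<le> e / (2 * K)" "d \<le> e / (2 * L)" using e K L by (auto simp: d_def)
  have "(\<lambda>x. c' * rep b x - c * rep a x) \<in> small M A e"
    if b: "b \<in> E" and c': "\<bar>c' - c\<bar> < d" and s: "(\<lambda>x. rep b x - rep a x) \<in> small M A d" for c' b
  proof -
    have bm: "rep b \<in> borel_measurable M" by (intro measurable rep_mem b)
    have 1: "(\<lambda>x. c' * (rep b x - rep a x)) \<in> small M A (e/2)"
    proof -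
      have cL: "\<bar>c'\<bar> \<le> L" using c' d(2) by (simp add: L_def)
      have "measure M {x\<in>A. e/2 \<le> \<bar>c' * (rep b x - rep a x)\<bar>} \<le> measure M {x\<in>A. d \<le> \<bar>rep b x - rep a x\<bar>}"
      proof (intro measure_mono_AE level_fmeasurable A AE_I2 impI)
        fix x assume x: "x \<in> {x\<in>A. e/2 \<le> \<bar>c' * (rep b x - rep a x)\<bar>}"
        then have "e/2 \<le> \<bar>c'\<bar> * \<bar>rep b x - rep a x\<bar>" by (simp add: abs_mult)
        also have "\<dots> \<le> L * \<bar>rep b x - rep a x\<bar>" using cL by (rule mult_right_mono) simp
        finally have "e / (2 * L) \<le> \<bar>rep b x - rep a x\<bar>" using L by (simp add: field_simps)
        then show "x \<in> {x\<in>A. d \<le> \<bar>rep b x - rep a x\<bar>}" using d(4) x by auto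
      qed (use am bm in auto)
      also have "\<dots> < d" using s by (simp add: small_def)
      also have "d \<le> e / 2"
      proof -
        have "e / (2 * L) \<le> e / 2" using L e by (intro divide_left_mono) auto
        then show ?thesis using d(4) by linarith
      qed
      finally show ?thesis using am bm by (simp add: small_def)
    qed
    have 2: "(\<lambda>x. (c' - c) * rep a x) \<in> small M A (e/2)"
    proof -
      have "measure M {x\<in>A. e/2 \<le> \<bar>(c' - c) * rep a x\<bar>} \<le> measure M {x\<in>A. K \<le> \<bar>rep a x\<bar>}"
      proof (intro measure_mono_AE level_fmeasurable A AE_I2 impI)
        fix x assume x: "x \<in> {x\<in>A. e/2 \<le> \<bar>(c' - c) * rep a x\<bar>}"
        then have "e/2 \<le> \<bar>c' - c\<bar> * \<bar>rep a x\<bar>" by (simp add: abs_mult)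
        also have "\<dots> \<le> e / (2 * K) * \<bar>rep a x\<bar>" using c' d(3) by (intro mult_right_mono) auto
        finally have "K \<le> \<bar>rep a x\<bar>" using K(1) e by (simp add: field_simps)
        then show "x \<in> {x\<in>A. K \<le> \<bar>rep a x\<bar>}" using x by auto
      qed (use am in auto)
      then show ?thesis using K(2) am by (simp add: small_def)
    qed
    have "(\<lambda>x. c' * rep b x - c * rep a x) = (\<lambda>x. c' * (rep b x - rep a x) + (c' - c) * rep a x)"
      by (simp add: algebra_simps)
    then show ?thesis using small_add[OF A 1 2] by simp
  qed
  then show ?thesis using d(1) by blast
qed

lemma linear_topology_measure_topology: "linear_topology R (measure_topology M E)"
  unfolding linear_topology_def
proof (intro conjI)
  let ?T = "measure_topology M E"
  show "topspace ?T = carrier R" by simp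
  show "continuous_map (prod_topology ?T ?T) ?T (\<lambda>(x, y). vadd R x y)"
  proof (rule continuous_map_measure_topology)
    show "(case z of (x, y) \<Rightarrow> vadd R x y) \<in> E" if "z \<in> topspace (prod_topology ?T ?T)" for z
      using that by (auto simp: vadd_mem)
    fix z A and e :: real assume z: "z \<in> topspace (prod_topology ?T ?T)" and A: "A \<in> fmeasurable M" and e: "0 < e"
    obtain a b where ab: "z = (a, b)" "a \<in> E" "b \<in> E" using z by auto
    have e2: "0 < e/2" using e by simp
    obtain U where U: "openin ?T U" "a \<in> U" "\<forall>c\<in>U. (\<lambda>x. rep c x - rep a x) \<in> small M A (e/2)"
      by (rule measure_topology_nbhd[OF subset_carrier ab(2) A e2])
    obtain V where V: "openin ?T V" "b \<in> V" "\<forall>c\<in>V. (\<lambda>x. rep c x - rep b x) \<in> small M A (e/2)"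
      by (rule measure_topology_nbhd[OF subset_carrier ab(3) A e2])
    have "(\<lambda>x. rep (vadd (L0 M) c d) x - rep (vadd (L0 M) a b) x) \<in> small M A e" if cd: "c \<in> U" "d \<in> V" for c d
    proof -
      have cdE: "c \<in> E" "d \<in> E" using cd openin_subset[OF U(1)] openin_subset[OF V(1)] by auto
      have s: "(\<lambda>x. (rep c x - rep a x) + (rep d x - rep b x)) \<in> small M A e"
        using U(3) V(3) cd by (intro small_add[OF A]) auto
      show ?thesis
      proof (rule small_solid[OF A s])
        show "(\<lambda>x. rep (vadd (L0 M) c d) x - rep (vadd (L0 M) a b) x) \<in> borel_measurable M"
          by (intro measurable diff rep_mem vadd_mem cdE ab)
        show "AE x in M. x \<in> A \<longrightarrow> \<bar>rep (vadd (L0 M) c d) x - rep (vadd (L0 M) a b) x\<bar>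
            \<le> \<bar>(rep c x - rep a x) + (rep d x - rep b x)\<bar>"
          using rep_vadd[OF cdE] rep_vadd[OF ab(2,3)] by eventually_elim (simp add: algebra_simps)
      qed
    qed
    then show "\<exists>N. openin (prod_topology ?T ?T) N \<and> z \<in> N \<and>
        (\<forall>y\<in>N. (\<lambda>t. rep (case y of (x, y) \<Rightarrow> vadd R x y) t - rep (case z of (x, y) \<Rightarrow> vadd R x y) t) \<in> small M A e)"
      using U(1,2) V(1,2) by (intro exI[of _ "U \<times> V"]) (auto simp: ab(1) openin_prod_Times_iff)
  qed
  show "continuous_map (prod_topology euclideanreal ?T) ?T (\<lambda>(c, x). vscale R c x)"
  proof (rule continuous_map_measure_topology)
    have sE: "vscale (L0 M) c a \<in> E" if "a \<in> E" for c a
      using sublattice that by (simp add: vector_sublattice_def)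
    then show "(case z of (c, x) \<Rightarrow> vscale R c x) \<in> E" if "z \<in> topspace (prod_topology euclideanreal ?T)" for z
      using that by auto
    have sr: "AE x in M. rep (vscale (L0 M) c a) x = c * rep a x" if "a \<in> E" for c a
      using L0_scale_ae(2) that subset_carrier by blast
    fix z A and e :: real assume z: "z \<in> topspace (prod_topology euclideanreal ?T)" and A: "A \<in> fmeasurable M" and e: "0 < e"
    obtain c a where ca: "z = (c, a)" "a \<in> E" using z by auto
    obtain d where d: "d > 0" "\<forall>c'. \<forall>b\<in>E. \<bar>c' - c\<bar> < d \<longrightarrow> (\<lambda>x. rep b x - rep a x) \<in> small M A d \<longrightarrow>
        (\<lambda>x. c' * rep b x - c * rep a x) \<in> small M A e" using small_scale_diff[OF A e ca(2)] by blast
    obtain U where U: "openin ?T U" "a \<in> U" "\<forall>b\<in>U. (\<lambda>x. rep b x - rep a x) \<in> small M A d"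
      by (rule measure_topology_nbhd[OF subset_carrier ca(2) A d(1)])
    have "(\<lambda>x. rep (vscale (L0 M) c' b) x - rep (vscale (L0 M) c a) x) \<in> small M A e"
      if c': "c' \<in> ball c d" and b: "b \<in> U" for c' b
    proof -
      have bE: "b \<in> E" using b openin_subset[OF U(1)] by auto
      have "\<bar>c' - c\<bar> < d" using c' by (simp add: dist_real_def abs_minus_commute)
      then have s: "(\<lambda>x. c' * rep b x - c * rep a x) \<in> small M A e" using d(2) bE U(3) b by blast
      show ?thesis
      proof (rule small_solid[OF A s])
        show "(\<lambda>x. rep (vscale (L0 M) c' b) x - rep (vscale (L0 M) c a) x) \<in> borel_measurable M"
          by (intro measurable diff rep_mem sE bE ca)
        show "AE x in M. x \<in> A \<longrightarrow> \<bar>rep (vscale (L0 M) c' b) x - rep (vscale (L0 M) c a) x\<bar>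
            \<le> \<bar>c' * rep b x - c * rep a x\<bar>"
          using sr[OF bE, of c'] sr[OF ca(2), of c] by eventually_elim simp
      qed
    qed
    then show "\<exists>N. openin (prod_topology euclideanreal ?T) N \<and> z \<in> N \<and>
        (\<forall>y\<in>N. (\<lambda>t. rep (case y of (c, x) \<Rightarrow> vscale R c x) t - rep (case z of (c, x) \<Rightarrow> vscale R c x) t) \<in> small M A e)"
      using U(1,2) d(1) by (intro exI[of _ "ball c d \<times> U"]) (auto simp: ca(1) openin_prod_Times_iff)
  qed
qed

lemma rep_vzero: "AE x in M. rep (vzero (L0 M)) x = 0"
  by (rule L0_zero_ae)

lemma small_diff_vzero_iff:
  assumes A: "A \<in> fmeasurable M" and b: "b \<in> E"
  shows "(\<lambda>x. rep b x - rep (vzero (L0 M)) x) \<in> small M A e \<longleftrightarrow> rep b \<in> small M A e"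
proof
  have m: "rep b \<in> borel_measurable M" "(\<lambda>x. rep b x - rep (vzero (L0 M)) x) \<in> borel_measurable M"
    by (intro measurable diff rep_mem b vzero_mem)+
  show "rep b \<in> small M A e" if "(\<lambda>x. rep b x - rep (vzero (L0 M)) x) \<in> small M A e"
    by (rule small_solid[OF A that m(1)]) (use rep_vzero in \<open>auto elim: eventually_mono\<close>)
  show "(\<lambda>x. rep b x - rep (vzero (L0 M)) x) \<in> small M A e" if "rep b \<in> small M A e"
    by (rule small_solid[OF A that m(2)]) (use rep_vzero in \<open>auto elim: eventually_mono\<close>)
qed

lemma locally_solid_measure_topology: "locally_solid R (measure_topology M E)"
  unfolding locally_solid_def
proof (intro conjI allI impI)
  let ?T = "measure_topology M E"
  show "linear_topology R ?T" by (rule linear_topology_measure_topology)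
  fix U assume "openin ?T U \<and> vzero R \<in> U"
  then have U: "openin ?T U" "vzero (L0 M) \<in> U" by auto
  obtain A e where A: "A \<in> fmeasurable M" "e > 0"
    "\<forall>b\<in>E. (\<lambda>x. rep b x - rep (vzero (L0 M)) x) \<in> small M A e \<longrightarrow> b \<in> U"
    using bspec[OF conjunct2[OF U(1)[unfolded openin_measure_topology]] U(2)] by blast
  let ?S = "{b\<in>E. rep b \<in> small M A e}"
  obtain W where W: "openin ?T W" "vzero (L0 M) \<in> W" "\<forall>b\<in>W. (\<lambda>x. rep b x - rep (vzero (L0 M)) x) \<in> small M A e"
    by (rule measure_topology_nbhd[OF subset_carrier vzero_mem A(1,2)])
  have WE: "W \<subseteq> E" using openin_subset[OF W(1)] by simp
  have "solid R ?S"
    unfolding solid_def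
  proof (intro conjI ballI impI)
    fix a b assume a: "a \<in> ?S" and b: "b \<in> carrier R" and le: "vabs R b \<sqsubseteq>\<^bsub>R\<^esub> vabs R a"
    have E: "a \<in> E" "b \<in> E" using a b by auto
    have "vabs R b = ae_class M (\<lambda>x. \<bar>rep b x\<bar>)" "vabs R a = ae_class M (\<lambda>x. \<bar>rep a x\<bar>)"
      using vabs_class[OF rep_mem[OF E(2)]] vabs_class[OF rep_mem[OF E(1)]] by (simp_all add: ae_class_rep E)
    then have "AE x in M. \<bar>rep b x\<bar> \<le> \<bar>rep a x\<bar>"
      using le le_iff[OF abs[OF rep_mem[OF E(2)]] abs[OF rep_mem[OF E(1)]]] by simp
    then have "AE x in M. x \<in> A \<longrightarrow> \<bar>rep b x\<bar> \<le> \<bar>rep a x\<bar>" by eventually_elim simp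
    then have "rep b \<in> small M A e" using a by (intro small_solid[OF A(1) _ measurable[OF rep_mem[OF E(2)]]]) auto
    then show "b \<in> ?S" using E by simp
  qed auto
  moreover have "?S \<subseteq> U" using A(3) small_diff_vzero_iff[OF A(1)] by auto
  moreover have "W \<subseteq> ?S" using W(3) WE small_diff_vzero_iff[OF A(1)] by auto
  ultimately show "\<exists>S W. solid R S \<and> S \<subseteq> U \<and> openin ?T W \<and> vzero R \<in> W \<and> W \<subseteq> S"
    using W(1,2) by (intro exI[of _ ?S] exI[of _ W]) simp
qed

text \<open>The moduli \<open>\<bar>f i - a\<bar>\<close> form a uo-null filter, and
  \<open>uo_null_small\<close> turns this into convergence in measure.\<close>

lemma uo_Lebesgue_measure_topology: "uo_Lebesgue R (measure_topology M E)"
  unfolding uo_Lebesgue_def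
proof (intro conjI allI impI locally_solid_measure_topology)
  fix I :: "(('a \<Rightarrow> real) set \<times> ('a \<Rightarrow> real) set set) set" and r f a
  assume "directed I r \<and> f \<in> I \<rightarrow> carrier R \<and> a \<in> carrier R \<and> uo_convergent R I r f a"
  then have I: "directed I r" and f: "f \<in> I \<rightarrow> E" and a: "a \<in> E" and uo: "uo_convergent R I r f a" by auto
  have ev: "eventually (\<lambda>i. i \<in> I) (net_filter I r)"
    unfolding eventually_net_filter[OF I] using directed_nonempty[OF I] by blast
  let ?G = "filtermap (\<lambda>i x. \<bar>rep (f i) x - rep a x\<bar>) (net_filter I r)"
  have fE: "eventually (\<lambda>i. f i \<in> E) (net_filter I r)" using ev by eventually_elim (use f in blast)
  have nn: "eventually (\<lambda>g. g \<in> F \<and> (AE x in M. 0 \<le> g x)) ?G"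
    unfolding eventually_filtermap using fE by eventually_elim (simp add: abs diff rep_mem a)
  have G: "uo_null ?G" by (rule uo_convergent_uo_null[OF I f a uo])
  show "limitin (measure_topology M E) f a (net_filter I r)"
    unfolding limitin_measure_topology[OF subset_carrier fE a]
  proof (intro ballI allI impI)
    fix A :: "'a set" and e :: real assume A: "A \<in> fmeasurable M" and e: "0 < e"
    have "eventually (\<lambda>i. (\<lambda>x. \<bar>rep (f i) x - rep a x\<bar>) \<in> small M A e) (net_filter I r)"
      using uo_null_small[OF nn G A e] by (simp add: eventually_filtermap)
    then show "eventually (\<lambda>i. (\<lambda>x. rep (f i) x - rep a x) \<in> small M A e) (net_filter I r)"
      using fE
    proof eventually_elim
      case (elim i)
      show ?case by (rule small_solid[OF A elim(1)]) (use elim(2) a in \<open>auto intro!: measurable[OF diff] rep_mem\<close>)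
    qed
  qed
qed

text \<open>By semi-finiteness two distinct classes already differ on a set of finite measure, so
  their difference lies outside some \<open>small M A e\<close>; balls of parameter
  \<open>e/2\<close> then separate them.\<close>

lemma Hausdorff_measure_topology:
  assumes sf: "semi_finite M"
  shows "Hausdorff_space (measure_topology M E)"
  unfolding Hausdorff_space_def
proof (intro allI impI)
  let ?T = "measure_topology M E"
  fix a b assume "a \<in> topspace ?T \<and> b \<in> topspace ?T \<and> a \<noteq> b"
  then have ab: "a \<in> E" "b \<in> E" "a \<noteq> b" by auto
  let ?d = "\<lambda>x. rep b x - rep a x"
  have m: "?d \<in> borel_measurable M" by (intro measurable diff rep_mem ab)
  have "\<exists>A\<in>fmeasurable M. \<exists>e>0. ?d \<notin> small M A e"
  proof (rule ccontr)
    assume "\<not> ?thesis"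
    then have s: "?d \<in> small M A e" if "A \<in> fmeasurable M" "e > 0" for A e using that by blast
    have "AE x in M. ?d x = 0"
    proof (rule AE_zero_on_fmeasurable[OF _ m])
      show "\<exists>C\<in>sets M. C \<subseteq> B \<and> 0 < emeasure M C \<and> emeasure M C < \<infinity>" if "B \<in> sets M" "emeasure M B = \<infinity>" for B
        using sf that unfolding semi_finite_def by blast
      show "AE x in M. x \<in> A \<longrightarrow> ?d x = 0" if "A \<in> fmeasurable M" for A
        by (rule small_AE_zero[OF that m s[OF that]])
    qed
    then have "AE x in M. rep a x = rep b x" by eventually_elim simp
    then show False using E_eqI[OF ab(1,2)] ab(3) by blast
  qed
  then obtain A e where A: "A \<in> fmeasurable M" "e > 0" "?d \<notin> small M A e" by blast
  have e2: "0 < e/2" using A(2) by simp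
  obtain U where U: "openin ?T U" "a \<in> U" "\<forall>c\<in>U. (\<lambda>x. rep c x - rep a x) \<in> small M A (e/2)"
    by (rule measure_topology_nbhd[OF subset_carrier ab(1) A(1) e2])
  obtain V where V: "openin ?T V" "b \<in> V" "\<forall>c\<in>V. (\<lambda>x. rep c x - rep b x) \<in> small M A (e/2)"
    by (rule measure_topology_nbhd[OF subset_carrier ab(2) A(1) e2])
  have False if c: "c \<in> U" "c \<in> V" for c
  proof -
    have cE: "c \<in> E" using openin_subset[OF U(1)] c by auto
    have s: "(\<lambda>x. rep c x - rep b x) \<in> small M A (e/2)" using V(3) c by blast
    have "(\<lambda>x. rep b x - rep c x) \<in> small M A (e/2)"
      by (rule small_solid[OF A(1) s]) (auto intro!: measurable[OF diff] rep_mem cE ab simp: abs_minus_commute)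
    then have "?d \<in> small M A e" using small_diff_trans[OF A(1), of "rep c" "rep a" e "rep b"] U(3) c by blast
    then show False using A(3) by blast
  qed
  then show "\<exists>U V. openin ?T U \<and> openin ?T V \<and> a \<in> U \<and> b \<in> V \<and> disjnt U V"
    using U(1,2) V(1,2) by (intro exI[of _ U] exI[of _ V]) (auto simp: disjnt_iff)
qed

lemma hausdorff_uo_Lebesgue_iff:
  assumes "semi_finite M"
  shows "hausdorff_uo_Lebesgue R T \<longleftrightarrow> T = measure_topology M E"
  using hausdorff_uo_Lebesgue_unique[OF assms, of T] uo_Lebesgue_measure_topology Hausdorff_measure_topology[OF assms]
  by (auto simp: hausdorff_uo_Lebesgue_def)

lemma uo_Lebesgue_topology_eq:
  assumes "semi_finite M"
  shows "uo_Lebesgue_topology R = measure_topology M E"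
  unfolding uo_Lebesgue_topology_def hausdorff_uo_Lebesgue_iff[OF assms] by simp

lemma limitin_vzero_iff:
  assumes "eventually (\<lambda>i. f i \<in> E) G"
  shows "limitin (measure_topology M E) f (vzero (L0 M)) G \<longleftrightarrow>
    (\<forall>A\<in>fmeasurable M. \<forall>e>0. eventually (\<lambda>i. rep (f i) \<in> small M A e) G)"
proof -
  have "eventually (\<lambda>i. (\<lambda>x. rep (f i) x - rep (vzero (L0 M)) x) \<in> small M A e) G \<longleftrightarrow>
      eventually (\<lambda>i. rep (f i) \<in> small M A e) G" if A: "A \<in> fmeasurable M" for A e
    by (rule eventually_cong[OF assms]) (rule small_diff_vzero_iff[OF A])
  then show ?thesis unfolding limitin_measure_topology[OF subset_carrier assms vzero_mem] by simp
qed

end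

text \<open>Regularity is immediate, as restricting \<open>L0 M\<close> to its own carrier changes
  nothing.\<close>

lemma L0_regular_carrier: "L0_regular M (carrier (L0 M))"
proof -
  interpret V: vector_lattice "L0 M" by (rule vector_lattice_L0)
  have sub: "vector_sublattice (L0 M) (carrier (L0 M))"
    unfolding vector_sublattice_def
    by (intro conjI ballI allI subset_refl L0_zero_ae L0_add_ae L0_scale_ae V.join_closed V.meet_closed)
  then have "regular_sublattice (L0 M) (carrier (L0 M))"
    by (simp add: regular_sublattice_def restrict_vl_carrier)
  then show ?thesis using sub by unfold_locales
qed

section \<open>Integral criteria\<close>

lemma ennreal_tendsto_0I:
  fixes f :: "'i \<Rightarrow> ennreal"
  assumes "\<And>e::real. 0 < e \<Longrightarrow> eventually (\<lambda>i. f i < ennreal e) G"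
  shows "(f \<longlongrightarrow> 0) G"
proof (rule order_tendstoI)
  fix u :: ennreal assume "0 < u"
  then obtain r where r: "0 < r" "r < u" using dense by blast
  then obtain e where "r = ennreal e" by (cases r rule: ennreal_cases) auto
  with r have "0 < e" "\<And>i. f i < ennreal e \<Longrightarrow> f i < u" by auto
  then show "eventually (\<lambda>i. f i < u) G" using assms[of e] by (auto elim: eventually_mono)
qed simp

text \<open>A level \<open>e\<close> and a measure bound \<open>d\<close> chosen independently are
  covered by the single parameter \<open>min d e\<close>; conversely both may be taken
  equal.\<close>

lemma eventually_small_iff_emeasure_tendsto:
  fixes g :: "'i \<Rightarrow> 'x \<Rightarrow> real"
  assumes g: "eventually (\<lambda>i. g i \<in> borel_measurable M) G"
  shows "(\<forall>A\<in>fmeasurable M. \<forall>e>0. eventually (\<lambda>i. g i \<in> small M A e) G) \<longleftrightarrow>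
    (\<forall>A\<in>fmeasurable M. \<forall>e>0. ((\<lambda>i. emeasure M {x\<in>A. e \<le> \<bar>g i x\<bar>}) \<longlongrightarrow> 0) G)"
proof (intro iffI ballI allI impI)
  fix A :: "'x set" and e :: real
  assume A: "A \<in> fmeasurable M" and e: "0 < e"
  have eq: "emeasure M {x\<in>A. e \<le> \<bar>h x\<bar>} = ennreal (measure M {x\<in>A. e \<le> \<bar>h x\<bar>})"
    if "h \<in> borel_measurable M" for h :: "'x \<Rightarrow> real" and e
    using fmeasurableD2[OF level_fmeasurable[OF A that]] by (rule emeasure_eq_ennreal_measure)
  {
    assume "\<forall>A\<in>fmeasurable M. \<forall>e>0. eventually (\<lambda>i. g i \<in> small M A e) G"
    then have *: "eventually (\<lambda>i. g i \<in> small M A d) G" if "d > 0" for d using A that by blast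
    show "((\<lambda>i. emeasure M {x\<in>A. e \<le> \<bar>g i x\<bar>}) \<longlongrightarrow> 0) G"
    proof (rule ennreal_tendsto_0I)
      fix d :: real assume d: "0 < d"
      have "eventually (\<lambda>i. g i \<in> small M A (min d e)) G" using * d e by simp
      with g show "eventually (\<lambda>i. emeasure M {x\<in>A. e \<le> \<bar>g i x\<bar>} < ennreal d) G"
      proof eventually_elim
        case (elim i)
        have "measure M {x\<in>A. e \<le> \<bar>g i x\<bar>} \<le> measure M {x\<in>A. min d e \<le> \<bar>g i x\<bar>}"
          using elim A by (intro measure_mono_AE level_fmeasurable) auto
        also have "\<dots> < d" using elim by (simp add: small_def)
        finally show ?case using eq[OF elim(1)] d by (simp add: ennreal_less_iff)
      qed
    qed
  next
    assume "\<forall>A\<in>fmeasurable M. \<forall>e>0. ((\<lambda>i. emeasure M {x\<in>A. e \<le> \<bar>g i x\<bar>}) \<longlongrightarrow> 0) G"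
    then have "((\<lambda>i. emeasure M {x\<in>A. e \<le> \<bar>g i x\<bar>}) \<longlongrightarrow> 0) G" using A e by blast
    then have "eventually (\<lambda>i. emeasure M {x\<in>A. e \<le> \<bar>g i x\<bar>} < ennreal e) G"
      by (rule order_tendstoD) (use e in simp)
    with g show "eventually (\<lambda>i. g i \<in> small M A e) G"
    proof eventually_elim
      case (elim i)
      then show ?case using eq[OF elim(1), of e] e by (simp add: small_def ennreal_less_iff)
    qed
  }
qed

text \<open>Where \<open>\<bar>g i\<bar> < d \<le> 1\<close>, the integrand is at most
  \<open>d\<close>, as \<open>p \<ge> 1\<close>; elsewhere in \<open>B\<close> it is at most
  \<open>K\<close>, on a set of measure below \<open>d\<close>.\<close>

lemma nn_integral_min_tendsto:
  fixes g :: "'i \<Rightarrow> 'x \<Rightarrow> real"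
  assumes g: "eventually (\<lambda>i. g i \<in> borel_measurable M) G" and p: "1 \<le> p" and K: "0 \<le> K"
    and B: "B \<in> fmeasurable M" and small: "\<And>e. 0 < e \<Longrightarrow> eventually (\<lambda>i. g i \<in> small M B e) G"
  shows "((\<lambda>i. \<integral>\<^sup>+x. ennreal (min (\<bar>g i x\<bar> powr p) K * indicator B x) \<partial>M) \<longlongrightarrow> 0) G"
proof (rule ennreal_tendsto_0I)
  fix e :: real assume e: "0 < e"
  \<comment> \<open>The two contributions together are at most \<open>d * (measure M B + K)\<close>,
    so \<open>d \<le> e / (2 * L)\<close> keeps them below \<open>e\<close>; the summand 1 makes
    \<open>L\<close> positive.\<close>
  define L where "L = measure M B + K + 1"
  have L: "L \<ge> 1" using K by (simp add: L_def)
  define d where "d = min 1 (e / (2 * L))"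
  have d: "0 < d" "d \<le> 1" "d \<le> e / (2 * L)" using e L by (auto simp: d_def)
  show "eventually (\<lambda>i. (\<integral>\<^sup>+x. ennreal (min (\<bar>g i x\<bar> powr p) K * indicator B x) \<partial>M) < ennreal e) G"
    using g small[OF d(1)]
  proof eventually_elim
    case (elim i)
    let ?S = "{x\<in>B. d \<le> \<bar>g i x\<bar>}"
    have S: "?S \<in> fmeasurable M" by (rule level_fmeasurable[OF B elim(1)])
    have "(\<integral>\<^sup>+x. ennreal (min (\<bar>g i x\<bar> powr p) K * indicator B x) \<partial>M)
        \<le> (\<integral>\<^sup>+x. ennreal d * indicator B x + ennreal K * indicator ?S x \<partial>M)"
    proof (rule nn_integral_mono)
      fix x
      have "\<bar>g i x\<bar> powr p \<le> d" if "\<not> d \<le> \<bar>g i x\<bar>"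
      proof -
        have "\<bar>g i x\<bar> powr p \<le> \<bar>g i x\<bar> powr 1" using that d(2) p by (intro powr_mono') auto
        then show ?thesis using that by auto
      qed
      then show "ennreal (min (\<bar>g i x\<bar> powr p) K * indicator B x) \<le> ennreal d * indicator B x + ennreal K * indicator ?S x"
        using K d(1) by (auto simp: indicator_def ennreal_plus[symmetric] simp del: ennreal_plus intro!: ennreal_leI)
    qed
    also have "\<dots> = ennreal d * emeasure M B + ennreal K * emeasure M ?S"
      using B S by (subst nn_integral_add) (auto simp: nn_integral_cmult_indicator)
    also have "\<dots> = ennreal (d * measure M B + K * measure M ?S)"
      using fmeasurableD2[OF B] fmeasurableD2[OF S] d(1) K
      by (simp add: emeasure_eq_ennreal_measure ennreal_mult)
    also have "\<dots> < ennreal e"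
    proof (rule ennreal_lessI[OF e])
      have "K * measure M ?S \<le> K * d" using elim(2) K by (intro mult_left_mono) (auto simp: small_def)
      then have "d * measure M B + K * measure M ?S \<le> d * L" using d(1) by (simp add: L_def algebra_simps)
      also have "\<dots> \<le> e / (2 * L) * L" using d(3) L by (intro mult_right_mono) auto
      also have "\<dots> < e" using L e by simp
      finally show "d * measure M B + K * measure M ?S < e" .
    qed
    finally show ?case .
  qed
qed

lemma nn_integral_min_indicator_tendsto_iff:
  fixes g :: "'i \<Rightarrow> 'x \<Rightarrow> real"
  assumes g: "eventually (\<lambda>i. g i \<in> borel_measurable M) G" and p: "1 \<le> p"
  shows "(\<forall>A\<in>fmeasurable M. \<forall>e>0. eventually (\<lambda>i. g i \<in> small M A e) G) \<longleftrightarrow>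
    (\<forall>A\<in>fmeasurable M. ((\<lambda>i. \<integral>\<^sup>+x. ennreal (min (\<bar>g i x\<bar> powr p) (indicator A x)) \<partial>M) \<longlongrightarrow> 0) G)"
proof (intro iffI ballI allI impI)
  fix A :: "'x set" assume A: "A \<in> fmeasurable M"
  {
    assume "\<forall>A\<in>fmeasurable M. \<forall>e>0. eventually (\<lambda>i. g i \<in> small M A e) G"
    then have *: "eventually (\<lambda>i. g i \<in> small M A d) G" if "d > 0" for d using A that by blast
    have eq: "min (\<bar>g i x\<bar> powr p) (indicator A x) = min (\<bar>g i x\<bar> powr p) 1 * indicator A x" for i x
      by (simp add: indicator_def)
    show "((\<lambda>i. \<integral>\<^sup>+x. ennreal (min (\<bar>g i x\<bar> powr p) (indicator A x)) \<partial>M) \<longlongrightarrow> 0) G"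
      unfolding eq by (rule nn_integral_min_tendsto[OF g p _ A *]) auto
  next
    fix e :: real assume e: "0 < e"
      and "\<forall>A\<in>fmeasurable M. ((\<lambda>i. \<integral>\<^sup>+x. ennreal (min (\<bar>g i x\<bar> powr p) (indicator A x)) \<partial>M) \<longlongrightarrow> 0) G"
    then have *: "((\<lambda>i. \<integral>\<^sup>+x. ennreal (min (\<bar>g i x\<bar> powr p) (indicator A x)) \<partial>M) \<longlongrightarrow> 0) G" using A by blast
    \<comment> \<open>On the level set of \<open>e\<close> inside \<open>A\<close>, \<open>d\<close>
      bounds both \<open>\<bar>g i\<bar> powr p\<close> and the indicator from below, the latter
      because of the minimum with 1. Chebyshev's inequality then bounds the measure of that
      set.\<close>
    define d where "d = min 1 e powr p"
    have d: "0 < d" "d \<le> 1" using e p powr_mono2[of p "min 1 e" 1] by (auto simp: d_def)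
    have "eventually (\<lambda>i. (\<integral>\<^sup>+x. ennreal (min (\<bar>g i x\<bar> powr p) (indicator A x)) \<partial>M) < ennreal (d * e)) G"
      by (rule order_tendstoD(2)[OF *]) (use d e in simp)
    with g show "eventually (\<lambda>i. g i \<in> small M A e) G"
    proof eventually_elim
      case (elim i)
      let ?S = "{x\<in>A. e \<le> \<bar>g i x\<bar>}"
      have S: "?S \<in> fmeasurable M" by (rule level_fmeasurable[OF A elim(1)])
      have "ennreal (d * measure M ?S) = (\<integral>\<^sup>+x. ennreal d * indicator ?S x \<partial>M)"
        using S d fmeasurableD2[OF S] by (simp add: nn_integral_cmult_indicator fmeasurableD emeasure_eq_ennreal_measure ennreal_mult)
      also have "\<dots> \<le> (\<integral>\<^sup>+x. ennreal (min (\<bar>g i x\<bar> powr p) (indicator A x)) \<partial>M)"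
      proof (rule nn_integral_mono)
        fix x
        have "d \<le> \<bar>g i x\<bar> powr p" if "x \<in> ?S"
          unfolding d_def by (rule powr_mono2) (use p e that in auto)
        then show "ennreal d * indicator ?S x \<le> ennreal (min (\<bar>g i x\<bar> powr p) (indicator A x))"
          using d by (auto simp: indicator_def intro!: ennreal_leI)
      qed
      also note elim(2)
      finally have "d * measure M ?S < d * e" using d by (simp add: ennreal_less_iff)
      then show ?case using d(1) elim(1) by (simp add: small_def)
    qed
  }
qed

text \<open>Apart from a part of small integral, \<open>h\<close> lives on a set of finite measure
  on which it is bounded, and there the minimum with a constant suffices.\<close>

lemma nn_integral_min_powr_tendsto:
  fixes g :: "'i \<Rightarrow> 'x \<Rightarrow> real"
  assumes g: "eventually (\<lambda>i. g i \<in> borel_measurable M) G" and p: "1 \<le> p"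
    and h [measurable]: "h \<in> borel_measurable M" and hp: "(\<integral>\<^sup>+x. ennreal (\<bar>h x\<bar> powr p) \<partial>M) < \<infinity>"
    and small: "\<And>A e. A \<in> fmeasurable M \<Longrightarrow> 0 < e \<Longrightarrow> eventually (\<lambda>i. g i \<in> small M A e) G"
  shows "((\<lambda>i. \<integral>\<^sup>+x. ennreal (min (\<bar>g i x\<bar> powr p) (\<bar>h x\<bar> powr p)) \<partial>M) \<longlongrightarrow> 0) G"
proof (rule ennreal_tendsto_0I)
  fix e :: real assume e: "0 < e"
  \<comment> \<open>The lower bound on \<open>\<bar>h\<bar>\<close> gives finite measure by
    integrability, the upper one bounds the integrand. The sets exhaust the support of
    \<open>h\<close>, and the rest tends to zero by dominated convergence.\<close>
  define B where "B n = {x\<in>space M. 1 / real (Suc n) \<le> \<bar>h x\<bar> \<and> \<bar>h x\<bar> \<le> real (Suc n)}" for n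
  have B_sets [measurable]: "B n \<in> sets M" for n unfolding B_def by measurable
  have B: "B n \<in> fmeasurable M" for n
  proof (rule fmeasurableI[OF B_sets])
    let ?c = "(1 / real (Suc n)) powr p"
    have "ennreal ?c * emeasure M (B n) = (\<integral>\<^sup>+x. ennreal ?c * indicator (B n) x \<partial>M)"
      by (simp add: nn_integral_cmult_indicator)
    also have "\<dots> \<le> (\<integral>\<^sup>+x. ennreal (\<bar>h x\<bar> powr p) \<partial>M)"
    proof (rule nn_integral_mono)
      fix x
      have "?c \<le> \<bar>h x\<bar> powr p" if "x \<in> B n" by (rule powr_mono2) (use p that in \<open>auto simp: B_def\<close>)
      then show "ennreal ?c * indicator (B n) x \<le> ennreal (\<bar>h x\<bar> powr p)"
        by (auto simp: indicator_def intro!: ennreal_leI)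
    qed
    also note hp
    finally have *: "ennreal ?c * emeasure M (B n) < \<infinity>" .
    have "ennreal ?c \<noteq> 0" by simp
    then show "emeasure M (B n) < \<infinity>" using * by (auto simp: ennreal_mult_less_top less_top[symmetric])
  qed
  have "(\<lambda>n. \<integral>\<^sup>+x. ennreal (\<bar>h x\<bar> powr p) * indicator (space M - B n) x \<partial>M) \<longlonglongrightarrow> (\<integral>\<^sup>+x. 0 \<partial>M)"
  proof (rule nn_integral_dominated_convergence[where w = "\<lambda>x. ennreal (\<bar>h x\<bar> powr p)"])
    show "AE x in M. (\<lambda>n. ennreal (\<bar>h x\<bar> powr p) * indicator (space M - B n) x) \<longlonglongrightarrow> 0"
    proof (rule AE_I2)
      fix x assume x: "x \<in> space M"
      show "(\<lambda>n. ennreal (\<bar>h x\<bar> powr p) * indicator (space M - B n) x) \<longlonglongrightarrow> 0"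
      proof (cases "h x = 0")
        case False
        obtain k where k: "inverse (real (Suc k)) < \<bar>h x\<bar>" using reals_Archimedean[of "\<bar>h x\<bar>"] False by auto
        obtain l where l: "\<bar>h x\<bar> < real l" using reals_Archimedean2 by blast
        have "x \<in> B n" if n: "Orderings.max k l \<le> n" for n
        proof -
          have "1 / real (Suc n) \<le> 1 / real (Suc k)" using n by (intro divide_left_mono) auto
          then show ?thesis using k l n x by (auto simp: B_def inverse_eq_divide)
        qed
        then have "\<forall>\<^sub>F n in sequentially. ennreal (\<bar>h x\<bar> powr p) * indicator (space M - B n) x = 0"
          unfolding eventually_sequentially by (intro exI[of _ "Orderings.max k l"]) simp
        then show ?thesis by (rule tendsto_eventually)
      qed simp
    qed
  qed (use hp in \<open>auto simp: indicator_def\<close>)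
  then have "\<forall>\<^sub>F n in sequentially. (\<integral>\<^sup>+x. ennreal (\<bar>h x\<bar> powr p) * indicator (space M - B n) x \<partial>M) < ennreal (e/2)"
    by (rule order_tendstoD) (use e in simp)
  then obtain n where n: "(\<integral>\<^sup>+x. ennreal (\<bar>h x\<bar> powr p) * indicator (space M - B n) x \<partial>M) < ennreal (e/2)"
    by (auto simp: eventually_sequentially)
  let ?K = "real (Suc n) powr p"
  have "((\<lambda>i. \<integral>\<^sup>+x. ennreal (min (\<bar>g i x\<bar> powr p) ?K * indicator (B n) x) \<partial>M) \<longlongrightarrow> 0) G"
    by (rule nn_integral_min_tendsto[OF g p _ B small[OF B]]) auto
  then have "eventually (\<lambda>i. (\<integral>\<^sup>+x. ennreal (min (\<bar>g i x\<bar> powr p) ?K * indicator (B n) x) \<partial>M) < ennreal (e/2)) G"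
    by (rule order_tendstoD) (use e in simp)
  with g show "eventually (\<lambda>i. (\<integral>\<^sup>+x. ennreal (min (\<bar>g i x\<bar> powr p) (\<bar>h x\<bar> powr p)) \<partial>M) < ennreal e) G"
  proof eventually_elim
    case (elim i)
    note [measurable] = elim(1)
    have "(\<integral>\<^sup>+x. ennreal (min (\<bar>g i x\<bar> powr p) (\<bar>h x\<bar> powr p)) \<partial>M)
        \<le> (\<integral>\<^sup>+x. ennreal (min (\<bar>g i x\<bar> powr p) ?K * indicator (B n) x)
              + ennreal (\<bar>h x\<bar> powr p) * indicator (space M - B n) x \<partial>M)"
    proof (rule nn_integral_mono)
      fix x assume x: "x \<in> space M"
      have "\<bar>h x\<bar> powr p \<le> ?K" if "x \<in> B n" by (rule powr_mono2) (use p that in \<open>auto simp: B_def\<close>)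
      then show "ennreal (min (\<bar>g i x\<bar> powr p) (\<bar>h x\<bar> powr p))
          \<le> ennreal (min (\<bar>g i x\<bar> powr p) ?K * indicator (B n) x) + ennreal (\<bar>h x\<bar> powr p) * indicator (space M - B n) x"
        using x by (cases "x \<in> B n") (auto intro!: ennreal_leI simp del: of_nat_Suc)
    qed
    also have "\<dots> = (\<integral>\<^sup>+x. ennreal (min (\<bar>g i x\<bar> powr p) ?K * indicator (B n) x) \<partial>M)
              + (\<integral>\<^sup>+x. ennreal (\<bar>h x\<bar> powr p) * indicator (space M - B n) x \<partial>M)"
      by (rule nn_integral_add) measurable
    also have "\<dots> < ennreal (e/2) + ennreal (e/2)" using elim(2) n by (rule add_strict_mono)
    also have "\<dots> = ennreal e" using e by (simp add: ennreal_plus[symmetric] del: ennreal_plus)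
    finally show ?case .
  qed
qed

lemma nn_integral_min_Lp_tendsto_iff:
  fixes g :: "'i \<Rightarrow> 'x \<Rightarrow> real"
  assumes g: "eventually (\<lambda>i. g i \<in> borel_measurable M) G" and p: "1 \<le> p"
  shows "(\<forall>A\<in>fmeasurable M. \<forall>e>0. eventually (\<lambda>i. g i \<in> small M A e) G) \<longleftrightarrow>
    (\<forall>h\<in>Lp M p. ((\<lambda>i. \<integral>\<^sup>+x. ennreal (min (\<bar>g i x\<bar> powr p) (\<bar>rep h x\<bar> powr p)) \<partial>M) \<longlongrightarrow> 0) G)"
    (is "?L \<longleftrightarrow> ?R")
proof
  assume L: ?L
  show ?R
  proof
    fix h assume "h \<in> Lp M p"
    then show "((\<lambda>i. \<integral>\<^sup>+x. ennreal (min (\<bar>g i x\<bar> powr p) (\<bar>rep h x\<bar> powr p)) \<partial>M) \<longlongrightarrow> 0) G"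
      using L by (intro nn_integral_min_powr_tendsto[OF g p]) (auto simp: Lp_def rep_measurable)
  qed
next
  assume R: ?R
  show ?L
    unfolding nn_integral_min_indicator_tendsto_iff[OF g p]
  proof
    fix A :: "'x set" assume A: "A \<in> fmeasurable M"
    \<comment> \<open>The indicator of a set of finite measure lies in \<open>Lp M p\<close>, and
      its \<open>p\<close>-th power is itself, so the criterion for \<open>Lp\<close> contains the
      one for sets.\<close>
    let ?h = "ae_class M (indicator A)"
    have m: "(indicator A :: 'x \<Rightarrow> real) \<in> borel_measurable M" using A by auto
    have "AE x in M. rep ?h x = indicator A x" by (rule rep_ae_class(2)[OF m])
    then have h: "AE x in M. \<bar>rep ?h x\<bar> powr p = indicator A x"
      by eventually_elim (use p in \<open>auto simp: indicator_def\<close>)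
    have "(\<integral>\<^sup>+x. ennreal (\<bar>rep ?h x\<bar> powr p) \<partial>M) = (\<integral>\<^sup>+x. indicator A x \<partial>M)"
      by (rule nn_integral_cong_AE) (use h in \<open>eventually_elim, auto simp: indicator_def\<close>)
    also have "\<dots> < \<infinity>" using A by (auto simp: fmeasurable_def)
    finally have "?h \<in> Lp M p" using ae_class_in_L0[OF m] by (simp add: Lp_def)
    then have "((\<lambda>i. \<integral>\<^sup>+x. ennreal (min (\<bar>g i x\<bar> powr p) (\<bar>rep ?h x\<bar> powr p)) \<partial>M) \<longlongrightarrow> 0) G" using R by blast
    moreover have "(\<integral>\<^sup>+x. ennreal (min (\<bar>g i x\<bar> powr p) (\<bar>rep ?h x\<bar> powr p)) \<partial>M)
        = (\<integral>\<^sup>+x. ennreal (min (\<bar>g i x\<bar> powr p) (indicator A x)) \<partial>M)" for i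
      by (rule nn_integral_cong_AE) (use h in \<open>eventually_elim, simp\<close>)
    ultimately show "((\<lambda>i. \<integral>\<^sup>+x. ennreal (min (\<bar>g i x\<bar> powr p) (indicator A x)) \<partial>M) \<longlongrightarrow> 0) G" by simp
  qed
qed

theorem theorem6p3:
  fixes M :: "'x measure" and E :: "('x \<Rightarrow> real) set set"
  assumes "semi_finite M"
    and "regular_sublattice (L0 M) E"
  shows "(\<exists>!T. hausdorff_uo_Lebesgue (restrict_vl (L0 M) E) T) \<and>
    (\<exists>!T. hausdorff_uo_Lebesgue (L0 M) T) \<and>
    uo_Lebesgue_topology (restrict_vl (L0 M) E) = subtopology (uo_Lebesgue_topology (L0 M)) E \<and>
    (\<forall>p::real. 1 \<le> p \<longrightarrow>
      (\<forall>(I :: 'i set) r f. directed I r \<and> f \<in> I \<rightarrow> E \<longrightarrow>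
        (limitin (uo_Lebesgue_topology (restrict_vl (L0 M) E)) f (vzero (L0 M)) (net_filter I r) \<longleftrightarrow>
          (\<forall>A\<in>sets M. emeasure M A < \<infinity> \<longrightarrow>
            ((\<lambda>i. \<integral>\<^sup>+x. min (\<bar>rep (f i) x\<bar> powr p) (indicator A x) \<partial>M) \<longlongrightarrow> 0) (net_filter I r))) \<and>
        (limitin (uo_Lebesgue_topology (restrict_vl (L0 M) E)) f (vzero (L0 M)) (net_filter I r) \<longleftrightarrow>
          (\<forall>g\<in>Lp M p.
            ((\<lambda>i. \<integral>\<^sup>+x. min (\<bar>rep (f i) x\<bar> powr p) (\<bar>rep g x\<bar> powr p) \<partial>M) \<longlongrightarrow> 0) (net_filter I r))) \<and>
        (limitin (uo_Lebesgue_topology (restrict_vl (L0 M) E)) f (vzero (L0 M)) (net_filter I r) \<longleftrightarrow>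
          converges_in_measure M I r f (vzero (L0 M))))) \<and>
    (\<forall>(I :: 'i set) r f. directed I r \<and> f \<in> I \<rightarrow> E \<longrightarrow>
      (limitin (uo_Lebesgue_topology (restrict_vl (L0 M) E)) f (vzero (L0 M)) (net_filter I r) \<longleftrightarrow>
        converges_in_measure M I r f (vzero (L0 M))))"
proof -
  interpret E: L0_regular M E
    using assms(2) by unfold_locales (simp_all add: regular_sublattice_def)
  \<comment> \<open>The uniqueness and existence results applied to the whole space; both topologies
    become \<open>measure_topology\<close>, so the restriction claim is
    \<open>subtopology_measure_topology\<close>.\<close>
  interpret L: L0_regular M "carrier (L0 M)" by (rule L0_regular_carrier)
  note E = E.hausdorff_uo_Lebesgue_iff[OF assms(1)] E.uo_Lebesgue_topology_eq[OF assms(1)]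
  note L = L.hausdorff_uo_Lebesgue_iff[OF assms(1), unfolded restrict_vl_carrier]
    L.uo_Lebesgue_topology_eq[OF assms(1), unfolded restrict_vl_carrier]
  let ?lim = "\<lambda>(I :: 'i set) r f. limitin (measure_topology M E) f (vzero (L0 M)) (net_filter I r)"
  have fm: "(\<forall>A\<in>fmeasurable M. P A) \<longleftrightarrow> (\<forall>A\<in>sets M. emeasure M A < \<infinity> \<longrightarrow> P A)" for P
    by (auto simp: fmeasurable_def)
  have "(?lim I r f \<longleftrightarrow> converges_in_measure M I r f (vzero (L0 M))) \<and>
    (1 \<le> p \<longrightarrow> (?lim I r f \<longleftrightarrow> (\<forall>A\<in>sets M. emeasure M A < \<infinity> \<longrightarrow>
        ((\<lambda>i. \<integral>\<^sup>+x. min (\<bar>rep (f i) x\<bar> powr p) (indicator A x) \<partial>M) \<longlongrightarrow> 0) (net_filter I r))) \<and>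
      (?lim I r f \<longleftrightarrow> (\<forall>g\<in>Lp M p.
        ((\<lambda>i. \<integral>\<^sup>+x. min (\<bar>rep (f i) x\<bar> powr p) (\<bar>rep g x\<bar> powr p) \<partial>M) \<longlongrightarrow> 0) (net_filter I r))))"
    if I: "directed I r" and f: "f \<in> I \<rightarrow> E" for I :: "'i set" and r f p
  proof -
    have "eventually (\<lambda>i. i \<in> I) (net_filter I r)"
      unfolding eventually_net_filter[OF I] using directed_nonempty[OF I] by blast
    then have fE: "eventually (\<lambda>i. f i \<in> E) (net_filter I r)" by eventually_elim (use f in blast)
    have m: "eventually (\<lambda>i. rep (f i) \<in> borel_measurable M) (net_filter I r)"
      using fE by eventually_elim (intro E.measurable E.rep_mem)
    \<comment> \<open>Convergence in measure is stated with the representative of zero, which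
      vanishes only almost everywhere; the difference is kept for that criterion, while
      \<open>limitin_vzero_iff\<close> removes it for the integral criteria.\<close>
    have m0: "eventually (\<lambda>i. (\<lambda>x. rep (f i) x - rep (vzero (L0 M)) x) \<in> borel_measurable M) (net_filter I r)"
      using fE by eventually_elim (intro E.measurable E.diff E.rep_mem E.vzero_mem)
    have "?lim I r f \<longleftrightarrow> converges_in_measure M I r f (vzero (L0 M))"
      unfolding limitin_measure_topology[OF E.subset_carrier fE E.vzero_mem]
        eventually_small_iff_emeasure_tendsto[OF m0] converges_in_measure_def fm ..
    then show ?thesis
      using nn_integral_min_indicator_tendsto_iff[OF m, of p] nn_integral_min_Lp_tendsto_iff[OF m, of p]
      unfolding E.limitin_vzero_iff[OF fE] fm by blast
  qed
  then show ?thesis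
    unfolding E L using subtopology_measure_topology[OF E.subset_carrier] by blast
qed

end
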